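(* Let $V$ be a complex vector space of finite dimension at least $2$ and let $f$ be an irreducible EKP-homaloidal polynomial function of degree three on $V$. Let $V(f)\subset \mathbb{P}(V)$ be the hypersurface defined by $f$. Then the singular locus of $V(f)$ is one of the four classical Severi varieties, and the secant variety of this singular locus is $V(f)$.
   Context: Let $V$ be a complex vector space of finite dimension $\geq 2$ with dual $V^*$. For a function $f$ on $V$ and $x\in V$, $f'(x)\in V^*$ denotes the differential of $f$ at $x$. Multiplicative Legendre transform: if $f$ is a homogeneous function on $V$ such that the Hessian of $\ln f$ is generically invertible (i.e. $\det \mathrm{Hess}(\ln f)$ is not identically zero), its multiplicative Legendre transform $f_*$ is the homogeneous function on $V^*$ satisfying $f_*\left(\frac{f'(x)}{f(x)}\right)=\frac{1}{f(x)}$ for all $x$ in an open subset of $V$ (such a function always exists). EKP-homaloidal: a homogeneous polynomial function $f$ on $V$ with $\det\mathrm{Hess}(\ln f)\neq 0$ is called EKP-homaloidal if its multiplicative Legendre transform $f_*$ is again a polynomial. In this case $f_*$ is homogeneous and $\deg f_*=\deg f$. Secant variety: for a projective variety $W\subset\mathbb{P}(V)$, its secant variety is the closure of the union of all secant lines in $\mathbb{P}(V)$ passing through two distinct points of $W$. The four classical Severi varieties are, up to projective equivalence: the Veronese surface $v_2(\mathbb{P}^2)\subset\mathbb{P}^5$; the Segre variety $\mathbb{P}^2\times\mathbb{P}^2\subset\mathbb{P}^8$; the Grassmannian $G(2,6)\subset\mathbb{P}^{14}$ in its Plücker embedding; and the $16$-dimensional variety $E_6/P_1\subset\mathbb{P}^{26}$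 (the Cayley plane, i.e. the closed orbit of the group $E_6$ in the projectivization of its $27$-dimensional minuscule representation). *)

theory Defs
  imports
    "HOL-Analysis.Analysis"
    "HOL-Library.Poly_Mapping"
    "HOL-Computational_Algebra.Factorial_Ring"
begin

section \<open>Polynomials and polynomial functions\<close>

text \<open>
  The vector space \<open>V\<close> is \<^typ>\<open>complex^'n\<close>. Its dual is identified with \<^typ>\<open>complex^'n\<close> through
  the dual basis: \<open>y\<close> stands for the linear form mapping \<open>x\<close> to the sum of all \<open>y $ i * x $ i\<close>.
  A monomial is a finitely supported family of exponents, and a polynomial is a finitely
  supported family of coefficients indexed by monomials.
\<close>

type_synonym 'n mpoly = "('n \<Rightarrow>\<^sub>0 nat) \<Rightarrow>\<^sub>0 complex"

definition poly_fun :: "'n::finite mpoly \<Rightarrow> complex^'n \<Rightarrow> complex" where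
  "poly_fun p x =
     (\<Sum>m \<in> Poly_Mapping.keys p. Poly_Mapping.lookup p m * (\<Prod>i\<in>UNIV. (x $ i) ^ Poly_Mapping.lookup m i))"

definition homogeneous_poly :: "nat \<Rightarrow> 'n::finite mpoly \<Rightarrow> bool" where
  "homogeneous_poly d p \<longleftrightarrow> (\<forall>m \<in> Poly_Mapping.keys p. (\<Sum>i\<in>UNIV. Poly_Mapping.lookup m i) = d)"

definition homogeneous_fun :: "nat \<Rightarrow> (complex^'n \<Rightarrow> complex) \<Rightarrow> bool" where
  "homogeneous_fun d g \<longleftrightarrow> (\<forall>c x. g (c *s x) = c ^ d * g x)"


section \<open>Multiplicative Legendre transform\<close>

definition partial :: "'n::finite \<Rightarrow> (complex^'n \<Rightarrow> complex) \<Rightarrow> complex^'n \<Rightarrow> complex" where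
  "partial i f x = deriv (\<lambda>t. f (x + t *s axis i 1)) 0"

text \<open>The differential \<open>f'(x)\<close>, in coordinates of the dual basis.\<close>

definition differential :: "(complex^'n \<Rightarrow> complex) \<Rightarrow> complex^'n::finite \<Rightarrow> complex^'n" where
  "differential f x = (\<chi> i. partial i f x)"

text \<open>
  The differential \<open>f'(x)/f(x)\<close> of the multivalued function \<open>ln f\<close>, and the Hessian of \<open>ln f\<close>
  as the matrix of partial derivatives of \<open>f'/f\<close>. Both are independent of the branch of the
  logarithm, and meaningful where \<open>f x \<noteq> 0\<close>.
\<close>

definition log_differential :: "(complex^'n \<Rightarrow> complex) \<Rightarrow> complex^'n::finite \<Rightarrow> complex^'n" where
  "log_differential f x = (1 / f x) *s differential f x"

definition hessian_ln :: "(complex^'n \<Rightarrow> complex) \<Rightarrow> complex^'n::finite \<Rightarrow> complex^'n^'n" where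
  "hessian_ln f x = (\<chi> i j. partial i (\<lambda>y. log_differential f y $ j) x)"

definition generically_invertible_hessian_ln :: "(complex^'n::finite \<Rightarrow> complex) \<Rightarrow> bool" where
  "generically_invertible_hessian_ln f \<longleftrightarrow> (\<exists>x. f x \<noteq> 0 \<and> det (hessian_ln f x) \<noteq> 0)"

definition multiplicative_legendre_transform ::
    "(complex^'n::finite \<Rightarrow> complex) \<Rightarrow> (complex^'n \<Rightarrow> complex) \<Rightarrow> bool" where
  "multiplicative_legendre_transform f g \<longleftrightarrow>
     (\<exists>d. homogeneous_fun d g) \<and>
     (\<exists>U. open U \<and> U \<noteq> {} \<and> (\<forall>x\<in>U. f x \<noteq> 0 \<and> g (log_differential f x) = 1 / f x))"

definition EKP_homaloidal :: "'n::finite mpoly \<Rightarrow> bool" where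
  "EKP_homaloidal f \<longleftrightarrow>
     (\<exists>d. homogeneous_poly d f) \<and>
     generically_invertible_hessian_ln (poly_fun f) \<and>
     (\<exists>g. multiplicative_legendre_transform (poly_fun f) (poly_fun g))"


section \<open>Projective geometry\<close>

text \<open>The points of the projective space of \<^typ>\<open>complex^'n\<close> are its lines through the origin.\<close>

type_synonym 'n point = "(complex^'n) set"

definition proj_space :: "'n::finite point set" where
  "proj_space = {vec.span {v} | v. v \<noteq> 0}"

definition zero_locus :: "'n::finite mpoly set \<Rightarrow> 'n point set" where
  "zero_locus S = {L \<in> proj_space. \<forall>p\<in>S. \<forall>v\<in>L. poly_fun p v = 0}"

definition zariski_closed :: "'n::finite point set \<Rightarrow> bool" where
  "zariski_closed Z \<longleftrightarrow> (\<exists>S. (\<forall>p\<in>S. \<exists>d. homogeneous_poly d p) \<and> Z = zero_locus S)"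

definition secant_line :: "'n::finite point \<Rightarrow> 'n point \<Rightarrow> 'n point set" where
  "secant_line L M = {K \<in> proj_space. K \<subseteq> vec.span (L \<union> M)}"

definition secant_variety :: "'n::finite point set \<Rightarrow> 'n point set" where
  "secant_variety W = zariski_closed hull (\<Union>{secant_line L M | L M. L \<in> W \<and> M \<in> W \<and> L \<noteq> M})"

definition hypersurface :: "'n::finite mpoly \<Rightarrow> 'n point set" where
  "hypersurface f = zero_locus {f}"

definition singular_locus :: "'n::finite mpoly \<Rightarrow> 'n point set" where
  "singular_locus f = {L \<in> hypersurface f. \<forall>v\<in>L. differential (poly_fun f) v = 0}"

definition projectively_equivalent :: "'m::finite point set \<Rightarrow> 'n::finite point set \<Rightarrow> bool" where
  "projectively_equivalent W W' \<longleftrightarrow>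
     (\<exists>T. Vector_Spaces.linear (*s) (*s) T \<and> bij T \<and> W' = (\<lambda>L. T ` L) ` W)"


section \<open>The four classical Severi varieties\<close>

definition veronese_surface :: "6 point set" where
  "veronese_surface =
     {vec.span {vector [x $ 1 * x $ 1, x $ 2 * x $ 2, x $ 3 * x $ 3,
                        x $ 1 * x $ 2, x $ 1 * x $ 3, x $ 2 * x $ 3]} | x :: complex^3. x \<noteq> 0}"

definition segre_P2_P2 :: "(3 \<times> 3) point set" where
  "segre_P2_P2 =
     {vec.span {\<chi> ij. x $ fst ij * y $ snd ij} | x y :: complex^3. x \<noteq> 0 \<and> y \<noteq> 0}"

text \<open>The coordinates of \<open>x \<and> y\<close> in the 15-dimensional second exterior power of \<open>complex^6\<close>.\<close>

definition plucker :: "complex^6 \<Rightarrow> complex^6 \<Rightarrow> complex^15" where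
  "plucker x y =
     vector (map (\<lambda>(i, j). x $ i * y $ j - x $ j * y $ i)
       [(1,2), (1,3), (1,4), (1,5), (1,6), (2,3), (2,4), (2,5), (2,6),
        (3,4), (3,5), (3,6), (4,5), (4,6), (5,6)])"

definition grassmannian_2_6 :: "15 point set" where
  "grassmannian_2_6 = {vec.span {plucker x y} | x y. x \<noteq> y \<and> vec.independent {x, y}}"

text \<open>
  A vector of \<open>complex^(3 \<times> 3 \<times> 3)\<close> is a triple \<open>(A, B, C)\<close> of complex \<open>3 \<times> 3\<close> matrices.
  \<open>cartan_cubic\<close> is Cartan's cubic form, i.e. the norm of the exceptional (Albert) Jordan algebra in
  its first Tits construction. The group of linear automorphisms of this form is the simply
  connected complex group of type \<open>E\<^sub>6\<close>, acting by a 27-dimensional minuscule representation.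
\<close>

definition slice :: "3 \<Rightarrow> complex^(3 \<times> 3 \<times> 3) \<Rightarrow> complex^3^3" where
  "slice k x = (\<chi> i j. x $ (k, i, j))"

definition cartan_cubic :: "complex^(3 \<times> 3 \<times> 3) \<Rightarrow> complex" where
  "cartan_cubic x =
     det (slice 1 x) + det (slice 2 x) + det (slice 3 x) - trace (slice 1 x ** slice 2 x ** slice 3 x)"

definition E6_group :: "(complex^(3 \<times> 3 \<times> 3) \<Rightarrow> complex^(3 \<times> 3 \<times> 3)) set" where
  "E6_group = {T. Vector_Spaces.linear (*s) (*s) T \<and> bij T \<and> (\<forall>x. cartan_cubic (T x) = cartan_cubic x)}"

text \<open>
  The representation is irreducible, so exactly one orbit in the projective space is closed;
  this predicate singles it out.
\<close>

definition is_cayley_plane :: "(3 \<times> 3 \<times> 3) point set \<Rightarrow> bool" where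
  "is_cayley_plane W \<longleftrightarrow>
     (\<exists>L\<in>proj_space. W = {T ` L | T. T \<in> E6_group}) \<and> zariski_closed W"

definition classical_severi_variety :: "'n::finite point set \<Rightarrow> bool" where
  "classical_severi_variety W \<longleftrightarrow>
     projectively_equivalent veronese_surface W \<or>
     projectively_equivalent segre_P2_P2 W \<or>
     projectively_equivalent grassmannian_2_6 W \<or>
     (\<exists>X. is_cayley_plane X \<and> projectively_equivalent X W)"

end

theory Submission
  imports Defs "HOL-Computational_Algebra.Polynomial" "HOL-Computational_Algebra.Fundamental_Theorem_Algebra"
begin

text \<open>
  Comparing degrees, the multiplicative Legendre transform of \<open>f\<close> is a cubic \<open>g\<close> with \<open>g(f'(x)) = f(x)\<^sup>2\<close>,
  and differentiating gives the adjoint identity \<open>g'(f'(x)) = f(x) x\<close>. The polarized identity and its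
  dual yield a Peirce calculus for the vectors \<open>e \<noteq> 0\<close> with \<open>f'(e) = 0\<close>, which represent the singular points.
  Irreducibility of \<open>f\<close> provides a frame \<open>e1, e2, e3\<close> of such vectors, starting from any \<open>e1\<close>, and
  forces all off-diagonal Peirce spaces to be nonzero. They are copies of one composition algebra \<open>A\<close> with norm \<open>q\<close>,
  and \<open>f\<close> becomes \<open>r s t - r q(a) - s q(b) - t q(c) + tr((a b) c)\<close>. Hurwitz' theorem leaves \<open>dim A\<close> as
  1, 2, 4 or 8, and then \<open>f\<close> is, in suitable coordinates, the determinant of symmetric matrices, the
  determinant, the Pfaffian or the Cartan cubic. Finally, a zero \<open>x\<close> of \<open>f\<close> with
  \<open>f'(x) \<noteq> 0\<close> is an anisotropic vector of a nondegenerate quadratic space of dimension at least 2 whose isotropic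
  vectors are singular points, so it is the sum of two of them.
\<close>

section \<open>Polynomial functions\<close>

text \<open>V carries neither a product nor a unit, and the cubic does not identify V with its dual.
  The calculus is therefore that of a Jordan pair: squaring maps V to its dual and the dual to V, an
  idempotent consists of a vector and a covector, and the adjoint identity is needed for g as well
  as for f. The second identity is not symmetric to the first in its origin: it has to be
  transported along the quadratic map f', whose image must first be shown to contain an open set.
  The normalization \<open>T x x x\<close> = 6 f(x), \<open>cr x x\<close> = 2 f'(x) avoids
  denominators in the polarized forms and turns g'(f'(x)) = f(x) x into
  \<open>3 *s dr (cr x x) (cr x x) = (4 * T x x x) *s x\<close>. Irreducibility acts by excluding
  linear factors: whenever a Peirce space is too small, the cubic vanishes on the hyperplane where a
  suitable linear coordinate is zero. The freedom in the first vector of a frame matters for the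
  Cartan cubic, because the Cayley plane is defined as an orbit.\<close>

definition monom_fun :: "('n::finite \<Rightarrow>\<^sub>0 nat) \<Rightarrow> complex^'n \<Rightarrow> complex" where
  "monom_fun m x = (\<Prod>i\<in>UNIV. (x $ i) ^ Poly_Mapping.lookup m i)"

lemma poly_fun_superset:
  assumes "finite S" "Poly_Mapping.keys p \<subseteq> S"
  shows "poly_fun p x = (\<Sum>m\<in>S. Poly_Mapping.lookup p m * monom_fun m x)"
  unfolding poly_fun_def monom_fun_def
  by (rule sum.mono_neutral_left) (use assms in \<open>auto simp: in_keys_iff\<close>)

lemma monom_fun_add: "monom_fun (m + m') x = monom_fun m x * monom_fun m' x"
  by (simp add: monom_fun_def lookup_add power_add prod.distrib)

lemma monom_fun_scale: "monom_fun m (c *s x) = c ^ (\<Sum>i\<in>UNIV. Poly_Mapping.lookup m i) * monom_fun m x"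
  by (simp add: monom_fun_def power_mult_distrib prod.distrib power_sum)

lemma poly_fun_zero [simp]: "poly_fun 0 x = 0"
  by (simp add: poly_fun_def)

lemma poly_fun_add: "poly_fun (p + q) x = poly_fun p x + poly_fun q x"
proof -
  let ?S = "Poly_Mapping.keys p \<union> Poly_Mapping.keys q"
  have "Poly_Mapping.keys (p + q) \<subseteq> ?S" by (rule keys_add)
  then show ?thesis
    by (simp add: poly_fun_superset[of ?S] lookup_add algebra_simps sum.distrib)
qed

lemma poly_fun_sum: "poly_fun (\<Sum>a\<in>X. p a) x = (\<Sum>a\<in>X. poly_fun (p a) x)"
  by (induction X rule: infinite_finite_induct) (auto simp: poly_fun_add)

lemma poly_fun_single: "poly_fun (Poly_Mapping.single m c) x = c * monom_fun m x"
  by (subst poly_fun_superset[of "{m}"]) auto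

lemma mpoly_sum_single: "p = (\<Sum>m\<in>Poly_Mapping.keys p. Poly_Mapping.single m (Poly_Mapping.lookup p m))"
  by (rule poly_mapping_eqI) (auto simp: lookup_sum lookup_single when_def in_keys_iff)

lemma poly_fun_mult: "poly_fun (p * q) x = poly_fun p x * poly_fun q x"
proof -
  let ?P = "Poly_Mapping.keys p" and ?Q = "Poly_Mapping.keys q"
  have "p * q = (\<Sum>m\<in>?P. \<Sum>m'\<in>?Q. Poly_Mapping.single m (Poly_Mapping.lookup p m)
      * Poly_Mapping.single m' (Poly_Mapping.lookup q m'))"
    by (subst (1) mpoly_sum_single, subst (2) mpoly_sum_single) (rule sum_product)
  then have "poly_fun (p * q) x = (\<Sum>m\<in>?P. \<Sum>m'\<in>?Q. (Poly_Mapping.lookup p m * monom_fun m x) * (Poly_Mapping.lookup q m' * monom_fun m' x))"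
    by (simp add: poly_fun_sum mult_single poly_fun_single monom_fun_add mult_ac)
  also have "\<dots> = poly_fun p x * poly_fun q x"
    by (simp add: sum_product poly_fun_superset[of ?P p] poly_fun_superset[of ?Q q])
  finally show ?thesis .
qed

text \<open>Dedekind's independence of characters, applied to monomials as characters of the
  multiplicative monoid \<open>complex^'n\<close>.\<close>

lemma monom_funs_independent:
  assumes "finite S" "\<And>x::complex^'n::finite. (\<Sum>m\<in>S. c m * monom_fun m x) = 0" "m \<in> S"
  shows "c m = 0"
  using assms
proof (induction S arbitrary: c m rule: finite_induct)
  case empty
  then show ?case by simp
next
  case (insert k S)
  have rest: "c m = 0" if m: "m \<in> S" for m
  proof -
    have "k \<noteq> m" using insert m by auto
    then obtain i where i: "Poly_Mapping.lookup k i \<noteq> Poly_Mapping.lookup m i"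
      by (metis poly_mapping_eqI)
    define y :: "complex^'n" where "y = (\<chi> j. if j = i then 2 else 1)"
    have y: "monom_fun k y = 2 ^ Poly_Mapping.lookup k i" for k
    proof -
      have "monom_fun k y = (\<Prod>j\<in>UNIV. if j = i then 2 ^ Poly_Mapping.lookup k i else 1)"
        unfolding monom_fun_def y_def by (rule prod.cong) auto
      then show ?thesis by simp
    qed
    have mul: "monom_fun k (\<chi> j. y $ j * x $ j) = monom_fun k y * monom_fun k x" for k x
      by (simp add: monom_fun_def power_mult_distrib prod.distrib)
    \<comment> \<open>Evaluate the relation at the coordinatewise product of y and x and subtract
      \<open>monom_fun k y\<close> times the relation at x: the term of k cancels, while the choice
      of y keeps the factor at m nonzero.\<close>
    have "(\<Sum>m\<in>S. (c m * (monom_fun m y - monom_fun k y)) * monom_fun m x) = 0" for x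
    proof -
      have "(\<Sum>m\<in>insert k S. c m * (monom_fun m y * monom_fun m x))
          - monom_fun k y * (\<Sum>m\<in>insert k S. c m * monom_fun m x) = 0"
        using insert.prems(1)[of "\<chi> j. y $ j * x $ j"] insert.prems(1)[of x]
        unfolding mul by simp
      then show ?thesis
        using insert.hyps by (simp add: sum_subtractf[symmetric] sum_distrib_left algebra_simps)
    qed
    from insert.IH[of "\<lambda>m. c m * (monom_fun m y - monom_fun k y)", OF this m]
    have "c m * (2 ^ Poly_Mapping.lookup m i - 2 ^ Poly_Mapping.lookup k i) = 0" by (simp add: y)
    moreover have "(2::complex) ^ Poly_Mapping.lookup m i \<noteq> 2 ^ Poly_Mapping.lookup k i"
    proof
      assume "(2::complex) ^ Poly_Mapping.lookup m i = 2 ^ Poly_Mapping.lookup k i"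
      then have "norm ((2::complex) ^ Poly_Mapping.lookup m i) = norm ((2::complex) ^ Poly_Mapping.lookup k i)"
        by simp
      then have "(2::real) ^ Poly_Mapping.lookup m i = 2 ^ Poly_Mapping.lookup k i"
        by (simp add: norm_power)
      then show False using i by simp
    qed
    ultimately show ?thesis by simp
  qed
  have "c k * monom_fun k (\<chi> j. 1) = 0"
    using insert.prems(1)[of "\<chi> j. 1"] insert.hyps rest by simp
  then have "c k = 0" by (simp add: monom_fun_def)
  with rest insert.prems(2) show ?case by auto
qed

lemma poly_fun_inject: "poly_fun p = poly_fun q \<Longrightarrow> p = q"
proof -
  assume *: "poly_fun p = poly_fun q"
  let ?S = "Poly_Mapping.keys p \<union> Poly_Mapping.keys q"
  have "(\<Sum>m\<in>?S. (Poly_Mapping.lookup p m - Poly_Mapping.lookup q m) * monom_fun m x) = 0" for x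
    using fun_cong[OF *, of x]
    by (simp add: poly_fun_superset[of ?S] algebra_simps sum_subtractf)
  then have "Poly_Mapping.lookup p m - Poly_Mapping.lookup q m = 0" if "m \<in> ?S" for m
    using monom_funs_independent[of ?S "\<lambda>m. Poly_Mapping.lookup p m - Poly_Mapping.lookup q m" m] that
    by auto
  then show "p = q"
    by (intro poly_mapping_eqI) (metis UnCI eq_iff_diff_eq_0 in_keys_iff)
qed

text \<open>Scaling by 2 alone separates degrees, since powers of 2 are distinct and monomial
  functions are independent. This is needed for the Legendre transform, whose homogeneity is given
  only as a function.\<close>

lemma homogeneous_fun_imp_poly:
  assumes "homogeneous_fun d (poly_fun p)"
  shows "homogeneous_poly d p"
  unfolding homogeneous_poly_def
proof
  fix m assume m: "m \<in> Poly_Mapping.keys p"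
  let ?K = "Poly_Mapping.keys p" and ?deg = "\<lambda>m. \<Sum>i\<in>UNIV. Poly_Mapping.lookup m i"
  have "(\<Sum>m\<in>?K. (Poly_Mapping.lookup p m * (2 ^ ?deg m - 2 ^ d)) * monom_fun m x) = 0" for x
  proof -
    have "poly_fun p (2 *s x) = 2 ^ d * poly_fun p x" using assms by (simp add: homogeneous_fun_def)
    then show ?thesis
      by (simp add: poly_fun_superset[of ?K] monom_fun_scale sum_distrib_left sum_subtractf algebra_simps)
  qed
  from monom_funs_independent[OF _ this m] have "(2::complex) ^ ?deg m = 2 ^ d"
    using m by (simp add: in_keys_iff)
  then have "norm ((2::complex) ^ ?deg m) = norm ((2::complex) ^ d)" by simp
  then have "(2::real) ^ ?deg m = 2 ^ d" by (simp add: norm_power)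
  then show "?deg m = d" by simp
qed

definition form :: "nat \<Rightarrow> (complex^'n::finite \<Rightarrow> complex) \<Rightarrow> bool" where
  "form d h \<longleftrightarrow> (\<exists>p. homogeneous_poly d p \<and> poly_fun p = h)"

definition polyfun :: "(complex^'n::finite \<Rightarrow> complex) \<Rightarrow> bool" where
  "polyfun h \<longleftrightarrow> (\<exists>p. poly_fun p = h)"

lemma homogeneous_poly_fun_scale:
  "homogeneous_poly d p \<Longrightarrow> poly_fun p (c *s x) = c ^ d * poly_fun p x"
  by (simp add: poly_fun_superset[of "Poly_Mapping.keys p"] monom_fun_scale sum_distrib_left homogeneous_poly_def mult_ac)

lemma form_iff: "form d h \<longleftrightarrow> polyfun h \<and> homogeneous_fun d h"
  unfolding form_def polyfun_def
  using homogeneous_fun_imp_poly homogeneous_poly_fun_scale homogeneous_fun_def by metis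

lemma polyfun_const [intro]: "polyfun (\<lambda>x. c)"
  unfolding polyfun_def
  by (rule exI[of _ "Poly_Mapping.single 0 c"]) (simp add: fun_eq_iff poly_fun_single monom_fun_def)

lemma polyfun_nth [intro]: "polyfun (\<lambda>x. x $ (i :: 'n::finite))"
proof -
  have "(\<Prod>j\<in>UNIV. (x $ j) ^ (1 when i = j)) = (\<Prod>j\<in>UNIV. if j = i then x $ j else 1)" for x :: "complex^'n"
    by (rule prod.cong) (auto simp: when_def)
  then show ?thesis
    unfolding polyfun_def
    by (intro exI[of _ "Poly_Mapping.single (Poly_Mapping.single i 1) 1"])
       (simp add: fun_eq_iff poly_fun_single monom_fun_def lookup_single)
qed

lemma polyfun_add [intro]: "polyfun g \<Longrightarrow> polyfun h \<Longrightarrow> polyfun (\<lambda>x. g x + h x)"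
  unfolding polyfun_def by (metis poly_fun_add ext)

lemma polyfun_mult [intro]: "polyfun g \<Longrightarrow> polyfun h \<Longrightarrow> polyfun (\<lambda>x. g x * h x)"
  unfolding polyfun_def by (metis poly_fun_mult ext)

lemma polyfun_minus [intro]: "polyfun g \<Longrightarrow> polyfun (\<lambda>x. - g x)"
  using polyfun_mult[OF polyfun_const[of "-1"]] by simp

lemma polyfun_diff [intro]: "polyfun g \<Longrightarrow> polyfun h \<Longrightarrow> polyfun (\<lambda>x. g x - h x)"
  using polyfun_add[OF _ polyfun_minus] by fastforce

lemma polyfun_sum [intro]: "(\<And>a. a \<in> X \<Longrightarrow> polyfun (g a)) \<Longrightarrow> polyfun (\<lambda>x. \<Sum>a\<in>X. g a x)"
  by (induction X rule: infinite_finite_induct) auto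

lemma polyfun_prod [intro]: "(\<And>a. a \<in> X \<Longrightarrow> polyfun (g a)) \<Longrightarrow> polyfun (\<lambda>x. \<Prod>a\<in>X. g a x)"
  by (induction X rule: infinite_finite_induct) auto

lemma polyfun_power [intro]: "polyfun g \<Longrightarrow> polyfun (\<lambda>x. g x ^ k)"
  by (induction k) auto

lemma polyfun_poly_fun [intro]: "polyfun (poly_fun p)"
  by (auto simp: polyfun_def)

lemma polyfun_compose:
  assumes "polyfun h" "\<And>i. polyfun (\<lambda>x. k x $ i)"
  shows "polyfun (\<lambda>x. h (k x))"
proof -
  obtain p where p: "h = poly_fun p" using assms(1) by (auto simp: polyfun_def)
  show ?thesis unfolding p poly_fun_def using assms(2) by (intro polyfun_sum polyfun_mult polyfun_const polyfun_prod polyfun_power)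
qed

lemma polyfun_on_line:
  assumes "polyfun h"
  obtains q where "\<And>t. h (x + t *s v) = poly q t"
proof -
  obtain p where p: "h = poly_fun p" using assms by (auto simp: polyfun_def)
  show ?thesis
    by (rule that[of "\<Sum>m\<in>Poly_Mapping.keys p. [:Poly_Mapping.lookup p m:] * (\<Prod>i\<in>UNIV. [:x $ i, v $ i:] ^ Poly_Mapping.lookup m i)"])
       (simp add: p poly_fun_def poly_sum poly_prod)
qed

lemma continuous_on_vec_lambda_line: "continuous_on UNIV (\<lambda>t::complex. x + t *s (v::complex^'n))"
proof -
  have "(\<lambda>t. x + t *s v) = (\<lambda>t. \<chi> i. x $ i + t * v $ i)" by (auto simp: vec_eq_iff)
  then show ?thesis by (simp only:) (auto intro!: continuous_on_vec_lambda continuous_intros)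
qed

text \<open>On the complex line joining a point of U to x, h becomes a polynomial in one variable
  with infinitely many zeros.\<close>

lemma polyfun_eq_0_on_open:
  assumes h: "polyfun h" and U: "open U" "U \<noteq> {}" and 0: "\<And>x. x \<in> U \<Longrightarrow> h x = 0"
  shows "h x = 0"
proof -
  obtain x0 where x0: "x0 \<in> U" using U by auto
  obtain q where q: "\<And>t. h (x0 + t *s (x - x0)) = poly q t" using polyfun_on_line[OF h] by metis
  let ?T = "(\<lambda>t::complex. x0 + t *s (x - x0)) -` U"
  have "open ?T" using continuous_on_vec_lambda_line[of x0 "x - x0"] U(1)
    by (simp add: continuous_on_open_vimage)
  moreover have "0 \<in> ?T" using x0 by simp
  ultimately have "infinite ?T"
    by (metis finite_imp_not_open empty_iff)
  moreover have "?T \<subseteq> {t. poly q t = 0}" using 0 q[symmetric] by auto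
  ultimately have "q = 0" using poly_roots_finite finite_subset by blast
  then show ?thesis using q[of 1] by simp
qed

lemma continuous_polyfun: "polyfun h \<Longrightarrow> continuous_on UNIV h"
  by (auto simp: polyfun_def poly_fun_def intro!: continuous_intros)

lemma open_polyfun_nonzero: "polyfun h \<Longrightarrow> open {x. h x \<noteq> 0}"
  using open_vimage[OF open_Compl[OF closed_singleton[of 0]] continuous_polyfun, of h]
  by (simp add: vimage_def)

text \<open>Cancellation as in an integral domain: h vanishes on the nonempty open set where g does
  not.\<close>

lemma polyfun_mult_eq_0:
  assumes "polyfun g" "polyfun h" "\<And>x. g x * h x = 0" "g x0 \<noteq> 0"
  shows "h x = 0"
  by (rule polyfun_eq_0_on_open[OF assms(2) open_polyfun_nonzero[OF assms(1)]]) (use assms in auto)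

text \<open>A divisor of 1 cannot vanish at the origin, so neither factor is a unit;
  \<open>poly_fun_inject\<close> lifts the factorization from functions to polynomials.\<close>

lemma not_irreducible_poly_fun:
  assumes "polyfun g" "polyfun h" "g 0 = 0" "h 0 = 0" "\<And>x. poly_fun f x = g x * h x"
  shows "\<not> irreducible f"
proof
  assume f: "irreducible f"
  obtain p q where pq: "poly_fun p = g" "poly_fun q = h" using assms by (auto simp: polyfun_def)
  have "f = p * q" by (rule poly_fun_inject) (simp add: fun_eq_iff assms(5) poly_fun_mult pq)
  then have "p dvd 1 \<or> q dvd 1" using f by (auto simp: irreducible_def)
  moreover have "poly_fun 1 (0::complex^'n) = 1"
    by (subst single_one[symmetric]) (simp only: poly_fun_single, simp add: monom_fun_def)
  ultimately show False
    using assms(3,4) pq by (metis dvd_def mult_zero_left poly_fun_mult zero_neq_one)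
qed

section \<open>Cubic pairs\<close>

definition pairing :: "complex^'n::finite \<Rightarrow> complex^'n \<Rightarrow> complex" where
  "pairing x y = (\<Sum>i\<in>UNIV. x $ i * y $ i)"

lemma pairing_commute: "pairing x y = pairing y x"
  by (simp add: pairing_def mult.commute)

lemma pairing_simps [simp]:
  "pairing (x + y) z = pairing x z + pairing y z" "pairing z (x + y) = pairing z x + pairing z y"
  "pairing (x - y) z = pairing x z - pairing y z" "pairing z (x - y) = pairing z x - pairing z y"
  "pairing (c *s x) z = c * pairing x z" "pairing z (c *s x) = c * pairing z x"
  "pairing (- x) z = - pairing x z" "pairing z (- x) = - pairing z x"
  "pairing 0 z = 0" "pairing z 0 = 0"
  by (simp_all add: pairing_def algebra_simps sum.distrib sum_subtractf sum_distrib_left sum_negf)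

lemma pairing_axis: "pairing x (axis i 1) = x $ i"
  by (simp add: pairing_def axis_def if_distrib cong: if_cong)

lemma pairing_eqI: "(\<And>z. pairing x z = pairing y z) \<Longrightarrow> x = y"
  by (metis pairing_axis vec_eq_iff)

lemma pairing_nondegenerate: "x \<noteq> 0 \<Longrightarrow> \<exists>y. pairing x y = 1"
proof -
  assume "x \<noteq> 0"
  then obtain z where "pairing x z \<noteq> 0" by (metis pairing_eqI pairing_simps(9))
  then show ?thesis by (intro exI[of _ "(1 / pairing x z) *s z"]) simp
qed

text \<open>\<open>cr\<close> stands for the polarization \<open>V \<times> V \<rightarrow> V\<^sup>*\<close> of twice the differential of a cubic form, which
  is \<open>x \<mapsto> T x x x / 6\<close>; \<open>dr\<close> below plays the same role on \<open>V\<^sup>*\<close>.\<close>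

locale cubic_map =
  fixes cr :: "complex^'n::finite \<Rightarrow> complex^'n \<Rightarrow> complex^'n"
  assumes cr_add: "cr (x + y) z = cr x z + cr y z"
    and cr_scale: "cr (c *s x) z = c *s cr x z"
    and cr_commute: "cr x y = cr y x"
    and cr_assoc: "pairing (cr x y) z = pairing (cr x z) y"
begin

definition T :: "complex^'n \<Rightarrow> complex^'n \<Rightarrow> complex^'n \<Rightarrow> complex" where
  "T x y z = pairing (cr x y) z"

lemma cr_add2: "cr z (x + y) = cr z x + cr z y"
  and cr_scale2: "cr z (c *s x) = c *s cr z x"
  by (simp_all only: cr_commute[of z] cr_add cr_scale)

lemma cr_zero [simp]: "cr 0 z = 0" "cr z 0 = 0"
  using cr_scale[of 0 0 z] cr_scale2[of z 0 0] by simp_all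

lemma cr_minus: "cr (- x) z = - cr x z" "cr z (- x) = - cr z x"
  using cr_scale[of "-1" x z] cr_scale2[of z "-1" x]
  by (simp_all only: vec.scale_minus_left vec.scale_one)

lemma cr_diff: "cr (x - y) z = cr x z - cr y z" "cr z (x - y) = cr z x - cr z y"
  using cr_add[of x "- y"] cr_add2[of _ x "- y"] by (simp_all add: cr_minus)

lemmas cr_linear = cr_add cr_add2 cr_scale cr_scale2 cr_minus cr_diff

lemma T_linear:
  "T (x + x') y z = T x y z + T x' y z" "T x (y + y') z = T x y z + T x y' z" "T x y (z + z') = T x y z + T x y z'"
  "T (x - x') y z = T x y z - T x' y z" "T x (y - y') z = T x y z - T x y' z" "T x y (z - z') = T x y z - T x y z'"
  "T (c *s x) y z = c * T x y z" "T x (c *s y) z = c * T x y z" "T x y (c *s z) = c * T x y z"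
  "T (- x) y z = - T x y z" "T x (- y) z = - T x y z" "T x y (- z) = - T x y z"
  by (simp_all add: T_def cr_linear)

lemma T_zero [simp]: "T 0 y z = 0" "T x 0 z = 0" "T x y 0 = 0"
  by (simp_all add: T_def)

lemma T_sym: "T x y z = T y x z" "T x y z = T x z y"
  by (simp only: T_def cr_commute[of y x]) (simp only: T_def cr_assoc[of x y z])

lemma T_sym3: "T x y z = T z x y" "T x y z = T z y x" "T x y z = T y z x"
  using T_sym(1)[of x y z] T_sym(2)[of x y z] T_sym(1)[of x z y] T_sym(2)[of y x z] T_sym(1)[of y z x]
  by simp_all

lemma T_cube_add:
  "T (a + b + c) (a + b + c) (a + b + c) = T a a a + T b b b + T c c c
    + 3 * (T a a b + T a a c + T b b a + T b b c + T c c a + T c c b) + 6 * T a b c"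
  by (simp add: T_linear T_sym algebra_simps)

lemma pairing_self_rank1: "cr e e = 0 \<Longrightarrow> pairing (cr e x) e = 0"
  using cr_assoc[of e x e] by simp

end

text \<open>The complete linearizations of
  \<open>3 *s dr (cr x x) (cr x x) = (4 * T x x x) *s x\<close> and of its dual: there are three
  ways to split four arguments into two pairs and four ways to single out one of them.\<close>

locale cubic_pair = cubic_map cr + D: cubic_map dr for cr dr :: "complex^'n::finite \<Rightarrow> complex^'n \<Rightarrow> complex^'n" +
  assumes adjoint: "dr (cr x1 x2) (cr x3 x4) + dr (cr x1 x3) (cr x2 x4) + dr (cr x1 x4) (cr x2 x3)
      = pairing (cr x2 x3) x4 *s x1 + pairing (cr x1 x3) x4 *s x2
      + pairing (cr x1 x2) x4 *s x3 + pairing (cr x1 x2) x3 *s x4"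
    and dual_adjoint: "cr (dr x1 x2) (dr x3 x4) + cr (dr x1 x3) (dr x2 x4) + cr (dr x1 x4) (dr x2 x3)
      = pairing (dr x2 x3) x4 *s x1 + pairing (dr x1 x3) x4 *s x2
      + pairing (dr x1 x2) x4 *s x3 + pairing (dr x1 x2) x3 *s x4"
begin

lemmas dr_commute = D.cr_commute and dr_assoc = D.cr_assoc
  and dr_zero = D.cr_zero and dr_linear = D.cr_linear

text \<open>Paired with a test vector z, this becomes \<open>adjoint\<close> at x1, x2, x3, z paired
  with y; the symmetry of both trilinear forms moves z into place.\<close>

lemma mixed: "cr (dr (cr x1 x2) y) x3 + cr (dr (cr x2 x3) y) x1 + cr (dr (cr x1 x3) y) x2
  = T x1 x2 x3 *s y + pairing x1 y *s cr x2 x3 + pairing x2 y *s cr x1 x3 + pairing x3 y *s cr x1 x2"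
proof (rule pairing_eqI)
  fix z
  have *: "pairing (cr (dr (cr a b) y) c) z = pairing (dr (cr a b) (cr c z)) y" for a b c
  proof -
    have "pairing (cr (dr (cr a b) y) c) z = pairing (cr c z) (dr (cr a b) y)"
      by (simp only: cr_commute[of _ c] cr_assoc[of c _ z])
    also have "\<dots> = pairing (dr (cr a b) y) (cr c z)" by (rule pairing_commute)
    also have "\<dots> = pairing (dr (cr a b) (cr c z)) y" by (rule dr_assoc)
    finally show ?thesis .
  qed
  have "pairing (cr (dr (cr x1 x2) y) x3 + cr (dr (cr x2 x3) y) x1 + cr (dr (cr x1 x3) y) x2) z
     = pairing (dr (cr x1 x2) (cr x3 z) + dr (cr x1 x3) (cr x2 z) + dr (cr x1 z) (cr x2 x3)) y"
    by (simp add: * dr_commute[of "cr x1 z"])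
  also have "\<dots> = pairing (pairing (cr x2 x3) z *s x1 + pairing (cr x1 x3) z *s x2
      + pairing (cr x1 x2) z *s x3 + pairing (cr x1 x2) x3 *s z) y"
    by (simp only: adjoint)
  finally show "pairing (cr (dr (cr x1 x2) y) x3 + cr (dr (cr x2 x3) y) x1 + cr (dr (cr x1 x3) y) x2) z
    = pairing (T x1 x2 x3 *s y + pairing x1 y *s cr x2 x3 + pairing x2 y *s cr x1 x3 + pairing x3 y *s cr x1 x2) z"
    by (simp add: T_def pairing_commute[of y] algebra_simps)
qed

text \<open>In \<open>adjoint\<close> at e, e, y, z two of the three pairings coincide and the third
  contains \<open>cr e e\<close>. A nonzero e with \<open>cr e e = 0\<close> is called a vector of
  rank one in the comments below.\<close>

lemma rank1_dr:
  assumes "cr e e = 0"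
  shows "dr (cr e y) (cr e z) = T e y z *s e"
proof -
  have "2 *s dr (cr e y) (cr e z) = 2 *s (T e y z *s e)"
    using adjoint[of e e y z] dr_commute[of "cr e z" "cr e y"] pairing_self_rank1[OF assms]
    by (simp add: T_def assms vec_eq_iff cr_assoc[of e z y])
  then show ?thesis by (simp add: vec_eq_iff)
qed

text \<open>From \<open>mixed\<close> at e, e, z. If \<open>pairing e y = 1\<close>, it says that
  the map from z to \<open>dr (cr e z) y\<close> leaves \<open>cr e\<close> unchanged, and hence is
  a projection.\<close>

lemma rank1_project:
  assumes "cr e e = 0"
  shows "cr e (dr (cr e z) y) = pairing e y *s cr e z"
proof -
  have "T e e z = 0" by (simp add: T_def assms)
  then have "2 *s cr e (dr (cr e z) y) = 2 *s (pairing e y *s cr e z)"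
    using mixed[of e e y z] cr_commute[of "dr (cr e z) y" e]
    by (simp add: assms vec_eq_iff)
  then show ?thesis by (simp add: vec_eq_iff)
qed

end

text \<open>Exchanging \<open>cr\<close> and \<open>dr\<close> exchanges the two axioms, so every
  result is also available on the dual side.\<close>

sublocale cubic_pair \<subseteq> dual: cubic_pair dr cr
  by unfold_locales
    (fact adjoint dual_adjoint)+

section \<open>Symmetric bilinear forms\<close>

text \<open>The form is bilinear on the ambient space, but only its restriction to W is
  nondegenerate. This fits the forms \<open>T e\<close>, which are studied on Peirce
  subspaces.\<close>

locale bilinear_space =
  fixes B :: "complex^'n::finite \<Rightarrow> complex^'n \<Rightarrow> complex" and W :: "(complex^'n) set"
  assumes subspace: "vec.subspace W"
    and B_add: "B (x + y) z = B x z + B y z"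
    and B_scale: "B (c *s x) z = c * B x z"
    and B_commute: "B x y = B y x"
    and B_nondegenerate: "v \<in> W \<Longrightarrow> (\<And>w. w \<in> W \<Longrightarrow> B v w = 0) \<Longrightarrow> v = 0"
begin

lemma B_add2: "B z (x + y) = B z x + B z y" and B_scale2: "B z (c *s x) = c * B z x"
  by (simp_all only: B_commute[of z] B_add B_scale)

lemma B_zero [simp]: "B 0 z = 0" "B z 0 = 0"
  using B_scale[of 0 0 z] B_scale2[of z 0 0] by simp_all

lemma B_minus: "B (- x) z = - B x z" "B z (- x) = - B z x"
  using B_scale[of "-1" x z] B_scale2[of z "-1" x] by simp_all

lemma B_diff: "B (x - y) z = B x z - B y z" "B z (x - y) = B z x - B z y"
  using B_add[of x "- y" z] B_add2[of z x "- y"] by (simp_all add: B_minus)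

lemmas B_linear = B_add B_add2 B_scale B_scale2 B_minus B_diff

lemma W_add: "x \<in> W \<Longrightarrow> y \<in> W \<Longrightarrow> x + y \<in> W"
  and W_diff: "x \<in> W \<Longrightarrow> y \<in> W \<Longrightarrow> x - y \<in> W"
  and W_scale: "x \<in> W \<Longrightarrow> c *s x \<in> W"
  and W_zero: "0 \<in> W"
  and W_minus: "x \<in> W \<Longrightarrow> - x \<in> W"
  using subspace by (auto intro: vec.subspace_add vec.subspace_diff vec.subspace_scale vec.subspace_0 vec.subspace_neg)

lemmas W_closed = W_add W_diff W_scale W_zero W_minus

text \<open>If all squares vanished, polarization would make v orthogonal to W; a complex square
  root then rescales a nonzero value to c.\<close>

lemma exists_value:
  assumes "v \<in> W" "v \<noteq> 0"
  shows "\<exists>w\<in>W. B w w = c"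
proof -
  have "\<exists>w\<in>W. B w w \<noteq> 0"
  proof (rule ccontr)
    assume *: "\<not> ?thesis"
    have "B v w = 0" if "w \<in> W" for w
    proof -
      have "B (v + w) (v + w) = 0" "B v v = 0" "B w w = 0" using * that assms W_add by blast+
      then show ?thesis by (simp add: B_linear B_commute[of w v])
    qed
    then show False using B_nondegenerate assms by blast
  qed
  then obtain w where w: "w \<in> W" "B w w \<noteq> 0" by blast
  obtain s where s: "s\<^sup>2 = c / B w w" using power2_csqrt by blast
  have "B (s *s w) (s *s w) = s\<^sup>2 * B w w" by (simp add: B_linear power2_eq_square)
  then show ?thesis using w s by (intro bexI[of _ "s *s w"]) (auto simp: W_scale)
qed

lemma orthogonal_complement:
  assumes v: "v \<in> W" "B v v \<noteq> 0"
  shows "bilinear_space B {w \<in> W. B v w = 0}"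
proof
  show "vec.subspace {w \<in> W. B v w = 0}"
    by (auto simp: vec.subspace_def B_linear W_closed)
  show "u = 0" if u: "u \<in> {w \<in> W. B v w = 0}" and *: "\<And>w. w \<in> {w \<in> W. B v w = 0} \<Longrightarrow> B u w = 0" for u
  proof (rule B_nondegenerate)
    show "u \<in> W" using u by simp
    fix w assume w: "w \<in> W"
    have "B u (w - (B v w / B v v) *s v) = 0"
      by (rule *) (use w v in \<open>auto simp: B_linear W_closed\<close>)
    then show "B u w = 0" using u by (simp add: B_linear B_commute[of u v])
  qed
qed (auto simp: B_linear B_commute)

lemma exists_orthogonal:
  assumes v: "v \<in> W" "B v v \<noteq> 0" and "\<not> W \<subseteq> vec.span {v}"
  shows "\<exists>w\<in>W. B v w = 0 \<and> B w w = c"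
proof -
  interpret O: bilinear_space B "{w \<in> W. B v w = 0}" using v by (rule orthogonal_complement)
  obtain w where w: "w \<in> W" "w \<notin> vec.span {v}" using assms by blast
  let ?w = "w - (B v w / B v v) *s v"
  have "?w \<noteq> 0" using w by (metis eq_iff_diff_eq_0 vec.span_base vec.span_scale singletonI)
  moreover have "?w \<in> {w \<in> W. B v w = 0}" using w v by (auto simp: B_linear W_closed)
  ultimately show ?thesis using O.exists_value[of ?w c] by auto
qed

end

section \<open>Idempotents and frames\<close>

context cubic_pair
begin

text \<open>In \<open>adjoint\<close> at x, x, x, e everything vanishes except
  \<open>T x x x\<close> times e.\<close>

lemma cr_nondegenerate:
  assumes "T x x x \<noteq> 0" "\<And>y. cr e y = 0"
  shows "e = 0"
  using adjoint[of x x x e] assms(1) assms(2)[of x]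
  by (simp add: cr_commute[of x e] T_def cr_assoc[of x x e])

text \<open>An idempotent of the Jordan pair formed by V and its dual: a rank one vector together
  with a rank one covector, normalized to pair to 1.\<close>

definition idempotent :: "complex^'n \<Rightarrow> complex^'n \<Rightarrow> bool" where
  "idempotent e f \<longleftrightarrow> cr e e = 0 \<and> dr f f = 0 \<and> pairing e f = 1"

lemma exists_idempotent:
  assumes e: "cr e e = 0" "e \<noteq> 0" and x0: "T x0 x0 x0 \<noteq> 0"
  shows "\<exists>f. idempotent e f"
proof -
  have "\<exists>x. T x x e \<noteq> 0"
  proof (rule ccontr)
    assume *: "\<not> ?thesis"
    have "T e x y = 0" for x y
    proof -
      have "T (x + y) (x + y) e = 0" "T x x e = 0" "T y y e = 0" using * by blast+
      then have "2 * T x y e = 0" by (simp add: T_linear T_sym(1)[of y x])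
      then show ?thesis by (simp add: T_sym3(1)[of x y e])
    qed
    then have "cr e x = 0" for x unfolding T_def by (intro pairing_eqI) simp
    then show False using cr_nondegenerate[OF x0] e(2) by blast
  qed
  then obtain x where x: "T x x e \<noteq> 0" by blast
  \<comment> \<open>On the span of \<open>cr x x\<close> and \<open>cr x e\<close> the product
    \<open>dr\<close> is known from three instances of \<open>adjoint\<close>, with values in the
    span of x and e. The two coefficients are chosen so that both components of
    \<open>dr f f\<close> cancel.\<close>
  define f where "f = T x x e *s cr x x - (2/3 * T x x x) *s cr x e"
  have Te: "T x e e = 0" using e(1) by (simp only: T_sym3(3)[of x e e]) (simp add: T_def)
  have 1: "3 *s dr (cr x x) (cr x x) = (4 * T x x x) *s x"
    using adjoint[of x x x x] by (simp add: T_def vec_eq_iff)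
  have 2: "3 *s dr (cr x x) (cr x e) = T x x x *s e + (3 * T x x e) *s x"
    using adjoint[of x x x e] dr_commute[of "cr x e"] by (simp add: T_def vec_eq_iff)
  have 3: "2 *s dr (cr x e) (cr x e) = (2 * T x x e) *s e"
    using adjoint[of x x e e] e Te by (simp add: T_def cr_assoc[of x e x] vec_eq_iff)
  have "dr f f $ i = 0" for i
  proof -
    have 1: "dr (cr x x) (cr x x) $ i = 4/3 * T x x x * x $ i"
      using arg_cong[OF 1, of "\<lambda>v. v $ i"] by (simp add: field_simps)
    have 2: "dr (cr x x) (cr x e) $ i = T x x x * e $ i / 3 + T x x e * x $ i"
      using arg_cong[OF 2, of "\<lambda>v. v $ i"] by (simp add: field_simps)
    have 3: "dr (cr x e) (cr x e) $ i = T x x e * e $ i" using 3 by (simp add: vec_eq_iff)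
    show ?thesis
      unfolding f_def by (simp add: dr_linear dr_commute[of "cr x e" "cr x x"] 1 2 3 algebra_simps)
  qed
  then have "dr f f = 0" by (simp add: vec_eq_iff)
  moreover have "pairing e f = (T x x e)\<^sup>2"
    using Te by (simp add: f_def pairing_commute[of e] T_def power2_eq_square)
  ultimately show ?thesis using e x
    by (intro exI[of _ "(1 / (T x x e)\<^sup>2) *s f"]) (simp add: idempotent_def dr_linear)
qed

text \<open>For an idempotent, the image of the Peirce projection supplied by
  \<open>rank1_project\<close>; the kernel of that projection is the kernel of
  \<open>cr e\<close>.\<close>

definition peirce0 :: "complex^'n \<Rightarrow> complex^'n \<Rightarrow> (complex^'n) set" where
  "peirce0 e f = {v. dr f (cr e v) = v}"

lemma dr_in_peirce0: "idempotent e f \<Longrightarrow> dr f a \<in> peirce0 e f"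
  using dual.rank1_project[of f a e] cr_commute[of e "dr f a"] pairing_commute[of f e]
  by (simp add: idempotent_def peirce0_def)

text \<open>Both vectors lie in the image of \<open>dr f\<close>, so the dual of
  \<open>rank1_dr\<close> applies. Hence the nonzero isotropic vectors of \<open>T e\<close> in this
  space are again of rank one: this is the source of frames and of secant lines.\<close>

lemma cr_peirce0:
  assumes "idempotent e f" "v \<in> peirce0 e f" "w \<in> peirce0 e f"
  shows "cr v w = T e v w *s f"
proof -
  have vw: "dr f (cr e v) = v" "dr f (cr e w) = w" using assms by (simp_all add: peirce0_def)
  have "cr (dr f (cr e v)) (dr f (cr e w)) = D.T f (cr e v) (cr e w) *s f"
    using assms by (intro dual.rank1_dr) (simp add: idempotent_def)
  then show ?thesis by (simp add: vw D.T_def T_def pairing_commute[of v] cr_assoc[of e v w])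
qed

lemma peirce0_space:
  assumes "idempotent e f"
  shows "bilinear_space (T e) (peirce0 e f)"
proof
  show "vec.subspace (peirce0 e f)"
    by (auto simp: vec.subspace_def peirce0_def cr_linear dr_linear)
  show "v = 0" if v: "v \<in> peirce0 e f" and *: "\<And>w. w \<in> peirce0 e f \<Longrightarrow> T e v w = 0" for v
  proof (rule pairing_eqI)
    fix z
    have "pairing v z = pairing (dr f (cr e v)) z" using v by (simp add: peirce0_def)
    also have "\<dots> = T e v (dr f z)"
      by (simp only: T_def dr_assoc[of f "cr e v" z] pairing_commute[of "cr e v"])
    also have "\<dots> = 0" by (rule *) (rule dr_in_peirce0[OF assms])
    finally show "pairing v z = pairing 0 z" by simp
  qed
qed (simp_all only: T_linear T_sym(2)[of e])

text \<open>By \<open>mixed\<close> at y, y, e the covector \<open>cr y y\<close> has the form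
  \<open>cr _ e\<close>, and such covectors pair to zero with y. So the cubic vanishes on the kernel
  of the Peirce projection, which would yield a linear factor if this kernel were a
  hyperplane.\<close>

lemma cubic_annihilator:
  assumes e: "idempotent e f" and y: "cr e y = 0"
  shows "T y y y = 0"
proof -
  have "cr (dr (cr y y) f) e = cr y y"
    using mixed[of y y f e] e y
    by (simp add: cr_commute[of y e] idempotent_def T_def cr_assoc[of y y e])
  then have "T y y y = pairing (cr (dr (cr y y) f) e) y" by (simp add: T_def)
  also have "\<dots> = pairing (cr e y) (dr (cr y y) f)"
    by (simp only: cr_commute[of _ e] cr_assoc[of e _ y])
  finally show ?thesis by (simp add: y)
qed

section \<open>Frames of three rank one vectors and their off-diagonal Peirce spaces\<close>

definition frame :: "complex^'n \<Rightarrow> complex^'n \<Rightarrow> complex^'n \<Rightarrow> bool" where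
  "frame e1 e2 e3 \<longleftrightarrow> cr e1 e1 = 0 \<and> cr e2 e2 = 0 \<and> cr e3 e3 = 0 \<and> T e1 e2 e3 = 1"

lemma exists_frame:
  assumes e: "idempotent e f" and V0: "\<And>v. \<not> peirce0 e f \<subseteq> vec.span {v}"
  shows "\<exists>e2 e3. frame e e2 e3"
proof -
  interpret bilinear_space "T e" "peirce0 e f" using e by (rule peirce0_space)
  obtain u where u: "u \<in> peirce0 e f" "u \<noteq> 0"
    using V0[of 0] by (metis subsetI vec.span_zero)
  then obtain v where v: "v \<in> peirce0 e f" "T e v v = 1" using exists_value[OF u] by blast
  then obtain w where w: "w \<in> peirce0 e f" "T e v w = 0" "T e w w = -1"
    using exists_orthogonal[of v "-1"] V0[of v] by auto
  \<comment> \<open>For orthogonal v and w of squares 1 and -1, the sum and the difference are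
    isotropic; the factor 1/2 normalizes their product to 1.\<close>
  let ?e2 = "v + w" and ?e3 = "(1/2) *s (v - w)"
  have mem: "?e2 \<in> peirce0 e f" "?e3 \<in> peirce0 e f" using v w by (simp_all add: W_closed)
  have "T e w v = 0" using w by (simp add: T_sym(2)[of e w v])
  then have "T e ?e2 ?e2 = 0" "T e ?e3 ?e3 = 0" "T e ?e2 ?e3 = 1"
    using v w by (simp_all add: T_linear)
  then have "frame e ?e2 ?e3"
    using cr_peirce0[OF e mem(1) mem(1)] cr_peirce0[OF e mem(2) mem(2)] e
    by (simp add: frame_def idempotent_def)
  then show ?thesis by blast
qed

lemma frame_rotate: "frame e1 e2 e3 \<Longrightarrow> frame e2 e3 e1"
  unfolding frame_def using T_sym3(3)[of e1 e2 e3] by simp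

lemma frame_swap: "frame e1 e2 e3 \<Longrightarrow> frame e1 e3 e2"
  by (simp add: frame_def T_sym(2)[of e1 e2 e3])

text \<open>For a frame this is the off-diagonal space opposite to e1; in the model of Hermitian 3 x
  3 matrices it is the space of the (2,3) entry.\<close>

definition peirce :: "complex^'n \<Rightarrow> complex^'n \<Rightarrow> (complex^'n) set" where
  "peirce e2 e3 = {v. cr e2 v = 0 \<and> cr e3 v = 0}"

lemma peirce_commute: "peirce e2 e3 = peirce e3 e2"
  by (auto simp: peirce_def)

lemma subspace_peirce: "vec.subspace (peirce e2 e3)"
  by (auto simp: vec.subspace_def peirce_def cr_linear)

lemma frame_dual:
  assumes "frame e1 e2 e3"
  shows "dr (cr e1 e2) (cr e1 e3) = e1" "dr (cr e1 e2) (cr e1 e2) = 0"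
proof -
  have "T e1 e2 e2 = 0" using assms unfolding T_sym3(3)[of e1 e2 e2] by (simp add: frame_def T_def)
  then show "dr (cr e1 e2) (cr e1 e3) = e1" "dr (cr e1 e2) (cr e1 e2) = 0"
    using assms rank1_dr[of e1 e2 e3] rank1_dr[of e1 e2 e2] by (simp_all add: frame_def)
qed

lemma frame_pairing:
  assumes "frame e1 e2 e3"
  shows "pairing e1 (cr e2 e3) = 1" "pairing e1 (cr e1 e2) = 0" "pairing e1 (cr e1 e3) = 0"
  using assms pairing_self_rank1[of e1]
  by (auto simp: frame_def pairing_commute[of e1] T_sym3(3)[of e1] simp flip: T_def)

text \<open>Read off from \<open>adjoint\<close> at e1, e2, e3, x: each of the three terms on its
  left side, stripped of two diagonal components, is one off-diagonal component of x.\<close>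

definition peirce_proj :: "complex^'n \<Rightarrow> complex^'n \<Rightarrow> complex^'n \<Rightarrow> complex^'n \<Rightarrow> complex^'n" where
  "peirce_proj e1 e2 e3 x = dr (cr e2 e3) (cr e1 x) - T e1 e3 x *s e2 - T e1 e2 x *s e3"

lemma peirce_proj_mem_aux:
  assumes "frame e1 e2 e3"
  shows "cr e2 (peirce_proj e1 e2 e3 x) = 0"
proof -
  have e: "cr e1 e1 = 0" "cr e2 e2 = 0" "cr e3 e3 = 0" "T e1 e2 e3 = 1" using assms by (simp_all add: frame_def)
  let ?f = "cr e2 e3"
  have 1: "dr (cr e1 e2) ?f = e2"
    using frame_dual(1)[OF frame_rotate[OF assms]] by (simp add: dr_commute[of ?f] cr_commute[of e2 e1])
  have 2: "dr (cr e2 x) ?f = T e2 e3 x *s e2"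
    using rank1_dr[OF e(2), of e3 x] by (simp add: dr_commute[of ?f])
  have p: "pairing e1 ?f = 1" "pairing e2 ?f = 0" "pairing x ?f = T e2 e3 x"
    using frame_pairing[OF assms] frame_pairing[OF frame_rotate[OF assms]]
    by (simp_all add: T_def pairing_commute)
  have "cr e2 x + cr (T e2 e3 x *s e2) e1 + cr (dr (cr e1 x) ?f) e2
      = T e1 e2 x *s ?f + cr e2 x + T e2 e3 x *s cr e1 e2"
    using mixed[of e1 e2 ?f x] by (simp add: 1 2 p)
  then have "cr (dr (cr e1 x) ?f) e2 = T e1 e2 x *s ?f"
    by (simp add: cr_linear cr_commute[of e2 e1] algebra_simps)
  then show ?thesis
    by (simp add: peirce_proj_def cr_linear e cr_commute[of e2 "dr _ _"] dr_commute[of ?f])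
qed

lemma peirce_proj_commute: "peirce_proj e1 e3 e2 x = peirce_proj e1 e2 e3 x"
  by (simp add: peirce_proj_def cr_commute[of e3])

lemma peirce_proj_mem: "frame e1 e2 e3 \<Longrightarrow> peirce_proj e1 e2 e3 x \<in> peirce e2 e3"
  using peirce_proj_mem_aux[of e1 e2 e3 x] peirce_proj_mem_aux[of e1 e3 e2 x] frame_swap
  by (simp add: peirce_def peirce_proj_commute)

lemma peirce_decomposition:
  assumes "frame e1 e2 e3"
  shows "x = T e2 e3 x *s e1 + T e3 e1 x *s e2 + T e1 e2 x *s e3
    + peirce_proj e1 e2 e3 x + peirce_proj e2 e3 e1 x + peirce_proj e3 e1 e2 x"
  using adjoint[of e1 e2 e3 x] assms
  by (simp add: peirce_proj_def frame_def cr_commute[of e3 e1] T_sym(1)[of e3 e1] T_sym(1)[of e3 e2] T_sym(1)[of e2 e1]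
      dr_commute[of "cr e1 x" "cr e2 e3"] T_def[symmetric] algebra_simps)

text \<open>The surviving part of \<open>adjoint\<close> at e1, e2, e3, v. Thus \<open>cr e1\<close>
  is injective on the space opposite to e1, with an explicit left inverse.\<close>

lemma peirce_project:
  assumes "frame e1 e2 e3" "v \<in> peirce e2 e3"
  shows "dr (cr e2 e3) (cr e1 v) = v"
proof -
  have "T e1 v e3 = 0" "T e1 e2 v = 0" "T e2 e3 v = 0"
    using assms(2) unfolding T_sym3(2)[of e1 v e3] T_sym3(3)[of e1 e2 v] T_sym(2)[of e2 e3 v]
    by (simp_all add: peirce_def T_def)
  then show ?thesis
    using adjoint[of e1 e2 e3 v] assms dr_commute[of "cr e1 v" "cr e2 e3"] T_sym(2)[of e1 e3 v]
    by (simp add: frame_def peirce_def T_def[symmetric])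
qed

end

context cubic_pair
begin

lemma frame_T:
  assumes "frame e1 e2 e3" "v \<in> peirce e2 e3"
  shows "T e1 e2 v = 0" "T e2 e3 v = 0" "T e3 e1 v = 0"
  using assms(2) unfolding T_sym3(3)[of e1 e2 v] T_sym(2)[of e2 e3 v] T_sym(2)[of e3 e1 v]
  by (simp_all add: peirce_def T_def)

text \<open>The argument of \<open>cr_peirce0\<close>, with the dual rank one vector
  \<open>cr e2 e3\<close>; \<open>peirce_project\<close> exhibits v and w in the image of
  \<open>dr (cr e2 e3)\<close>.\<close>

lemma peirce_cr:
  assumes "frame e1 e2 e3" "v \<in> peirce e2 e3" "w \<in> peirce e2 e3"
  shows "cr v w = T e1 v w *s cr e2 e3"
proof -
  have "cr (dr (cr e2 e3) (cr e1 v)) (dr (cr e2 e3) (cr e1 w)) = D.T (cr e2 e3) (cr e1 v) (cr e1 w) *s cr e2 e3"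
    using frame_dual(2)[OF frame_rotate[OF assms(1)]] by (rule dual.rank1_dr)
  then show ?thesis
    using assms by (simp add: peirce_project D.T_def T_def pairing_commute[of v] cr_assoc[of e1 v w])
qed

lemma T_peirce2:
  assumes "frame e1 e2 e3" "v \<in> peirce e2 e3" "w \<in> peirce e2 e3" "z \<in> peirce e3 e1 \<union> peirce e1 e2"
  shows "T v w z = 0"
proof -
  have "T e2 e3 z = 0"
    using assms(1,4) frame_T(1)[OF frame_rotate, of e1 e2 e3 z] frame_T(3)[OF frame_rotate[OF frame_rotate], of e1 e2 e3 z]
    by auto
  then show ?thesis using peirce_cr[OF assms(1-3)] by (simp add: T_def)
qed

lemma T_peirce3:
  assumes "frame e1 e2 e3" "v \<in> peirce e2 e3"
  shows "T v v v = 0"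
  using peirce_cr[OF assms assms(2)] frame_T(2)[OF assms] by (simp add: T_def)

lemma cubic_expansion:
  assumes fr: "frame e1 e2 e3" and a: "a1 \<in> peirce e2 e3" "a2 \<in> peirce e3 e1" "a3 \<in> peirce e1 e2"
    and x: "x = (x1 *s e1 + x2 *s e2 + x3 *s e3) + (a1 + a2 + a3)"
  shows "T x x x = 6 * (x1 * x2 * x3) + 3 * (x1 * T e1 a1 a1 + x2 * T e2 a2 a2 + x3 * T e3 a3 a3) + 6 * T a1 a2 a3"
proof -
  note fr2 = frame_rotate[OF fr] and fr3 = frame_rotate[OF frame_rotate[OF fr]]
  let ?s = "x1 *s e1 + x2 *s e2 + x3 *s e3" and ?v = "a1 + a2 + a3"
  have cr0: "cr e1 e1 = 0" "cr e2 e2 = 0" "cr e3 e3 = 0" "cr e2 a1 = 0" "cr e3 a1 = 0"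
    "cr e3 a2 = 0" "cr e1 a2 = 0" "cr e1 a3 = 0" "cr e2 a3 = 0"
    using fr a by (simp_all add: frame_def peirce_def)
  have T0: "T e1 e1 z = 0" "T e2 e2 z = 0" "T e3 e3 z = 0" "T e2 a1 z = 0" "T e3 a1 z = 0"
    "T e3 a2 z = 0" "T e1 a2 z = 0" "T e1 a3 z = 0" "T e2 a3 z = 0" for z
    by (simp_all add: T_def cr0)
  have T1: "T e1 e2 e3 = 1" using fr by (simp add: frame_def)
  have s: "T ?s ?s ?s = 6 * (x1 * x2 * x3)"
    unfolding T_cube_add by (simp add: T_linear T0 T1)
  have e: "T e1 e2 ?v = 0" "T e2 e3 ?v = 0" "T e3 e1 ?v = 0"
    using frame_T[OF fr a(1)] frame_T[OF fr2 a(2)] frame_T[OF fr3 a(3)] by (simp_all add: T_linear)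
  have "T ?s ?s ?v = 0"
    using e by (simp add: T_linear(1,7) T_linear(2)[of _ "x1 *s e1 + x2 *s e2"] T_linear(2)[of _ "x1 *s e1"] T_linear(8) T0
        T_sym(1)[of e2 e1] T_sym(1)[of e3 e2] T_sym(1)[of e1 e3])
  moreover have "T ?v ?v ?s = x1 * T e1 a1 a1 + x2 * T e2 a2 a2 + x3 * T e3 a3 a3"
  proof -
    have "T e1 ?v ?v = T e1 a1 a1" "T e2 ?v ?v = T e2 a2 a2" "T e3 ?v ?v = T e3 a3 a3"
      by (simp_all add: T_linear T0) 
        (simp_all add: T_sym(2)[of e1 a1 a2] T_sym(2)[of e1 a1 a3] T_sym(2)[of e2 a2 a1] T_sym(2)[of e2 a2 a3]
          T_sym(2)[of e3 a3 a2] T_sym(2)[of e3 a3 a1] T0)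
    then show ?thesis unfolding T_sym3(1)[of ?v ?v ?s] by (simp add: T_linear(1,7))
  qed
  moreover have "T ?v ?v ?v = 6 * T a1 a2 a3"
    using T_peirce2[OF fr a(1) a(1), of a2] T_peirce2[OF fr a(1) a(1), of a3]
      T_peirce2[OF fr2 a(2) a(2), of a1] T_peirce2[OF fr2 a(2) a(2), of a3]
      T_peirce2[OF fr3 a(3) a(3), of a1] T_peirce2[OF fr3 a(3) a(3), of a2]
      T_peirce3[OF fr a(1)] T_peirce3[OF fr2 a(2)] T_peirce3[OF fr3 a(3)] a
    unfolding T_cube_add by simp
  moreover have "T x x x = T ?s ?s ?s + T ?v ?v ?v + 3 * (T ?s ?s ?v + T ?v ?v ?s)"
    using T_cube_add[of ?s ?v 0] unfolding x by simp
  ultimately show ?thesis unfolding s by (simp only:) (simp add: distrib_left)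
qed

text \<open>The sign makes this the polar form of the norm q that enters the cubic as - r q(a). A
  vector orthogonal to its own Peirce space is orthogonal under \<open>T e1\<close> to all other
  components anyway, so \<open>cr e1\<close> kills it and \<open>peirce_project\<close> shows that
  it is 0.\<close>

lemma peirce_space:
  assumes fr: "frame e1 e2 e3"
  shows "bilinear_space (\<lambda>x y. - T e1 x y) (peirce e2 e3)"
proof
  show "v = 0" if v: "v \<in> peirce e2 e3" and *: "\<And>w. w \<in> peirce e2 e3 \<Longrightarrow> - T e1 v w = 0" for v
  proof -
    note fr2 = frame_rotate[OF fr] and fr3 = frame_rotate[OF frame_rotate[OF fr]]
    have z: "T e1 v y = 0" if "y \<in> {e1, e2, e3} \<union> peirce e3 e1 \<union> peirce e1 e2" for y
      using that frame_T[OF fr v] fr unfolding T_sym(2)[of e1 v y]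
      by (auto simp: peirce_def T_def frame_def) (auto simp: cr_commute[of e1 e3])
    have "cr e1 v = 0"
    proof (rule pairing_eqI)
      fix x
      have "T e1 v x = 0"
        using *[OF peirce_proj_mem[OF fr, of x]] z peirce_proj_mem[OF fr2, of x] peirce_proj_mem[OF fr3, of x]
        by (subst peirce_decomposition[OF fr, of x]) (simp add: T_linear)
      then show "pairing (cr e1 v) x = pairing 0 x" by (simp add: T_def)
    qed
    then show "v = 0" using peirce_project[OF fr v] by simp
  qed
qed (simp_all add: subspace_peirce T_linear T_sym(2)[of e1])

text \<open>The trilinear part of the cubic rewritten as a product of two off-diagonal spaces with
  values in the third; see \<open>T_pmult\<close> for the defining adjunction.\<close>

definition pmult :: "complex^'n \<Rightarrow> complex^'n \<Rightarrow> complex^'n \<Rightarrow> complex^'n \<Rightarrow> complex^'n" where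
  "pmult e1 e2 v w = dr (cr e1 e2) (cr v w)"

lemma pmult_commute: "pmult e1 e2 v w = pmult e1 e2 w v" "pmult e1 e2 v w = pmult e2 e1 v w"
  by (simp_all add: pmult_def cr_commute[of w v] cr_commute[of e2 e1])

lemma pmult_linear:
  "pmult e1 e2 (v + v') w = pmult e1 e2 v w + pmult e1 e2 v' w"
  "pmult e1 e2 v (w + w') = pmult e1 e2 v w + pmult e1 e2 v w'"
  "pmult e1 e2 (c *s v) w = c *s pmult e1 e2 v w"
  "pmult e1 e2 v (c *s w) = c *s pmult e1 e2 v w"
  by (simp_all add: pmult_def cr_linear dr_linear)

lemma pmult_mem_aux:
  assumes fr: "frame e1 e2 e3" and v: "v \<in> peirce e2 e3" and w: "w \<in> peirce e3 e1"
  shows "cr e1 (pmult e1 e2 v w) = 0"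
proof -
  let ?f = "cr e1 e2"
  have e1: "cr e1 e1 = 0" using fr by (simp add: frame_def)
  have w': "cr w e1 = 0" using w by (simp add: peirce_def cr_commute[of w])
  have 1: "dr (cr v e1) ?f = 0"
    using rank1_dr[OF e1, of v e2] frame_T(1)[OF fr v]
    by (simp add: cr_commute[of v e1] T_sym(2)[of e1 v e2])
  have 2: "T v w e1 = 0" "pairing v ?f = 0" "pairing w ?f = 0" "pairing e1 ?f = 0"
    using w' frame_T(1)[OF fr v] frame_T(3)[OF frame_rotate[OF fr] w] frame_pairing(2)[OF fr]
    by (simp_all only: T_sym3(3)[of v w e1] pairing_commute[of v] pairing_commute[of w]) (simp_all add: T_def)
  have "cr (dr (cr v w) ?f) e1 = 0"
    using mixed[of v w ?f e1] by (simp add: 1 2 w')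
  then show ?thesis unfolding pmult_def cr_commute[of e1 "dr _ _"] dr_commute[of ?f "cr v w"] .
qed

lemma pmult_mem:
  assumes fr: "frame e1 e2 e3" and v: "v \<in> peirce e2 e3" and w: "w \<in> peirce e3 e1"
  shows "pmult e1 e2 v w \<in> peirce e1 e2"
  \<comment> \<open>Annihilation by e2 is annihilation by e1 for the frame with e1 and e2 exchanged
    and the factors swapped.\<close>
  using pmult_mem_aux[OF assms] pmult_mem_aux[OF frame_swap[OF frame_rotate[OF frame_rotate[OF frame_swap[OF fr]]]], of w v]
    pmult_mem_aux[OF frame_rotate[OF frame_swap[OF frame_rotate[OF frame_rotate[OF fr]]]], of w v] v w
    pmult_mem_aux[OF frame_swap[OF frame_rotate[OF fr]], of w v]
  by (simp add: peirce_def pmult_commute(1)[of _ _ w] pmult_commute(2)[of e2])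

lemma T_pmult:
  assumes fr: "frame e1 e2 e3" and z: "z \<in> peirce e1 e2"
  shows "T e3 (pmult e1 e2 v w) z = T v w z"
proof -
  have "T v w z = pairing (cr v w) (dr (cr e1 e2) (cr e3 z))"
    using peirce_project[OF frame_rotate[OF frame_rotate[OF fr]] z] by (simp add: T_def)
  also have "\<dots> = pairing (cr e3 z) (pmult e1 e2 v w)"
    unfolding pmult_def pairing_commute[of "cr v w"] pairing_commute[of "cr e3 z"] dr_assoc[of _ "cr e3 z"] ..
  finally show ?thesis by (simp add: T_def cr_assoc[of e3 z])
qed

text \<open>With q equal to -1/2 times the square under \<open>T\<close>, this is the composition
  law q(v w) = q(v) q(w). It is \<open>adjoint\<close> at v, v, w, w paired with
  \<open>cr e1 e2\<close>: the scalars on the right vanish, and \<open>cr v v\<close>,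
  \<open>cr w w\<close> are multiples of dual frame vectors.\<close>

lemma pmult_norm:
  assumes fr: "frame e1 e2 e3" and v: "v \<in> peirce e2 e3" and w: "w \<in> peirce e3 e1"
  shows "2 * T e3 (pmult e1 e2 v w) (pmult e1 e2 v w) = - (T e1 v v * T e2 w w)"
proof -
  let ?u = "pmult e1 e2 v w"
  have fr2: "frame e2 e3 e1" using fr by (rule frame_rotate)
  have "T e3 ?u ?u = T v w ?u" using fr pmult_mem[OF assms] by (rule T_pmult)
  also have "\<dots> = pairing (dr (cr v w) (cr v w)) (cr e1 e2)"
    unfolding T_def pmult_def pairing_commute[of "cr v w"] dr_commute[of "cr e1 e2"] by (rule dr_assoc)
  finally have 1: "T e3 ?u ?u = pairing (dr (cr v w) (cr v w)) (cr e1 e2)" .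
  have "T v v w = 0" "T w w v = 0" using T_peirce2[OF fr v v, of w] T_peirce2[OF fr2 w w, of v] v w by auto
  moreover have "dr (cr v v) (cr w w) = (T e1 v v * T e2 w w) *s e3"
    unfolding peirce_cr[OF fr v v] peirce_cr[OF fr2 w w]
    using frame_dual(1)[OF frame_rotate[OF fr2]]
    by (simp add: dr_linear cr_commute[of e2 e3] dr_commute[of "cr e3 e2"])
  ultimately have "2 *s dr (cr v w) (cr v w) = - (T e1 v v * T e2 w w) *s e3"
    using adjoint[of v v w w] T_sym3(3)[of v w w] T_sym(2)[of v w v]
    by (simp add: T_def[symmetric] vec_eq_iff algebra_simps eq_neg_iff_add_eq_0)
  then have "pairing (2 *s dr (cr v w) (cr v w)) (cr e1 e2) = pairing (- (T e1 v v * T e2 w w) *s e3) (cr e1 e2)"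
    by simp
  moreover have "pairing e3 (cr e1 e2) = 1" using frame_pairing(1)[OF frame_rotate[OF fr2]] .
  ultimately show ?thesis by (simp add: 1)
qed

lemma pmult_norm_polar:
  assumes fr: "frame e1 e2 e3" and v: "v \<in> peirce e2 e3" and w: "w \<in> peirce e3 e1" "w' \<in> peirce e3 e1"
  shows "2 * T e3 (pmult e1 e2 v w) (pmult e1 e2 v w') = - (T e1 v v * T e2 w w')"
proof -
  have *: "w + w' \<in> peirce e3 e1" using w subspace_peirce vec.subspace_add by blast
  have "2 * (T e1 v v * T e2 w w') + 4 * T e3 (pmult e1 e2 v w) (pmult e1 e2 v w') = 0"
    using * pmult_norm[OF fr v w(1)] pmult_norm[OF fr v w(2)] pmult_norm[OF fr v, of "w + w'"]
    by (simp add: pmult_linear T_linear algebra_simps T_sym(2)[of e3 "pmult e1 e2 v w'" "pmult e1 e2 v w"] T_sym(2)[of e2 w' w])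
  then show ?thesis by algebra
qed

text \<open>Here v has norm q(v) = 1, so multiplication by v is an isometry; multiplication back is
  its adjoint by \<open>T_pmult\<close>, hence its inverse.\<close>

lemma pmult_pmult:
  assumes fr: "frame e1 e2 e3" and v: "v \<in> peirce e2 e3" "T e1 v v = -2" and w: "w \<in> peirce e3 e1"
  shows "pmult e3 e1 v (pmult e1 e2 v w) = w"
proof -
  have fr2: "frame e2 e3 e1" and fr3: "frame e3 e1 e2" using fr frame_rotate by blast+
  interpret W: bilinear_space "\<lambda>x y. - T e2 x y" "peirce e3 e1" using fr2 by (rule peirce_space)
  let ?u = "pmult e1 e2 v w"
  have u: "?u \<in> peirce e1 e2" using pmult_mem[OF fr v(1) w] .
  have mem: "pmult e3 e1 v ?u \<in> peirce e3 e1" using pmult_mem[OF fr3 u v(1)] by (simp add: pmult_commute(1)[of _ _ v])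
  have "pmult e3 e1 v ?u - w = 0"
  proof (rule W.B_nondegenerate)
    show "pmult e3 e1 v ?u - w \<in> peirce e3 e1" using mem w by (rule W.W_diff)
    fix w' assume w': "w' \<in> peirce e3 e1"
    have "T e2 (pmult e3 e1 v ?u) w' = T v ?u w'" using fr3 w' by (rule T_pmult)
    also have "\<dots> = T v w' ?u" by (rule T_sym)
    also have "\<dots> = T e3 (pmult e1 e2 v w') ?u" using T_pmult[OF fr u] by simp
    also have "\<dots> = T e2 w' w" using pmult_norm_polar[OF fr v(1) w' w] v(2) by simp
    finally show "- T e2 (pmult e3 e1 v ?u - w) w' = 0" by (simp add: T_linear T_sym(2)[of e2 w])
  qed
  then show ?thesis by simp
qed

end

section \<open>Composition algebras\<close>

text \<open>B is the polar form of the norm, \<open>B x x\<close> = 2 q(x). This explains the value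
  2 at the unit and the factor 2 in the composition law.\<close>

locale composition_algebra = bilinear_space B A
  for B :: "complex^'n::finite \<Rightarrow> complex^'n \<Rightarrow> complex" and A +
  fixes m :: "complex^'n \<Rightarrow> complex^'n \<Rightarrow> complex^'n" and one :: "complex^'n"
  assumes B_one: "B one one = 2"
    and m_add: "m (x + y) z = m x z + m y z" and m_add2: "m z (x + y) = m z x + m z y"
    and m_scale: "m (c *s x) z = c *s m x z" and m_scale2: "m z (c *s x) = c *s m z x"
    and m_closed: "x \<in> A \<Longrightarrow> y \<in> A \<Longrightarrow> m x y \<in> A"
    and one_closed: "one \<in> A"
    and one_left: "x \<in> A \<Longrightarrow> m one x = x" and one_right: "x \<in> A \<Longrightarrow> m x one = x"
    and composition: "x \<in> A \<Longrightarrow> y \<in> A \<Longrightarrow> 2 * B (m x y) (m x y) = B x x * B y y"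

context composition_algebra
begin

lemma m_zero [simp]: "m 0 z = 0" "m z 0 = 0"
  using m_scale[of 0 0 z] m_scale2[of z 0 0] by simp_all

lemma m_minus: "m (- x) z = - m x z" "m z (- x) = - m z x"
  using m_scale[of "-1" x z] m_scale2[of z "-1" x] by simp_all

lemma m_diff: "m (x - y) z = m x z - m y z" "m z (x - y) = m z x - m z y"
  using m_add[of x "- y" z] m_add2[of z x "- y"] by (simp_all add: m_minus)

lemmas m_linear = m_add m_add2 m_scale m_scale2 m_minus m_diff

lemma composition_left:
  assumes "x \<in> A" "y \<in> A" "z \<in> A"
  shows "2 * B (m x y) (m x z) = B x x * B y z"
proof -
  have "2 * (2 * B (m x y) (m x z)) = 2 * (B x x * B y z)"
    using composition[OF assms(1) W_add[OF assms(2,3)]] composition[OF assms(1,2)] composition[OF assms(1,3)]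
    by (simp add: B_linear m_linear B_commute[of z y] B_commute[of "m x z" "m x y"] algebra_simps)
  then show ?thesis by simp
qed

lemma composition_right:
  assumes "x \<in> A" "y \<in> A" "z \<in> A"
  shows "2 * B (m y x) (m z x) = B x x * B y z"
proof -
  have "2 * (2 * B (m y x) (m z x)) = 2 * (B x x * B y z)"
    using composition[OF W_add[OF assms(2,3)] assms(1)] composition[OF assms(2,1)] composition[OF assms(3,1)]
    by (simp add: B_linear m_linear B_commute[of z y] B_commute[of "m z x" "m y x"] algebra_simps)
  then show ?thesis by simp
qed

lemma composition_polar:
  assumes "x \<in> A" "y \<in> A" "z \<in> A" "w \<in> A"
  shows "B (m x y) (m z w) + B (m x w) (m z y) = B x z * B y w"
proof -
  have "2 * (B (m x y) (m z w) + B (m x w) (m z y)) = 2 * (B x z * B y w)"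
    using composition_left[OF W_add[OF assms(1,3)] assms(2,4)] composition_left[OF assms(1,2,4)] composition_left[OF assms(3,2,4)]
    by (simp add: B_linear m_linear B_commute[of z x] B_commute[of "m z y" "m x w"] algebra_simps)
  then show ?thesis by algebra
qed

definition cnj' :: "complex^'n \<Rightarrow> complex^'n" where
  "cnj' x = B x one *s one - x"

lemma cnj'_closed: "x \<in> A \<Longrightarrow> cnj' x \<in> A"
  by (simp add: cnj'_def W_closed one_closed)

lemma cnj'_cnj': "cnj' (cnj' x) = x"
  by (simp add: cnj'_def B_linear B_one vec_eq_iff algebra_simps)

lemma cnj'_left:
  assumes "x \<in> A" "y \<in> A" "z \<in> A"
  shows "B (m x y) z = B y (m (cnj' x) z)"
  using composition_polar[OF assms(1,2) one_closed assms(3)] assms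
  by (simp add: cnj'_def m_linear B_linear one_left B_commute[of "m x z"] algebra_simps)

lemma cnj'_right:
  assumes "x \<in> A" "y \<in> A" "z \<in> A"
  shows "B (m x y) z = B x (m z (cnj' y))"
  using composition_polar[OF assms(1,2,3) one_closed] assms
  by (simp add: cnj'_def m_linear B_linear one_right algebra_simps)

lemma eqI: "x \<in> A \<Longrightarrow> y \<in> A \<Longrightarrow> (\<And>w. w \<in> A \<Longrightarrow> B x w = B y w) \<Longrightarrow> x = y"
  using B_nondegenerate[of "x - y"] by (simp add: B_linear W_closed)

text \<open>Linearization of the law that multiplying by x and then by its conjugate is
  multiplication by q(x). In the absence of associativity, this and its mirror image carry the
  structure theory.\<close>

lemma alternative_left:
  assumes "x \<in> A" "y \<in> A" "z \<in> A"
  shows "m (cnj' x) (m y z) + m (cnj' y) (m x z) = B x y *s z"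
proof (rule eqI)
  fix w assume w: "w \<in> A"
  have *: "B (m (cnj' a) (m b z)) w = B (m b z) (m a w)" if "a \<in> A" "b \<in> A" for a b
    using cnj'_left[of "cnj' a" "m b z" w] that assms w by (simp add: cnj'_closed cnj'_cnj' m_closed)
  show "B (m (cnj' x) (m y z) + m (cnj' y) (m x z)) w = B (B x y *s z) w"
    using composition_polar[of y z x w] assms w by (simp add: B_linear * B_commute[of "m x z"] B_commute[of y])
qed (use assms in \<open>simp_all add: W_closed m_closed cnj'_closed\<close>)

lemma alternative_right:
  assumes "x \<in> A" "y \<in> A" "z \<in> A"
  shows "m (m y x) (cnj' z) + m (m y z) (cnj' x) = B x z *s y"
proof (rule eqI)
  fix w assume w: "w \<in> A"
  have *: "B (m (m y b) (cnj' a)) w = B (m y b) (m w a)" if "a \<in> A" "b \<in> A" for a b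
    using cnj'_right[of "m y b" "cnj' a" w] that assms w by (simp add: cnj'_closed cnj'_cnj' m_closed)
  show "B (m (m y x) (cnj' z) + m (m y z) (cnj' x)) w = B (B x z *s y) w"
    using composition_polar[of y x w z] assms w by (simp add: B_linear *)
qed (use assms in \<open>simp_all add: W_closed m_closed cnj'_closed\<close>)

text \<open>Adding to \<open>one\<close> the imaginary unit times an orthogonal vector of the same
  norm gives an isotropic vector, and halving makes its trace 1. Over the complex numbers every
  composition algebra larger than the scalars is therefore split.\<close>

lemma exists_split:
  assumes "\<not> A \<subseteq> vec.span {one}"
  shows "\<exists>e\<in>A. B e e = 0 \<and> B e one = 1"
proof -
  obtain i where i: "i \<in> A" "B one i = 0" "B i i = 2"
    using exists_orthogonal[OF one_closed _ assms, of 2] B_one by auto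
  show ?thesis
    by (rule bexI[of _ "(1/2) *s (one + \<i> *s i)"])
       (use i in \<open>simp_all add: B_linear B_one B_commute[of i one] W_closed one_closed\<close>)
qed

end

text \<open>Norm 0 and trace 1 make e an idempotent of the algebra, with \<open>one - e\<close> as
  its complement; see \<open>e_products\<close>.\<close>

locale split_composition_algebra = composition_algebra +
  fixes e
  assumes e_closed: "e \<in> A" and e_isotropic: "B e e = 0" and e_trace: "B e one = 1"
begin

definition e' :: "complex^'a" where "e' = one - e"

lemma e'_closed: "e' \<in> A" and e'_isotropic: "B e' e' = 0" and e'_trace: "B e' one = 1" and B_e_e': "B e e' = 1"
  using e_trace
  by (simp_all add: e'_def W_closed e_closed one_closed B_linear B_one e_isotropic B_commute[of one e])

lemma cnj'_e: "cnj' e = e'" "cnj' e' = e"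
  using e_trace e'_trace by (simp_all add: cnj'_def e'_def)

lemma e_products: "m e' e = 0" "m e e' = 0" "m e e = e" "m e' e' = e'"
proof -
  show 1: "m e' e = 0" using alternative_left[OF e_closed e_closed one_closed]
    by (simp add: cnj'_e one_right e_closed e_isotropic vec_eq_iff)
  show 2: "m e e' = 0" using alternative_right[OF e_closed one_closed e_closed]
    by (simp add: cnj'_e one_left e_closed e_isotropic vec_eq_iff)
  show "m e e = e" "m e' e' = e'" using 1 2 one_left[OF e_closed] one_left[OF e'_closed]
    by (simp_all add: e'_def m_linear algebra_simps)
qed

lemma m_e':
  assumes "a \<in> A"
  shows "m e' a = a - m e a" "m a e' = a - m a e"
  using assms by (simp_all add: e'_def m_linear one_left one_right)

lemma m_e_m_e: "a \<in> A \<Longrightarrow> m e (m e a) = m e a"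
  using alternative_left[OF e_closed e_closed, of a]
  by (simp add: cnj'_e m_e' e_isotropic m_closed e_closed vec_eq_iff)

lemma m_e_a_e: "a \<in> A \<Longrightarrow> m (m e a) e = B a e' *s e"
  using alternative_right[of a e e'] by (simp add: cnj'_e e_products e_closed e'_closed)

text \<open>U and V are the off-diagonal Peirce spaces of e. In Zorn's vector matrices, e and
  \<open>e'\<close> are the diagonal units, and U and V the two off-diagonal vector
  positions.\<close>

definition U :: "(complex^'a) set" where "U = {u \<in> A. m e u = u \<and> m u e = 0}"
definition V :: "(complex^'a) set" where "V = {v \<in> A. m e v = 0 \<and> m v e = v}"

text \<open>Exchanging e with its complement exchanges U and V, so each statement on V follows from
  the one on U.\<close>

lemma dual: "split_composition_algebra B A m one e'"
  by unfold_locales (simp_all add: e'_closed e'_isotropic e'_trace)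

lemma dual_e': "split_composition_algebra.e' one e' = e"
  by (subst split_composition_algebra.e'_def[OF dual]) (simp add: e'_def)

lemma dual_U: "split_composition_algebra.U A m e' = V" and dual_V: "split_composition_algebra.V A m e' = U"
  by (auto simp: split_composition_algebra.U_def[OF dual] split_composition_algebra.V_def[OF dual] U_def V_def m_e')

lemma subspace_U: "vec.subspace U"
  by (auto simp: vec.subspace_def U_def W_closed m_linear)

lemma subspace_V: "vec.subspace V"
  using split_composition_algebra.subspace_U[OF dual] by (simp add: dual_U)

lemma U_table:
  assumes "u \<in> U"
  shows "u \<in> A" "m e u = u" "m u e = 0" "m e' u = 0" "m u e' = u"
  using assms by (auto simp: U_def m_e')

lemma V_table:
  assumes "v \<in> V"
  shows "v \<in> A" "m e v = 0" "m v e = v" "m e' v = v" "m v e' = 0"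
  using assms by (auto simp: V_def m_e')

lemma B_U:
  assumes u: "u \<in> U"
  shows "B u e = 0" "B u e' = 0" "u' \<in> U \<Longrightarrow> B u u' = 0"
  using composition_left[OF e_closed, of u e] composition_right[OF e'_closed, of u e'] composition_left[OF e_closed, of u u']
    U_table[OF u] U_table[of u'] e_products
  by (simp_all add: e_closed e'_closed e_isotropic e'_isotropic)

lemma B_V:
  assumes v: "v \<in> V"
  shows "B v e = 0" "B v e' = 0" "v' \<in> V \<Longrightarrow> B v v' = 0"
  using split_composition_algebra.B_U[OF dual, unfolded dual_U dual_e', OF v] by simp_all

lemma cnj'_U: "u \<in> U \<Longrightarrow> cnj' u = - u"
  using B_U[of u] by (simp add: cnj'_def e'_def B_linear)

lemma cnj'_V: "v \<in> V \<Longrightarrow> cnj' v = - v"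
  using B_V[of v] by (simp add: cnj'_def e'_def B_linear)

lemma decomposition_U:
  assumes a: "a \<in> A"
  shows "m e a - B a e' *s e \<in> U"
  using a m_e_m_e[OF a] m_e_a_e[OF a] e_products by (simp add: U_def W_closed m_closed e_closed m_linear)

lemma decomposition_V:
  assumes a: "a \<in> A"
  shows "m e' a - B a e *s e' \<in> V"
  using split_composition_algebra.decomposition_U[OF dual a] by (simp add: dual_U dual_e')

lemma decomposition:
  assumes a: "a \<in> A"
  shows "a = B a e' *s e + B a e *s e' + (m e a - B a e' *s e) + (m e' a - B a e *s e')"
  using m_e'[OF a] by simp

text \<open>The alternative laws show that e fixes the product from both sides, and
  \<open>m_e_a_e\<close> makes such an element a multiple of e.\<close>

lemma U_V_product:
  assumes "u \<in> U" "v \<in> V"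
  shows "m u v = - B u v *s e"
proof -
  have uv: "u \<in> A" "v \<in> A" "m u v \<in> A" using assms by (simp_all add: U_table V_table m_closed)
  have "m e' (m u v) = 0"
    using alternative_left[OF e_closed uv(1,2)] assms B_U[OF assms(1)] B_commute[of e u]
    by (simp add: cnj'_e cnj'_U V_table)
  then have 1: "m e (m u v) = m u v" using uv by (simp add: m_e')
  have "m (m u v) e = m u v"
    using alternative_right[OF uv(2,1) e'_closed] assms B_V[OF assms(2)]
    by (simp add: cnj'_e cnj'_V U_table m_linear)
  then have "m u v = B (m u v) e' *s e" using m_e_a_e[OF uv(3)] 1 by simp
  moreover have "B (m u v) e' = - B u v"
    using cnj'_left[OF uv(1,2) e'_closed] assms by (simp add: cnj'_U m_linear U_table B_linear B_commute[of u v])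
  ultimately show ?thesis by simp
qed

lemma V_U_product:
  assumes "u \<in> U" "v \<in> V"
  shows "m v u = - B u v *s e'"
  using split_composition_algebra.U_V_product[OF dual, of v u] assms by (simp add: dual_U dual_V B_commute[of v u])

lemma U_U_product:
  assumes "u \<in> U" "u' \<in> U"
  shows "m u u' \<in> V" "m u u' = - m u' u"
proof -
  have uu: "u \<in> A" "u' \<in> A" "m u u' \<in> A" using assms by (simp_all add: U_table m_closed)
  have "m e' (m u u') = m u u'"
    using alternative_left[OF e_closed uu(1,2)] assms B_U[OF assms(1)] B_commute[of e u]
    by (simp add: cnj'_e cnj'_U U_table m_linear)
  moreover have "m (m u u') e' = 0"
    using alternative_right[OF uu(2,1) e_closed] assms B_U[OF assms(2)]
    by (simp add: cnj'_e cnj'_U U_table m_linear)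
  ultimately show "m u u' \<in> V" using uu by (simp add: V_def m_e')
  show "m u u' = - m u' u"
    using alternative_left[OF uu(1,2) one_closed] assms B_U(3)[OF assms]
    by (simp add: cnj'_U m_linear one_right uu add_eq_0_iff) (metis minus_minus)
qed

lemma V_V_product:
  assumes "v \<in> V" "v' \<in> V"
  shows "m v v' \<in> U" "m v v' = - m v' v"
  using split_composition_algebra.U_U_product[OF dual, of v v'] assms by (simp_all add: dual_U dual_V)

text \<open>The triple product identity for the cross product, here an instance of
  \<open>alternative_right\<close>.\<close>

lemma U_U_V_product:
  assumes "u1 \<in> U" "u2 \<in> U" "v \<in> V"
  shows "m (m u1 u2) v = B u1 v *s u2 - B u2 v *s u1"
  using alternative_right[of u2 u1 v] assms
  by (simp add: U_table V_table cnj'_U cnj'_V m_linear U_V_product vec_eq_iff algebra_simps eq_neg_iff_add_eq_0)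

lemma V_V_U_product:
  assumes "v1 \<in> V" "v2 \<in> V" "u \<in> U"
  shows "m (m v1 v2) u = B v1 u *s v2 - B v2 u *s v1"
  using split_composition_algebra.U_U_V_product[OF dual, of v1 v2 u] assms by (simp add: dual_U dual_V)

lemma U_V_nondegenerate:
  assumes "u \<in> U" "\<And>v. v \<in> V \<Longrightarrow> B u v = 0"
  shows "u = 0"
proof (rule B_nondegenerate)
  show "u \<in> A" using assms by (simp add: U_table)
  fix w assume w: "w \<in> A"
  show "B u w = 0"
    by (subst decomposition[OF w])
      (simp only: B_add2 B_scale2 B_U(1,2)[OF assms(1)] B_U(3)[OF assms(1) decomposition_U[OF w]] assms(2)[OF decomposition_V[OF w]], simp)
qed

lemma V_U_nondegenerate:
  assumes "v \<in> V" "\<And>u. u \<in> U \<Longrightarrow> B u v = 0"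
  shows "v = 0"
  using split_composition_algebra.U_V_nondegenerate[OF dual, of v] assms by (simp add: dual_U dual_V B_commute[of v])

lemma product_decomposed:
  assumes "u \<in> U" "u' \<in> U" "v \<in> V" "v' \<in> V"
  shows "m (p *s e + q *s e' + u + v) (p' *s e + q' *s e' + u' + v') =
    (p * p' - B u v') *s e + (q * q' - B u' v) *s e' + (p *s u' + q' *s u + m v v') + (q *s v' + p' *s v + m u u')"
  using assms
  by (simp add: m_linear e_products U_table V_table U_V_product V_U_product vec_eq_iff algebra_simps)

lemma B_decomposed:
  assumes "u \<in> U" "u' \<in> U" "v \<in> V" "v' \<in> V"
  shows "B (p *s e + q *s e' + u + v) (p' *s e + q' *s e' + u' + v') = p * q' + q * p' + B u v' + B u' v"
proof -
  have "B e u' = 0" "B e' u' = 0" "B e v' = 0" "B e' v' = 0"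
    using B_U[OF assms(2)] B_V[OF assms(4)] by (simp_all only: B_commute[of _ u'] B_commute[of _ v'])
  moreover have "B e' e = 1" using B_e_e' by (simp only: B_commute)
  moreover have "B v u' = B u' v" by (rule B_commute)
  ultimately show ?thesis
    using B_U[OF assms(1)] B_V[OF assms(3)] assms
    by (simp add: B_linear e_isotropic e'_isotropic B_e_e' algebra_simps)
qed

lemma cnj'_decomposed:
  assumes "u \<in> U" "v \<in> V"
  shows "cnj' (p *s e + q *s e' + u + v) = q *s e + p *s e' + - u + - v"
  using assms B_U[of u] B_V[of v] B_e_e'
  by (simp add: cnj'_def e'_def B_linear e_isotropic e_trace B_commute[of one e] B_one vec_eq_iff algebra_simps)

lemma norm_decomposed:
  assumes "u \<in> U" "v \<in> V"
  shows "B (p *s e + q *s e' + u + v) (p *s e + q *s e' + u + v) = 2 * (p * q + B u v)"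
  using B_decomposed[OF assms(1,1,2,2)] by simp

lemma triple_decomposed:
  assumes "u1 \<in> U" "u2 \<in> U" "u3 \<in> U" "v1 \<in> V" "v2 \<in> V" "v3 \<in> V"
  shows "B (m (p1 *s e + q1 *s e' + u1 + v1) (p2 *s e + q2 *s e' + u2 + v2)) (cnj' (p3 *s e + q3 *s e' + u3 + v3)) =
    p1 * p2 * p3 + q1 * q2 * q3 - p3 * B u1 v2 - q3 * B u2 v1 - p1 * B u2 v3 - q2 * B u1 v3
    - p2 * B u3 v1 - q1 * B u3 v2 - B (m v1 v2) v3 - B (m u1 u2) u3"
proof -
  have U: "p1 *s u2 + q2 *s u1 + m v1 v2 \<in> U" "- u3 \<in> U"
    using assms subspace_U V_V_product(1) by (auto intro!: vec.subspace_add vec.subspace_scale vec.subspace_neg)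
  have V: "q1 *s v2 + p2 *s v1 + m u1 u2 \<in> V" "- v3 \<in> V"
    using assms subspace_V U_U_product(1) by (auto intro!: vec.subspace_add vec.subspace_scale vec.subspace_neg)
  show ?thesis
    unfolding product_decomposed[OF assms(1,2,4,5)] cnj'_decomposed[OF assms(3,6)] B_decomposed[OF U V]
    by (simp add: B_linear B_commute[of "m u1 u2" u3] algebra_simps)
qed

text \<open>Dual bases of U and V, multiplied by the cross product as in Zorn's vector matrices. The
  norm there is p q minus a dot product, while \<open>norm_decomposed\<close> has +
  \<open>B u v\<close>; hence the values -1.\<close>

definition triad where
  "triad u1 u2 u3 v1 v2 v3 \<longleftrightarrow> u1 \<in> U \<and> u2 \<in> U \<and> u3 \<in> U \<and> v1 \<in> V \<and> v2 \<in> V \<and> v3 \<in> V \<and>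
    m u1 u2 = v3 \<and> m u2 u3 = v1 \<and> m u3 u1 = v2 \<and>
    B u1 v1 = -1 \<and> B u2 v2 = -1 \<and> B u3 v3 = -1 \<and> B u1 v2 = 0 \<and> B u1 v3 = 0 \<and>
    B u2 v1 = 0 \<and> B u2 v3 = 0 \<and> B u3 v1 = 0 \<and> B u3 v2 = 0"

lemma triad_V_products:
  assumes "triad u1 u2 u3 v1 v2 v3"
  shows "m v1 v2 = - u3" "m v2 v3 = - u1" "m v3 v1 = - u2"
  using assms U_U_V_product[of u2 u3 v2] U_U_V_product[of u3 u1 v3] U_U_V_product[of u1 u2 v1]
  by (auto simp: triad_def)

text \<open>This bounds the dimension of U by 3. The part w' of w orthogonal to all three v's is
  annihilated by u1, which is minus the product of v2 and v3, and multiplying \<open>m u1 w'\<close>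
  by v1 returns - w'.\<close>

lemma triad_spans_U:
  assumes t: "triad u1 u2 u3 v1 v2 v3" and w: "w \<in> U"
  shows "w = - B w v1 *s u1 - B w v2 *s u2 - B w v3 *s u3"
proof -
  note t' = t[unfolded triad_def]
  define w' where "w' = w + B w v1 *s u1 + B w v2 *s u2 + B w v3 *s u3"
  have w': "w' \<in> U" using w t' subspace_U unfolding w'_def
    by (auto intro!: vec.subspace_add vec.subspace_scale)
  have B: "B w' v1 = 0" "B w' v2 = 0" "B w' v3 = 0"
    using t' by (simp_all add: w'_def B_linear)
  have "m (m v2 v3) w' = 0" using V_V_U_product[of v2 v3 w'] t' w' B by (simp add: B_commute[of _ w'])
  then have "m u1 w' = 0" using triad_V_products[OF t] by (simp add: m_minus)
  then have "w' = 0" using U_U_V_product[of u1 w' v1] t' w' B by simp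
  then show ?thesis by (simp add: w'_def algebra_simps eq_neg_iff_add_eq_0)
qed

lemma triad_spans_V:
  assumes t: "triad u1 u2 u3 v1 v2 v3" and w: "w \<in> V"
  shows "w = - B u1 w *s v1 - B u2 w *s v2 - B u3 w *s v3"
proof -
  note t' = t[unfolded triad_def]
  define w' where "w' = w + B u1 w *s v1 + B u2 w *s v2 + B u3 w *s v3"
  have w': "w' \<in> V" using w t' subspace_V unfolding w'_def
    by (auto intro!: vec.subspace_add vec.subspace_scale)
  have "w' = 0"
  proof (rule V_U_nondegenerate[OF w'])
    fix u assume "u \<in> U"
    then have u: "u = - B u v1 *s u1 - B u v2 *s u2 - B u v3 *s u3" by (rule triad_spans_U[OF t])
    have "B u1 w' = 0" "B u2 w' = 0" "B u3 w' = 0" using t' by (simp_all add: w'_def B_linear)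
    then show "B u w' = 0" by (subst u) (simp add: B_linear)
  qed
  then show ?thesis by (simp add: w'_def algebra_simps eq_neg_iff_add_eq_0)
qed

text \<open>U and V are dual and A has dimension 2 + 2 dim U, so the cases are dimensions 2, 4 and
  8; the scalars themselves do not occur because e exists. If U contains independent u and u2, the
  triple product identity makes \<open>m u u2\<close> nonzero, and a u3 dual to it completes a triad
  whose v's are the pairwise products.\<close>

theorem Hurwitz:
  obtains (zero) "U = {0}" "V = {0}"
  | (one) u v where "u \<in> U" "v \<in> V" "B u v = -1" "\<And>w. w \<in> U \<Longrightarrow> w = - B w v *s u" "\<And>w. w \<in> V \<Longrightarrow> w = - B u w *s v"
  | (three) u1 u2 u3 v1 v2 v3 where "triad u1 u2 u3 v1 v2 v3"
proof (cases "U \<subseteq> {0}")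
  case True
  then have U: "U = {0}" using vec.subspace_0[OF subspace_U] by auto
  have "V = {0}"
    using V_U_nondegenerate U vec.subspace_0[OF subspace_V] by fastforce
  with U show ?thesis by (rule zero)
next
  case False
  then obtain u where u: "u \<in> U" "u \<noteq> 0" by auto
  then obtain v where v: "v \<in> V" "B u v = -1"
  proof -
    obtain v where v: "v \<in> V" "B u v \<noteq> 0" using U_V_nondegenerate[OF u(1)] u(2) by blast
    show ?thesis
      by (rule that[of "(- 1 / B u v) *s v"]) (use v vec.subspace_scale[OF subspace_V v(1), of "- 1 / B u v"] in \<open>simp_all add: B_linear\<close>)
  qed
  show ?thesis
  proof (cases "\<forall>w\<in>U. w = - B w v *s u")
    case U: True
    show ?thesis
    proof (rule one[OF u(1) v])
      show "w = - B w v *s u" if "w \<in> U" for w using U that by blast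
      show "w = - B u w *s v" if w: "w \<in> V" for w
      proof -
        have "w + B u w *s v = 0"
        proof (rule V_U_nondegenerate)
          show "w + B u w *s v \<in> V" using w v subspace_V by (auto intro: vec.subspace_add vec.subspace_scale)
          fix x assume "x \<in> U"
          then have x: "x = - B x v *s u" using U by blast
          show "B x (w + B u w *s v) = 0" by (subst x) (simp add: B_linear v)
        qed
        then show ?thesis by (simp add: eq_neg_iff_add_eq_0)
      qed
    qed
  next
    case False
    then obtain u2 where u2: "u2 \<in> U" "u2 \<noteq> - B u2 v *s u" by blast
    have "m u u2 \<noteq> 0"
    proof
      assume "m u u2 = 0"
      then have "B u v *s u2 - B u2 v *s u = 0" using U_U_V_product[OF u(1) u2(1) v(1)] by simp
      then have "u2 = - B u2 v *s u" using v(2) by (simp add: minus_equation_iff[of u2])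
      then show False using u2(2) by blast
    qed
    then obtain w where w: "w \<in> U" "B w (m u u2) \<noteq> 0" using V_U_nondegenerate[of "m u u2"] U_U_product(1) u u2 by blast
    define u3 where "u3 = (- 1 / B w (m u u2)) *s w"
    have u3: "u3 \<in> U" "B u3 (m u u2) = -1"
      using w vec.subspace_scale[OF subspace_U w(1), of "- 1 / B w (m u u2)"] by (simp_all add: u3_def B_linear)
    have alt: "B x (m x y) = 0" "B y (m x y) = 0" if "x \<in> U" "y \<in> U" for x y
    proof -
      have "m x x = 0" "m y y = 0" using U_U_product(2)[of x x] U_U_product(2)[of y y] that by (simp_all add: vec_eq_iff)
      then show "B x (m x y) = 0" "B y (m x y) = 0"
        using cnj'_left[of x y x] cnj'_right[of x y y] that
        by (simp_all add: U_table cnj'_U m_linear B_commute[of _ "m x y"])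
    qed
    have cyc: "B x (m y z) = B z (m x y)" if "x \<in> U" "y \<in> U" "z \<in> U" for x y z
      using cnj'_right[of x y z] U_U_product(2)[of y z] that
      by (simp add: U_table cnj'_U m_linear B_linear B_commute[of z])
    show ?thesis
      using three[of u u2 u3 "m u2 u3" "m u3 u" "m u u2"] u u2 u3 alt[OF u(1) u2(1)] alt[OF u2(1) u3(1)] alt[OF u3(1) u(1)]
        cyc[OF u(1) u2(1) u3(1)] cyc[OF u2(1) u3(1) u(1)]
      by (simp add: triad_def U_U_product(1))
  qed
qed

end

section \<open>Coordinates\<close>

lemma (in composition_algebra) B_cnj': "B (cnj' x) (cnj' x) = B x x"
  by (simp add: cnj'_def B_linear B_one B_commute[of one x])

lemma (in composition_algebra) cnj'_linear:
  "cnj' (x + y) = cnj' x + cnj' y" "cnj' (c *s x) = c *s cnj' x"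
  by (simp_all add: cnj'_def B_linear vec_eq_iff algebra_simps)

text \<open>The value -2 means norm 1. Multiplication by y1 and y2 then identifies the other two
  Peirce spaces isometrically with the third, and the transported product acquires the product of y1
  and y2 as its unit, as in Jacobson's coordinatization theorem.\<close>

locale coordinatized = cubic_pair cr dr for cr dr :: "complex^'n::finite \<Rightarrow> complex^'n \<Rightarrow> complex^'n" +
  fixes e1 e2 e3 y1 y2
  assumes fr: "frame e1 e2 e3" and y1: "y1 \<in> peirce e2 e3" "T e1 y1 y1 = -2"
    and y2: "y2 \<in> peirce e3 e1" "T e2 y2 y2 = -2"
begin

lemma fr2: "frame e2 e3 e1" and fr3: "frame e3 e1 e2"
  using fr frame_rotate by blast+

definition phi1 where "phi1 a = pmult e2 e3 y2 a"
definition phi2 where "phi2 b = pmult e3 e1 b y1"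
definition cmult where "cmult a b = pmult e1 e2 (phi1 a) (phi2 b)"
definition cone where "cone = pmult e1 e2 y1 y2"
abbreviation "A \<equiv> peirce e1 e2"
abbreviation "B \<equiv> \<lambda>x y. - T e3 x y"

lemma phi_linear:
  "phi1 (a + b) = phi1 a + phi1 b" "phi1 (c *s a) = c *s phi1 a"
  "phi2 (a + b) = phi2 a + phi2 b" "phi2 (c *s a) = c *s phi2 a"
  by (simp_all add: phi1_def phi2_def pmult_linear)

lemma phi1_mem: "a \<in> A \<Longrightarrow> phi1 a \<in> peirce e2 e3"
  unfolding phi1_def by (rule pmult_mem[OF fr2 y2(1)])

lemma phi2_mem: "b \<in> A \<Longrightarrow> phi2 b \<in> peirce e3 e1"
  unfolding phi2_def by (rule pmult_mem[OF fr3 _ y1(1)])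

lemma phi1_isometry: "a \<in> A \<Longrightarrow> b \<in> A \<Longrightarrow> T e1 (phi1 a) (phi1 b) = T e3 a b"
  using pmult_norm_polar[OF fr2 y2(1)] y2(2) by (simp add: phi1_def)

lemma swapped: "frame e1 e3 e2" "y1 \<in> peirce e3 e2"
  using fr frame_swap y1 by (auto simp: peirce_commute)

lemma phi2_isometry: "a \<in> A \<Longrightarrow> b \<in> A \<Longrightarrow> T e2 (phi2 a) (phi2 b) = T e3 a b"
  using pmult_norm_polar[OF swapped, of a b] y1(2)
  by (simp add: phi2_def peirce_commute[of e2 e1] pmult_commute(1)[of _ _ _ y1] pmult_commute(2)[of e3 e1])

lemma pmult_pmult':
  "b \<in> A \<Longrightarrow> pmult e1 e2 y1 (phi2 b) = b"
  "a \<in> A \<Longrightarrow> pmult e1 e2 (phi1 a) y2 = a"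
  "phi1 cone = y1" "phi2 cone = y2"
  "v \<in> peirce e2 e3 \<Longrightarrow> phi1 (pmult e1 e2 v y2) = v"
  "w \<in> peirce e3 e1 \<Longrightarrow> phi2 (pmult e1 e2 y1 w) = w"
proof -
  show "pmult e1 e2 y1 (phi2 b) = b" if "b \<in> A" for b
    using pmult_pmult[OF swapped y1(2), of b] that
    by (simp add: phi2_def peirce_commute[of e2 e1] pmult_commute(1)[of _ _ b y1] pmult_commute(2)[of e2 e1] pmult_commute(2)[of e1 e3])
  show "pmult e1 e2 (phi1 a) y2 = a" if "a \<in> A" for a
    using pmult_pmult[OF fr2 y2, of a] that
    by (simp add: phi1_def pmult_commute(1)[of e1 e2 _ y2])
  have sw: "frame e2 e1 e3" "y2 \<in> peirce e1 e3" using frame_swap[OF fr2] y2 by (simp_all add: peirce_commute)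
  show 1: "phi1 (pmult e1 e2 v y2) = v" if "v \<in> peirce e2 e3" for v
    using pmult_pmult[OF sw y2(2), of v] that
    by (simp add: phi1_def peirce_commute[of e3 e2] pmult_commute(1)[of _ _ v y2] pmult_commute(2)[of e2 e1] pmult_commute(2)[of e3 e2])
  show 2: "phi2 (pmult e1 e2 y1 w) = w" if "w \<in> peirce e3 e1" for w
    using pmult_pmult[OF fr y1, of w] that by (simp add: phi2_def pmult_commute(1)[of e3 e1 _ y1])
  show "phi1 cone = y1" "phi2 cone = y2" using 1 2 y1 y2 by (simp_all add: cone_def)
qed

sublocale C: composition_algebra B A cmult cone
proof -
  interpret bilinear_space B A using peirce_space[OF fr3] .
  show "composition_algebra B A cmult cone"
  proof
    show "- T e3 cone cone = 2" using pmult_norm[OF fr y1(1) y2(1)] y1 y2 by (simp add: cone_def)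
    show "cone \<in> A" unfolding cone_def using pmult_mem[OF fr y1(1) y2(1)] .
    show "cmult x y \<in> A" if "x \<in> A" "y \<in> A" for x y
      unfolding cmult_def using pmult_mem[OF fr phi1_mem phi2_mem] that .
    show "cmult cone x = x" "cmult x cone = x" if "x \<in> A" for x
      using that by (simp_all add: cmult_def pmult_pmult')
    show "2 * - T e3 (cmult x y) (cmult x y) = - T e3 x x * - T e3 y y" if "x \<in> A" "y \<in> A" for x y
      using pmult_norm[OF fr phi1_mem phi2_mem] that by (simp add: cmult_def phi1_isometry phi2_isometry)
  qed (simp_all add: cmult_def phi_linear pmult_linear)
qed

text \<open>The conjugate in the last component turns the cubic term into the cyclically symmetric form
  \<open>tr((a b) c)\<close>.\<close>

definition theta where
  "theta r s t a b c = r *s e1 + s *s e2 + t *s e3 + (phi1 a + phi2 b + - C.cnj' c)"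

lemma theta_cubic:
  assumes "a \<in> A" "b \<in> A" "c \<in> A"
  shows "T (theta r s t a b c) (theta r s t a b c) (theta r s t a b c) =
    6 * (r * s * t) - 3 * (r * B a a + s * B b b + t * B c c) + 6 * B (cmult a b) (C.cnj' c)"
proof -
  have c: "- C.cnj' c \<in> A" using assms by (simp add: C.W_closed C.cnj'_closed)
  have "T (phi1 a) (phi2 b) (- C.cnj' c) = T e3 (cmult a b) (- C.cnj' c)"
    using T_pmult[OF fr c] by (simp add: cmult_def)
  moreover have "T e3 (- C.cnj' c) (- C.cnj' c) = T e3 c c" using C.B_cnj'[of c] by (simp add: T_linear)
  ultimately show ?thesis
    using cubic_expansion[OF fr phi1_mem[OF assms(1)] phi2_mem[OF assms(2)] c theta_def[of r s t]] assms
    by (simp add: phi1_isometry phi2_isometry T_linear algebra_simps)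
qed

lemma theta_linear:
  "theta (r + r') (s + s') (t + t') (a + a') (b + b') (c + c') = theta r s t a b c + theta r' s' t' a' b' c'"
  "theta (k * r) (k * s) (k * t) (k *s a) (k *s b) (k *s c) = k *s theta r s t a b c"
  by (simp_all add: theta_def phi_linear C.cnj'_linear vec_eq_iff algebra_simps)

lemma theta_surj: "\<exists>r s t. \<exists>a\<in>A. \<exists>b\<in>A. \<exists>c\<in>A. x = theta r s t a b c"
proof -
  obtain r s t a1 a2 a3 where *: "x = r *s e1 + s *s e2 + t *s e3 + a1 + a2 + a3"
    "a1 \<in> peirce e2 e3" "a2 \<in> peirce e3 e1" "a3 \<in> peirce e1 e2"
    using peirce_decomposition[OF fr, of x] peirce_proj_mem[OF fr, of x] peirce_proj_mem[OF fr2, of x] peirce_proj_mem[OF fr3, of x]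
    by metis
  have "x = theta r s t (pmult e1 e2 a1 y2) (pmult e1 e2 y1 a2) (C.cnj' (- a3))"
    using * by (simp add: theta_def pmult_pmult' C.cnj'_cnj' algebra_simps)
  moreover have "pmult e1 e2 a1 y2 \<in> A" "pmult e1 e2 y1 a2 \<in> A" "C.cnj' (- a3) \<in> A"
    using * y1 y2 fr by (auto intro: pmult_mem C.cnj'_closed C.W_closed)
  ultimately show ?thesis by blast
qed

lemma theta_inj:
  assumes 0: "theta r s t a b c = 0" and abc: "a \<in> A" "b \<in> A" "c \<in> A"
  shows "r = 0" "s = 0" "t = 0" "a = 0" "b = 0" "c = 0"
proof -
  define d where "d = - C.cnj' c"
  have c: "d \<in> A" using abc by (simp add: d_def C.W_closed C.cnj'_closed)
  note fa = frame_T[OF fr phi1_mem[OF abc(1)]] and fb = frame_T[OF fr2 phi2_mem[OF abc(2)]] and fc = frame_T[OF fr3 c]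
  have cr0: "cr e1 e1 = 0" "cr e2 e2 = 0" "cr e3 e3 = 0" "cr e2 (phi1 a) = 0" "cr e3 (phi1 a) = 0"
    "cr e3 (phi2 b) = 0" "cr e1 (phi2 b) = 0" "cr e1 d = 0" "cr e2 d = 0"
    using fr phi1_mem[OF abc(1)] phi2_mem[OF abc(2)] c by (simp_all add: frame_def peirce_def)
  have T0: "T e1 e1 z = 0" "T e2 e2 z = 0" "T e3 e3 z = 0" "T e2 (phi1 a) z = 0" "T e3 (phi1 a) z = 0"
    "T e3 (phi2 b) z = 0" "T e1 (phi2 b) z = 0" "T e1 d z = 0" "T e2 d z = 0" for z
    by (simp_all only: T_def cr0 pairing_simps)
  have T1: "T e1 e2 e3 = 1" "T e2 e3 e1 = 1" "T e3 e1 e2 = 1" using fr fr2 fr3 by (simp_all add: frame_def)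
  have Te: "T e1 z e1 = 0" "T e2 z e2 = 0" "T e3 z e3 = 0" for z
    using T0 unfolding T_sym(2)[of _ z] by simp_all
  have Tee: "T e2 e3 e3 = 0" "T e3 e1 e1 = 0" "T e1 e2 e2 = 0"
    unfolding T_sym3(3)[of e2 e3 e3] T_sym3(3)[of e3 e1 e1] T_sym3(3)[of e1 e2 e2] by (simp_all only: T0)
  have th: "T x y (theta r s t a b c) = r * T x y e1 + s * T x y e2 + t * T x y e3 + T x y (phi1 a) + T x y (phi2 b) + T x y d" for x y
    unfolding theta_def d_def[symmetric] by (simp only: T_linear(3,9)) simp
  have "T e2 e3 (theta r s t a b c) = r" "T e3 e1 (theta r s t a b c) = s" "T e1 e2 (theta r s t a b c) = t"
    unfolding th using fa fb fc T1 T0 Te Tee by simp_all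
  then show "r = 0" "s = 0" "t = 0" using 0 by simp_all
  then have *: "phi1 a + phi2 b + d = 0" using 0 by (simp add: theta_def d_def)
  have "T e1 (phi1 a + phi2 b + d) z = T e1 (phi1 a) z" "T e2 (phi1 a + phi2 b + d) z = T e2 (phi2 b) z"
    "T e3 (phi1 a + phi2 b + d) z = T e3 d z" for z
    by (simp_all only: T_linear T0) simp_all
  then have z: "T e1 (phi1 a) z = 0" "T e2 (phi2 b) z = 0" "T e3 d z = 0" for z unfolding * by simp_all
  show "a = 0" by (rule C.B_nondegenerate[OF abc(1)]) (use z phi1_isometry abc in \<open>metis minus_zero\<close>)
  show "b = 0" by (rule C.B_nondegenerate[OF abc(2)]) (use z phi2_isometry abc in \<open>metis minus_zero\<close>)
  have "d = 0" by (rule C.B_nondegenerate[OF c]) (use z in simp)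
  then have "C.cnj' c = 0" by (simp add: d_def)
  then show "c = 0" using C.cnj'_cnj'[of c] by (simp add: C.cnj'_def)
qed

end

section \<open>Explicit cubic forms in 6, 9, 15 and 27 coordinates\<close>

lemma exhaust_6: "(i :: 6) = 1 \<or> i = 2 \<or> i = 3 \<or> i = 4 \<or> i = 5 \<or> i = 6"
proof (induct i)
  case (of_int z)
  then have "0 \<le> z" "z < 6" by simp_all
  then have "z = 0 \<or> z = 1 \<or> z = 2 \<or> z = 3 \<or> z = 4 \<or> z = 5" by arith
  then show ?case by auto
qed

lemma forall_6: "(\<forall>i::6. P i) \<longleftrightarrow> P 1 \<and> P 2 \<and> P 3 \<and> P 4 \<and> P 5 \<and> P 6"
  by (metis exhaust_6)

lemma exhaust_15: "(i :: 15) \<in> {1, 2, 3, 4, 5, 6, 7, 8, 9, 10, 11, 12, 13, 14, 15}"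
proof (induct i)
  case (of_int z)
  then have "0 \<le> z" "z < 15" by simp_all
  then have "z \<in> {0, 1, 2, 3, 4, 5, 6, 7, 8, 9, 10, 11, 12, 13, 14}" by (simp, arith)
  then show ?case by auto
qed

lemma forall_15: "(\<forall>i::15. P i) \<longleftrightarrow> P 1 \<and> P 2 \<and> P 3 \<and> P 4 \<and> P 5 \<and> P 6 \<and> P 7 \<and> P 8 \<and>
    P 9 \<and> P 10 \<and> P 11 \<and> P 12 \<and> P 13 \<and> P 14 \<and> P 15"
proof
  assume *: "P 1 \<and> P 2 \<and> P 3 \<and> P 4 \<and> P 5 \<and> P 6 \<and> P 7 \<and> P 8 \<and> P 9 \<and> P 10 \<and> P 11 \<and> P 12 \<and> P 13 \<and> P 14 \<and> P 15"
  show "\<forall>i. P i"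
  proof
    fix i :: 15
    show "P i" using exhaust_15[of i] * by auto
  qed
qed simp

lemma vector_6 [simp]:
  "(vector [a, b, c, d, e, f] :: complex^6) $ 1 = a" "(vector [a, b, c, d, e, f] :: complex^6) $ 2 = b"
  "(vector [a, b, c, d, e, f] :: complex^6) $ 3 = c" "(vector [a, b, c, d, e, f] :: complex^6) $ 4 = d"
  "(vector [a, b, c, d, e, f] :: complex^6) $ 5 = e" "(vector [a, b, c, d, e, f] :: complex^6) $ 6 = f"
  by (simp_all add: vector_def)

lemma vector_15 [simp]:
  fixes a b c d e f g h i j k l m n p :: complex
  defines "v \<equiv> (vector [a, b, c, d, e, f, g, h, i, j, k, l, m, n, p] :: complex^15)"
  shows "v $ 1 = a" "v $ 2 = b" "v $ 3 = c" "v $ 4 = d" "v $ 5 = e" "v $ 6 = f" "v $ 7 = g" "v $ 8 = h"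
    "v $ 9 = i" "v $ 10 = j" "v $ 11 = k" "v $ 12 = l" "v $ 13 = m" "v $ 14 = n" "v $ 15 = p"
  by (simp_all add: v_def vector_def)

definition linear_iso :: "(complex^'m::finite \<Rightarrow> complex^'n::finite) \<Rightarrow> bool" where
  "linear_iso \<Phi> \<longleftrightarrow> Vector_Spaces.linear (*s) (*s) \<Phi> \<and> bij \<Phi>"

lemma linear_isoI:
  assumes add: "\<And>x y. \<Phi> (x + y) = \<Phi> x + \<Phi> y" and scale: "\<And>c x. \<Phi> (c *s x) = c *s \<Phi> x"
    and inj: "\<And>x. \<Phi> x = 0 \<Longrightarrow> x = 0" and surj: "\<And>y. \<exists>x. \<Phi> x = y"
  shows "linear_iso \<Phi>"
proof -
  have "x = y" if "\<Phi> x = \<Phi> y" for x y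
  proof -
    have "\<Phi> (x + (-1) *s y) = 0" unfolding add scale that by simp
    then have "x + (-1) *s y = 0" by (rule inj)
    then show ?thesis by simp
  qed
  moreover have "Vector_Spaces.linear (*s) (*s) \<Phi>" by unfold_locales (simp_all add: add scale)
  ultimately show ?thesis using surj unfolding linear_iso_def bij_def inj_def surj_def by metis
qed

text \<open>The determinant of the symmetric matrix with diagonal x1, x2, x3 and entries x4, x5, x6
  in positions (1,2), (1,3), (2,3), in the order of the coordinates of
  \<open>veronese_surface\<close>.\<close>

definition sym_cubic :: "complex^6 \<Rightarrow> complex" where
  "sym_cubic x = x $ 1 * x $ 2 * x $ 3 - x $ 1 * (x $ 6)\<^sup>2 - x $ 2 * (x $ 5)\<^sup>2 - x $ 3 * (x $ 4)\<^sup>2 + 2 * x $ 4 * x $ 5 * x $ 6"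

definition det_cubic :: "complex^(3 \<times> 3) \<Rightarrow> complex" where
  "det_cubic x = det (\<chi> i j. x $ (i, j))"

text \<open>Up to sign, the Pfaffian of the alternating \<open>6 \<times> 6\<close> matrix with the entries of \<open>x\<close> above the
  diagonal, in the order of \<open>plucker\<close>.\<close>

definition pf_cubic :: "complex^15 \<Rightarrow> complex" where
  "pf_cubic x = (let b1 = x $ 15; b2 = - x $ 14; b3 = x $ 13; c1 = x $ 6; c2 = - x $ 2; c3 = x $ 1 in
    det (vector [vector [x $ 3, x $ 4, x $ 5], vector [x $ 7, x $ 8, x $ 9], vector [x $ 10, x $ 11, x $ 12]] :: complex^3^3)
    - (x $ 3 * b1 * c1 + x $ 4 * b2 * c1 + x $ 5 * b3 * c1 + x $ 7 * b1 * c2 + x $ 8 * b2 * c2 + x $ 9 * b3 * c2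
      + x $ 10 * b1 * c3 + x $ 11 * b2 * c3 + x $ 12 * b3 * c3))"

lemma (in split_composition_algebra) decomposed_eq_0:
  assumes "u \<in> U" "v \<in> V" "p *s e + q *s e' + u + v = 0"
  shows "p = 0" "q = 0" "u = 0" "v = 0"
proof -
  let ?a = "p *s e + q *s e' + u + v"
  have "B ?a e = q" "B ?a e' = p"
    using B_decomposed[OF assms(1) vec.subspace_0[OF subspace_U] assms(2) vec.subspace_0[OF subspace_V], of p q]
    by (metis (no_types) B_zero mult_1_right add_0_right mult_zero_right add_0_left vec.scale_one vec.scale_zero_left)+
  then show pq: "p = 0" "q = 0" using assms(3) by simp_all
  then have "u + v = 0" using assms(3) by simp
  moreover have "m e (u + v) = u" using assms by (simp add: m_linear U_table V_table)
  ultimately show "u = 0" "v = 0" by simp_all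
qed

lemma (in split_composition_algebra) decompose:
  assumes "a \<in> A"
  obtains p q u v where "u \<in> U" "v \<in> V" "a = p *s e + q *s e' + u + v"
  using decomposition[OF assms] decomposition_U[OF assms] decomposition_V[OF assms] by blast

lemma (in split_composition_algebra) composed_closed:
  "u \<in> U \<Longrightarrow> v \<in> V \<Longrightarrow> p *s e + q *s e' + u + v \<in> A"
  using e_closed e'_closed by (simp add: W_closed U_table V_table)

context coordinatized
begin

lemma sym_coordinates:
  assumes "A \<subseteq> vec.span {cone}"
  shows "\<exists>\<Phi>::complex^6 \<Rightarrow> complex^'n. linear_iso \<Phi> \<and> (\<forall>x. T (\<Phi> x) (\<Phi> x) (\<Phi> x) = 6 * sym_cubic x)"
proof -
  define \<Phi> :: "complex^6 \<Rightarrow> complex^'n" where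
    "\<Phi> x = theta (x $ 1) (x $ 2) (x $ 3) (x $ 6 *s cone) (x $ 5 *s cone) (x $ 4 *s cone)" for x
  have one: "c *s cone \<in> A" for c using C.one_closed by (rule C.W_scale)
  have 0: "c = 0" if "c *s cone = 0" for c using that C.B_one by (auto simp: vec.scale_eq_0_iff)
  have "linear_iso \<Phi>"
  proof (rule linear_isoI)
    show "\<Phi> (x + y) = \<Phi> x + \<Phi> y" for x y
      by (simp add: \<Phi>_def theta_linear(1)[symmetric] vec.scale_left_distrib)
    show "\<Phi> (c *s x) = c *s \<Phi> x" for c x
      by (simp add: \<Phi>_def theta_linear(2)[symmetric])
    show "x = 0" if "\<Phi> x = 0" for x
      using theta_inj[OF that[unfolded \<Phi>_def] one one one] 0 by (simp add: vec_eq_iff[of x] forall_6)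
    fix y
    obtain r s t a b c where *: "a \<in> A" "b \<in> A" "c \<in> A" "y = theta r s t a b c" using theta_surj by blast
    moreover have "\<exists>k. d = k *s cone" if "d \<in> A" for d
      using that assms by (auto simp: vec.span_singleton)
    ultimately obtain a' b' c' where "a = a' *s cone" "b = b' *s cone" "c = c' *s cone" by metis
    then have "\<Phi> (vector [r, s, t, c', b', a']) = y" by (simp add: \<Phi>_def *)
    then show "\<exists>x. \<Phi> x = y" by blast
  qed
  moreover have "T (\<Phi> x) (\<Phi> x) (\<Phi> x) = 6 * sym_cubic x" for x
  proof -
    have "C.cnj' cone = cone" unfolding C.cnj'_def C.B_one by (simp add: vec_eq_iff)
    then have 1: "C.cnj' (c *s cone) = c *s cone" for c by (simp only: C.cnj'_linear)
    have 2: "T e3 (c *s cone) (d *s cone) = - 2 * (c * d)" for c d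
    proof -
      have "T e3 cone cone = - 2" using C.B_one by (metis minus_minus)
      then show ?thesis by (simp add: T_linear)
    qed
    have 3: "cmult (c *s cone) (d *s cone) = (c * d) *s cone" for c d
      by (simp add: C.m_scale C.m_scale2 C.one_left[OF C.one_closed])
    show ?thesis unfolding \<Phi>_def theta_cubic[OF one one one] 1 2 3 sym_cubic_def by algebra
  qed
  ultimately show ?thesis by blast
qed

end

locale split_coordinatized = coordinatized +
  fixes e
  assumes split: "split_composition_algebra B A cmult cone e"
begin

sublocale S: split_composition_algebra B A cmult cone e by (rule split)

definition zorn where "zorn p q u v = p *s e + q *s S.e' + u + v"

lemma zorn_linear:
  "zorn (p + p') (q + q') (u + u') (v + v') = zorn p q u v + zorn p' q' u' v'"
  "zorn (c * p) (c * q) (c *s u) (c *s v) = c *s zorn p q u v"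
  by (simp_all add: zorn_def vec_eq_iff algebra_simps)

lemma zorn_cubic:
  assumes "u1 \<in> S.U" "u2 \<in> S.U" "u3 \<in> S.U" "v1 \<in> S.V" "v2 \<in> S.V" "v3 \<in> S.V"
    and x_def: "x = theta r s t (zorn p1 q1 u1 v1) (zorn p2 q2 u2 v2) (zorn p3 q3 u3 v3)"
  shows "T x x x = 6 * (r * s * t - r * (p1 * q1 + B u1 v1) - s * (p2 * q2 + B u2 v2) - t * (p3 * q3 + B u3 v3)
    + (p1 * p2 * p3 + q1 * q2 * q3 - p3 * B u1 v2 - q3 * B u2 v1 - p1 * B u2 v3 - q2 * B u1 v3
    - p2 * B u3 v1 - q1 * B u3 v2 - B (cmult v1 v2) v3 - B (cmult u1 u2) u3))"
proof -
  have mem: "zorn p1 q1 u1 v1 \<in> A" "zorn p2 q2 u2 v2 \<in> A" "zorn p3 q3 u3 v3 \<in> A"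
    unfolding zorn_def using assms(1-6) S.composed_closed by blast+
  show ?thesis
    unfolding x_def theta_cubic[OF mem]
    unfolding zorn_def S.norm_decomposed[OF assms(1,4)] S.norm_decomposed[OF assms(2,5)] S.norm_decomposed[OF assms(3,6)]
      S.triple_decomposed[OF assms(1-6)]
    by (simp add: algebra_simps)
qed

lemma zorn_inj:
  assumes "theta r s t (zorn p1 q1 u1 v1) (zorn p2 q2 u2 v2) (zorn p3 q3 u3 v3) = 0"
    and U: "u1 \<in> S.U" "u2 \<in> S.U" "u3 \<in> S.U" "v1 \<in> S.V" "v2 \<in> S.V" "v3 \<in> S.V"
  shows "r = 0 \<and> s = 0 \<and> t = 0 \<and> p1 = 0 \<and> p2 = 0 \<and> p3 = 0 \<and> q1 = 0 \<and> q2 = 0 \<and> q3 = 0 \<and>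
    u1 = 0 \<and> u2 = 0 \<and> u3 = 0 \<and> v1 = 0 \<and> v2 = 0 \<and> v3 = 0"
proof -
  have mem: "zorn p1 q1 u1 v1 \<in> A" "zorn p2 q2 u2 v2 \<in> A" "zorn p3 q3 u3 v3 \<in> A"
    unfolding zorn_def using assms(2-7) S.composed_closed by blast+
  note 0 = theta_inj[OF assms(1) mem]
  show ?thesis
    using 0(1-3) S.decomposed_eq_0[OF U(1,4) 0(4)[unfolded zorn_def]] S.decomposed_eq_0[OF U(2,5) 0(5)[unfolded zorn_def]]
      S.decomposed_eq_0[OF U(3,6) 0(6)[unfolded zorn_def]]
    by simp
qed

lemma zorn_surj:
  obtains r s t p1 q1 u1 v1 p2 q2 u2 v2 p3 q3 u3 v3 where
    "u1 \<in> S.U" "u2 \<in> S.U" "u3 \<in> S.U" "v1 \<in> S.V" "v2 \<in> S.V" "v3 \<in> S.V"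
    "x = theta r s t (zorn p1 q1 u1 v1) (zorn p2 q2 u2 v2) (zorn p3 q3 u3 v3)"
proof -
  obtain r s t a b c where *: "a \<in> A" "b \<in> A" "c \<in> A" "x = theta r s t a b c" using theta_surj by blast
  show ?thesis
    using * that unfolding zorn_def by (metis S.decompose)
qed

lemma det_coordinates:
  assumes "S.U = {0}" "S.V = {0}"
  shows "\<exists>\<Phi>::complex^(3 \<times> 3) \<Rightarrow> complex^'a. linear_iso \<Phi> \<and> (\<forall>x. T (\<Phi> x) (\<Phi> x) (\<Phi> x) = 6 * det_cubic x)"
proof -
  \<comment> \<open>Without U and V the cubic is r s t - r p1 q1 - s p2 q2 - t p3 q3 + p1 p2 p3 + q1
    q2 q3, the determinant of the matrix with rows (r, q3, p2), (p3, s, q1), (q2, p1, t).\<close>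
  define \<Phi> :: "complex^(3 \<times> 3) \<Rightarrow> complex^'a" where
    "\<Phi> x = theta (x $ (1,1)) (x $ (2,2)) (x $ (3,3)) (zorn (x $ (3,2)) (x $ (2,3)) 0 0)
      (zorn (x $ (1,3)) (x $ (3,1)) 0 0) (zorn (x $ (2,1)) (x $ (1,2)) 0 0)" for x
  have 0: "0 \<in> S.U" "0 \<in> S.V" using assms by simp_all
  have "linear_iso \<Phi>"
  proof (rule linear_isoI)
    show "\<Phi> (x + y) = \<Phi> x + \<Phi> y" for x y
      by (simp add: \<Phi>_def theta_linear(1)[symmetric] zorn_linear(1)[symmetric])
    show "\<Phi> (c *s x) = c *s \<Phi> x" for c x
      by (simp add: \<Phi>_def theta_linear(2)[symmetric] zorn_linear(2)[symmetric])
    show "x = 0" if "\<Phi> x = 0" for x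
      using zorn_inj[OF that[unfolded \<Phi>_def] 0(1,1,1,2,2,2)] by (simp add: vec_eq_iff[of x] forall_3)
    show "\<exists>x. \<Phi> x = y" for y
    proof (rule zorn_surj[of y])
      fix r s t p1 q1 u1 v1 p2 q2 u2 v2 p3 q3 u3 v3
      assume "u1 \<in> S.U" "u2 \<in> S.U" "u3 \<in> S.U" "v1 \<in> S.V" "v2 \<in> S.V" "v3 \<in> S.V"
        and y: "y = theta r s t (zorn p1 q1 u1 v1) (zorn p2 q2 u2 v2) (zorn p3 q3 u3 v3)"
      then have "\<Phi> (\<chi> ij. (vector [vector [r, q3, p2], vector [p3, s, q1], vector [q2, p1, t]] :: complex^3^3) $ fst ij $ snd ij) = y"
        using assms by (simp add: \<Phi>_def)
      then show ?thesis by blast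
    qed
  qed
  moreover have "T (\<Phi> x) (\<Phi> x) (\<Phi> x) = 6 * det_cubic x" for x
    unfolding \<Phi>_def zorn_cubic[OF 0(1,1,1,2,2,2) refl]
    by (simp add: det_cubic_def det_3 algebra_simps)
  ultimately show ?thesis by blast
qed

lemma pf_coordinates:
  assumes u: "u \<in> S.U" and v: "v \<in> S.V" and uv: "B u v = -1"
    and U: "\<And>w. w \<in> S.U \<Longrightarrow> w = - B w v *s u" and V: "\<And>w. w \<in> S.V \<Longrightarrow> w = - B u w *s v"
  shows "\<exists>\<Phi>::complex^15 \<Rightarrow> complex^'a. linear_iso \<Phi> \<and> (\<forall>x. T (\<Phi> x) (\<Phi> x) (\<Phi> x) = 6 * pf_cubic x)"
proof -
  \<comment> \<open>In the alternating 6 x 6 matrix, the block with rows 1 to 3 and columns 4 to 6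
    is the matrix of the determinantal case. The coefficients of u and v come, up to sign, from the
    two alternating diagonal blocks.\<close>
  define \<Phi> :: "complex^15 \<Rightarrow> complex^'a" where
    "\<Phi> x = theta (x $ 3) (x $ 8) (x $ 12) (zorn (x $ 11) (x $ 9) (x $ 15 *s u) ((- x $ 6) *s v))
      (zorn (x $ 5) (x $ 10) ((- x $ 14) *s u) (x $ 2 *s v)) (zorn (x $ 7) (x $ 4) (x $ 13 *s u) ((- x $ 1) *s v))" for x
  have mem: "c *s u \<in> S.U" "c *s v \<in> S.V" for c
    using u v S.subspace_U S.subspace_V vec.subspace_scale by blast+
  have 0: "c *s u = 0 \<longleftrightarrow> c = 0" "c *s v = 0 \<longleftrightarrow> c = 0" for c using uv by (auto simp: vec.scale_eq_0_iff)
  have "linear_iso \<Phi>"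
  proof (rule linear_isoI)
    have "\<Phi> (x + y) = theta (x $ 3 + y $ 3) (x $ 8 + y $ 8) (x $ 12 + y $ 12)
      (zorn (x $ 11 + y $ 11) (x $ 9 + y $ 9) (x $ 15 *s u + y $ 15 *s u) ((- x $ 6) *s v + (- y $ 6) *s v))
      (zorn (x $ 5 + y $ 5) (x $ 10 + y $ 10) ((- x $ 14) *s u + (- y $ 14) *s u) (x $ 2 *s v + y $ 2 *s v))
      (zorn (x $ 7 + y $ 7) (x $ 4 + y $ 4) (x $ 13 *s u + y $ 13 *s u) ((- x $ 1) *s v + (- y $ 1) *s v))" for x y
      unfolding \<Phi>_def vec.scale_left_distrib[symmetric] by simp
    then show "\<Phi> (x + y) = \<Phi> x + \<Phi> y" for x y
      unfolding theta_linear zorn_linear by (simp only: \<Phi>_def)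
    have "\<Phi> (c *s x) = theta (c * x $ 3) (c * x $ 8) (c * x $ 12)
      (zorn (c * x $ 11) (c * x $ 9) (c *s (x $ 15 *s u)) (c *s ((- x $ 6) *s v)))
      (zorn (c * x $ 5) (c * x $ 10) (c *s ((- x $ 14) *s u)) (c *s (x $ 2 *s v)))
      (zorn (c * x $ 7) (c * x $ 4) (c *s (x $ 13 *s u)) (c *s ((- x $ 1) *s v)))" for c x
      unfolding \<Phi>_def by simp
    then show "\<Phi> (c *s x) = c *s \<Phi> x" for c x
      unfolding theta_linear zorn_linear by (simp only: \<Phi>_def)
    show "x = 0" if "\<Phi> x = 0" for x
      using zorn_inj[OF that[unfolded \<Phi>_def] mem(1,1,1,2,2,2)] unfolding 0 by (simp add: vec_eq_iff[of x] forall_15)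
    show "\<exists>x. \<Phi> x = y" for y
    proof (rule zorn_surj[of y])
      fix r s t p1 q1 u1 v1 p2 q2 u2 v2 p3 q3 u3 v3
      assume *: "u1 \<in> S.U" "u2 \<in> S.U" "u3 \<in> S.U" "v1 \<in> S.V" "v2 \<in> S.V" "v3 \<in> S.V"
        and y: "y = theta r s t (zorn p1 q1 u1 v1) (zorn p2 q2 u2 v2) (zorn p3 q3 u3 v3)"
      have "\<exists>c. w = c *s u" if "w \<in> S.U" for w using U[OF that] by metis
      moreover have "\<exists>c. w = c *s v" if "w \<in> S.V" for w using V[OF that] by metis
      ultimately obtain a1 a2 a3 b1 b2 b3 where
        ab: "u1 = a1 *s u" "u2 = a2 *s u" "u3 = a3 *s u" "v1 = b1 *s v" "v2 = b2 *s v" "v3 = b3 *s v" using * by metis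
      have "\<Phi> (vector [- b3, b2, r, q3, p2, - b1, p3, s, q1, q2, p1, t, a3, - a2, a1]) = y"
        unfolding y ab \<Phi>_def by (simp only: vector_15 minus_minus)
      then show ?thesis by blast
    qed
  qed
  moreover have "T (\<Phi> x) (\<Phi> x) (\<Phi> x) = 6 * pf_cubic x" for x
  proof -
    have "cmult u u = 0" "cmult v v = 0"
      using S.U_U_product(2)[OF u u] S.V_V_product(2)[OF v v] by (simp_all add: vec_eq_iff)
    then have 1: "T e3 (cmult (a *s u) (b *s u)) w = 0" "T e3 (cmult (a *s v) (b *s v)) w = 0" for a b w
      by (simp_all add: C.m_scale C.m_scale2)
    have 2: "T e3 (a *s u) (b *s v) = a * b" for a b using uv by (simp add: T_linear)
    show ?thesis
      unfolding \<Phi>_def zorn_cubic[OF mem(1,1,1,2,2,2) refl] 1 2 pf_cubic_def Let_def det_3 vector_3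
      by algebra
  qed
  ultimately show ?thesis by blast
qed

end

context split_coordinatized
begin

text \<open>The position of e1 is recorded because two such coordinate systems with different first
  frame vectors yield an automorphism of the Cartan cubic moving one singular point to
  another.\<close>

lemma cartan_coordinates:
  assumes "S.triad u1 u2 u3 v1 v2 v3"
  shows "\<exists>\<Phi>::complex^(3 \<times> 3 \<times> 3) \<Rightarrow> complex^'a. linear_iso \<Phi> \<and>
    (\<forall>x. T (\<Phi> x) (\<Phi> x) (\<Phi> x) = 6 * cartan_cubic x) \<and> \<Phi> (axis (1, 1, 1) 1) = e1"
proof -
  note t = assms[unfolded S.triad_def]
  define uu where "uu a b c = a *s u1 + b *s u2 + c *s u3" for a b c
  define vv where "vv a b c = a *s v1 + b *s v2 + c *s v3" for a b c
  have uu_add: "uu (a + a') (b + b') (c + c') = uu a b c + uu a' b' c'"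
    and uu_scale: "uu (k * a) (k * b) (k * c) = k *s uu a b c"
    and vv_add: "vv (a + a') (b + b') (c + c') = vv a b c + vv a' b' c'"
    and vv_scale: "vv (k * a) (k * b) (k * c) = k *s vv a b c" for a b c a' b' c' k
    by (simp_all add: uu_def vv_def vec_eq_iff algebra_simps)
  have uu: "uu a b c \<in> S.U" and vv: "vv a b c \<in> S.V" for a b c
    using t S.subspace_U S.subspace_V by (auto simp: uu_def vv_def intro!: vec.subspace_add vec.subspace_scale)
  have T1: "T e3 u1 v1 = 1" "T e3 u2 v2 = 1" "T e3 u3 v3 = 1"
    using t by (metis minus_minus)+
  have T0: "T e3 u1 v2 = 0" "T e3 u1 v3 = 0" "T e3 u2 v1 = 0" "T e3 u2 v3 = 0" "T e3 u3 v1 = 0" "T e3 u3 v2 = 0"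
    using t by simp_all
  have T_uv: "T e3 (uu a b c) (vv a' b' c') = a * a' + b * b' + c * c'" for a b c a' b' c'
    by (simp add: uu_def vv_def T_linear T0 T1)
  have mu: "cmult u1 u2 = v3" "cmult u2 u3 = v1" "cmult u3 u1 = v2" "cmult u2 u1 = - v3" "cmult u3 u2 = - v1" "cmult u1 u3 = - v2"
    "cmult u1 u1 = 0" "cmult u2 u2 = 0" "cmult u3 u3 = 0"
    using t S.U_U_product(2)[of u2 u1] S.U_U_product(2)[of u3 u2] S.U_U_product(2)[of u1 u3]
      S.U_U_product(2)[of u1 u1] S.U_U_product(2)[of u2 u2] S.U_U_product(2)[of u3 u3]
    by (auto simp: vec_eq_iff)
  have mv: "cmult v1 v2 = - u3" "cmult v2 v3 = - u1" "cmult v3 v1 = - u2" "cmult v2 v1 = u3" "cmult v3 v2 = u1" "cmult v1 v3 = u2"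
    "cmult v1 v1 = 0" "cmult v2 v2 = 0" "cmult v3 v3 = 0"
    using t S.V_V_product(2)[of v2 v1] S.V_V_product(2)[of v3 v2] S.V_V_product(2)[of v1 v3] S.triad_V_products[OF assms]
      S.V_V_product(2)[of v1 v1] S.V_V_product(2)[of v2 v2] S.V_V_product(2)[of v3 v3]
    by (auto simp: vec_eq_iff)
  have m_uu: "cmult (uu a b c) (uu a' b' c') = vv (b * c' - c * b') (c * a' - a * c') (a * b' - b * a')" for a b c a' b' c'
    by (simp add: uu_def vv_def C.m_linear mu vec_eq_iff algebra_simps)
  have m_vv: "cmult (vv a b c) (vv a' b' c') = uu (c * b' - b * c') (a * c' - c * a') (b * a' - a * b')" for a b c a' b' c'
    by (simp add: uu_def vv_def C.m_linear mv vec_eq_iff algebra_simps)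
  have T_vu: "T e3 (vv a' b' c') (uu a b c) = a * a' + b * b' + c * c'" for a b c a' b' c'
    unfolding T_sym(2)[of e3 "vv a' b' c'"] by (rule T_uv)
  have uu_inj: "uu a b c = 0 \<Longrightarrow> a = 0 \<and> b = 0 \<and> c = 0" for a b c
    using T_uv[of a b c 1 0 0] T_uv[of a b c 0 1 0] T_uv[of a b c 0 0 1] by simp
  have vv_inj: "vv a b c = 0 \<Longrightarrow> a = 0 \<and> b = 0 \<and> c = 0" for a b c
    using T_vu[of a b c 1 0 0] T_vu[of a b c 0 1 0] T_vu[of a b c 0 0 1] by simp
  have uu_surj: "\<exists>a b c. w = uu a b c" if "w \<in> S.U" for w
    using S.triad_spans_U[OF assms that] unfolding uu_def
    by (metis (no_types, lifting) add_uminus_conv_diff vec.scale_minus_left)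
  have vv_surj: "\<exists>a b c. w = vv a b c" if "w \<in> S.V" for w
    using S.triad_spans_V[OF assms that] unfolding vv_def
    by (metis (no_types, lifting) add_uminus_conv_diff vec.scale_minus_left)
  \<comment> \<open>Rows of the second matrix become elements of U, negated columns of the third
    become elements of V. Then \<open>B (R x i) (Q x j)\<close> is the (i, j) entry of their matrix
    product, and the two alternating triple products become determinants, both with sign +.\<close>
  define R where "R x j = uu (x $ (2, j, 1)) (x $ (2, j, 2)) (x $ (2, j, 3))" for x :: "complex^(3 \<times> 3 \<times> 3)" and j
  define Q where "Q x j = vv (- x $ (3, 1, j)) (- x $ (3, 2, j)) (- x $ (3, 3, j))" for x :: "complex^(3 \<times> 3 \<times> 3)" and j
  define \<Phi> :: "complex^(3 \<times> 3 \<times> 3) \<Rightarrow> complex^'a" where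
    "\<Phi> x = theta (x $ (1,1,1)) (x $ (1,2,2)) (x $ (1,3,3)) (zorn (x $ (1,3,2)) (x $ (1,2,3)) (R x 1) (Q x 1))
      (zorn (x $ (1,1,3)) (x $ (1,3,1)) (R x 2) (Q x 2)) (zorn (x $ (1,2,1)) (x $ (1,1,2)) (R x 3) (Q x 3))" for x
  have mem: "R x j \<in> S.U" "Q x j \<in> S.V" for x j by (simp_all add: R_def Q_def uu vv)
  have RQ_add: "R (x + y) j = R x j + R y j" "Q (x + y) j = Q x j + Q y j" for x y j
    by (simp_all only: R_def Q_def vector_add_component minus_add_distrib uu_add vv_add)
  have RQ_scale: "R (k *s x) j = k *s R x j" "Q (k *s x) j = k *s Q x j" for k x j
    unfolding R_def Q_def uu_scale[symmetric] vv_scale[symmetric] by simp_all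
  have "linear_iso \<Phi>"
  proof (rule linear_isoI)
    show "\<Phi> (x + y) = \<Phi> x + \<Phi> y" for x y
      by (simp only: \<Phi>_def RQ_add vector_add_component theta_linear zorn_linear)
    show "\<Phi> (c *s x) = c *s \<Phi> x" for c x
      by (simp only: \<Phi>_def RQ_scale vector_smult_component theta_linear zorn_linear)
    show "x = 0" if "\<Phi> x = 0" for x
    proof -
      note * = zorn_inj[OF that[unfolded \<Phi>_def] mem(1,1,1,2,2,2)]
      have "x $ (2, j, k) = 0 \<and> x $ (3, k, j) = 0" for j k
      proof -
        have "R x j = 0" "Q x j = 0" using * exhaust_3[of j] by auto
        then show ?thesis using uu_inj[OF \<open>R x j = 0\<close>[unfolded R_def]] vv_inj[OF \<open>Q x j = 0\<close>[unfolded Q_def]] exhaust_3[of k] by auto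
      qed
      then show ?thesis using * by (simp add: vec_eq_iff[of x] forall_3)
    qed
    show "\<exists>x. \<Phi> x = y" for y
    proof (rule zorn_surj[of y])
      fix r s t p1 q1 w1 z1 p2 q2 w2 z2 p3 q3 w3 z3
      assume *: "w1 \<in> S.U" "w2 \<in> S.U" "w3 \<in> S.U" "z1 \<in> S.V" "z2 \<in> S.V" "z3 \<in> S.V"
        and y: "y = theta r s t (zorn p1 q1 w1 z1) (zorn p2 q2 w2 z2) (zorn p3 q3 w3 z3)"
      obtain b11 b12 b13 b21 b22 b23 b31 b32 b33 where
        b: "w1 = uu b11 b12 b13" "w2 = uu b21 b22 b23" "w3 = uu b31 b32 b33" using uu_surj * by metis
      obtain c11 c12 c13 c21 c22 c23 c31 c32 c33 where
        c: "z1 = vv c11 c21 c31" "z2 = vv c12 c22 c32" "z3 = vv c13 c23 c33" using vv_surj * by metis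
      define x :: "complex^(3 \<times> 3 \<times> 3)" where "x = (\<chi> kij. (vector [
          vector [vector [r, q3, p2], vector [p3, s, q1], vector [q2, p1, t]],
          vector [vector [b11, b12, b13], vector [b21, b22, b23], vector [b31, b32, b33]],
          vector [vector [-c11, -c12, -c13], vector [-c21, -c22, -c23], vector [-c31, -c32, -c33]]] :: complex^3^3^3)
          $ fst kij $ fst (snd kij) $ snd (snd kij))"
      have "\<Phi> x = y" by (simp add: \<Phi>_def y b c R_def Q_def x_def)
      then show ?thesis by blast
    qed
  qed
  moreover have "T (\<Phi> x) (\<Phi> x) (\<Phi> x) = 6 * cartan_cubic x" for x
  proof -
    have tr: "trace (slice 1 x ** slice 2 x ** slice 3 x) = (\<Sum>i\<in>UNIV. \<Sum>k\<in>UNIV. (\<Sum>j\<in>UNIV. x $ (1, i, j) * x $ (2, j, k)) * x $ (3, k, i))"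
      by (simp add: trace_def matrix_matrix_mult_def slice_def)
    show ?thesis
      unfolding \<Phi>_def zorn_cubic[OF mem(1,1,1,2,2,2) refl]
      unfolding R_def Q_def m_uu m_vv T_uv T_vu cartan_cubic_def tr det_3 sum_3
      unfolding slice_def vec_lambda_beta
      by algebra
  qed
  moreover have "\<Phi> (axis (1, 1, 1) 1) = e1"
  proof -
    have "uu 0 0 0 = 0" "vv 0 0 0 = 0" by (simp_all add: uu_def vv_def)
    moreover have "C.cnj' 0 = 0" "phi1 0 = 0" "phi2 0 = 0"
      using C.cnj'_linear(2)[of 0 0] phi_linear(2)[of 0 0] phi_linear(4)[of 0 0] by simp_all
    ultimately show ?thesis by (simp add: \<Phi>_def R_def Q_def zorn_def theta_def axis_def)
  qed
  ultimately show ?thesis by blast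
qed

end

context cubic_pair
begin

lemma coordinates:
  assumes fr: "frame e1 e2 e3" and "\<exists>v\<in>peirce e2 e3. v \<noteq> 0" "\<exists>v\<in>peirce e3 e1. v \<noteq> 0"
  shows "(\<exists>\<Phi>::complex^6 \<Rightarrow> complex^'n. linear_iso \<Phi> \<and> (\<forall>x. T (\<Phi> x) (\<Phi> x) (\<Phi> x) = 6 * sym_cubic x)) \<or>
    (\<exists>\<Phi>::complex^(3 \<times> 3) \<Rightarrow> complex^'n. linear_iso \<Phi> \<and> (\<forall>x. T (\<Phi> x) (\<Phi> x) (\<Phi> x) = 6 * det_cubic x)) \<or>
    (\<exists>\<Phi>::complex^15 \<Rightarrow> complex^'n. linear_iso \<Phi> \<and> (\<forall>x. T (\<Phi> x) (\<Phi> x) (\<Phi> x) = 6 * pf_cubic x)) \<or>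
    (\<exists>\<Phi>::complex^(3 \<times> 3 \<times> 3) \<Rightarrow> complex^'n. linear_iso \<Phi> \<and>
      (\<forall>x. T (\<Phi> x) (\<Phi> x) (\<Phi> x) = 6 * cartan_cubic x) \<and> \<Phi> (axis (1, 1, 1) 1) = e1)"
proof -
  interpret P1: bilinear_space "\<lambda>x y. - T e1 x y" "peirce e2 e3" using fr by (rule peirce_space)
  interpret P2: bilinear_space "\<lambda>x y. - T e2 x y" "peirce e3 e1" by (rule peirce_space[OF frame_rotate[OF fr]])
  obtain y1 where y1: "y1 \<in> peirce e2 e3" "- T e1 y1 y1 = 2" using P1.exists_value assms(2) by blast
  obtain y2 where y2: "y2 \<in> peirce e3 e1" "- T e2 y2 y2 = 2" using P2.exists_value assms(3) by blast
  interpret coordinatized cr dr e1 e2 e3 y1 y2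
  proof
    show "T e1 y1 y1 = -2" "T e2 y2 y2 = -2" using y1 y2 by (metis minus_minus)+
  qed (use fr y1 y2 in auto)
  show ?thesis
  proof (cases "A \<subseteq> vec.span {cone}")
    case True
    then show ?thesis using sym_coordinates by blast
  next
    case False
    then obtain e where e: "e \<in> A" "B e e = 0" "B e cone = 1" using C.exists_split by blast
    interpret split_coordinatized cr dr e1 e2 e3 y1 y2 e
      by unfold_locales (use e in auto)
    show ?thesis
      by (cases rule: S.Hurwitz) (use det_coordinates pf_coordinates cartan_coordinates in blast)+
  qed
qed

end

section \<open>Irreducible cubic pairs\<close>

definition polymap :: "(complex^'m::finite \<Rightarrow> complex^'n::finite) \<Rightarrow> bool" where
  "polymap h \<longleftrightarrow> (\<forall>i. polyfun (\<lambda>x. h x $ i))"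

lemma polymap_id: "polymap (\<lambda>x. x)"
  by (auto simp: polymap_def)

lemma polymap_const: "polymap (\<lambda>x. c)"
  by (auto simp: polymap_def)

lemma polymap_diff: "polymap g \<Longrightarrow> polymap h \<Longrightarrow> polymap (\<lambda>x. g x - h x)"
  by (auto simp: polymap_def)

lemma polymap_scale: "polyfun g \<Longrightarrow> polymap h \<Longrightarrow> polymap (\<lambda>x. g x *s h x)"
  by (auto simp: polymap_def)

lemma polyfun_pairing: "polymap g \<Longrightarrow> polymap h \<Longrightarrow> polyfun (\<lambda>x. pairing (g x) (h x))"
  by (auto simp: polymap_def pairing_def intro!: polyfun_sum polyfun_mult)

lemma additive_sum_axis:
  fixes L :: "complex^'m::finite \<Rightarrow> complex^'n::finite"
  assumes "\<And>x y. L (x + y) = L x + L y" "\<And>c x. L (c *s x) = c *s L x"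
  shows "L x = (\<Sum>j\<in>UNIV. x $ j *s L (axis j 1))"
proof -
  have "Vector_Spaces.linear (*s) (*s) L" by unfold_locales (simp_all add: assms)
  then have "L x = matrix L *v x" by (simp add: matrix_works)
  then show ?thesis by (simp add: matrix_vector_mult_def matrix_def vec_eq_iff mult.commute)
qed

lemma polymap_linear:
  assumes "\<And>x y. L (x + y) = L x + L y" "\<And>c x. L (c *s x) = c *s L x" "polymap h"
  shows "polymap (\<lambda>x. L (h x))"
proof -
  have "polymap (\<lambda>x. \<Sum>j\<in>UNIV. h x $ j *s L (axis j 1))" using assms(3) by (auto simp: polymap_def intro!: polyfun_sum polyfun_mult)
  moreover have "(\<lambda>x. L (h x)) = (\<lambda>x. \<Sum>j\<in>UNIV. h x $ j *s L (axis j 1))"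
    by (intro ext additive_sum_axis assms(1,2))
  ultimately show ?thesis by simp
qed

context cubic_map
begin

lemma polymap_cr:
  assumes "polymap g" "polymap h"
  shows "polymap (\<lambda>x. cr (g x) (h x))"
proof -
  have h: "polymap (\<lambda>x. cr a (h x))" for a by (rule polymap_linear) (simp_all add: cr_linear assms)
  have "cr a b = (\<Sum>j\<in>UNIV. a $ j *s cr (axis j 1) b)" for a b
    by (rule additive_sum_axis) (simp_all add: cr_linear)
  then have "(\<lambda>x. cr (g x) (h x)) = (\<lambda>x. \<Sum>j\<in>UNIV. g x $ j *s cr (axis j 1) (h x))" by (intro ext)
  moreover have "polymap (\<lambda>x. \<Sum>j\<in>UNIV. g x $ j *s cr (axis j 1) (h x))"
    using h assms(1) by (auto simp: polymap_def intro!: polyfun_sum polyfun_mult)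
  ultimately show ?thesis by simp
qed

lemma polyfun_T: "polymap f \<Longrightarrow> polymap g \<Longrightarrow> polymap h \<Longrightarrow> polyfun (\<lambda>x. T (f x) (g x) (h x))"
  unfolding T_def by (intro polyfun_pairing polymap_cr)

end

text \<open>Vanishing at the origin stands for being a nonunit. It holds for the factors met below,
  a linear and a quadratic form.\<close>

locale irreducible_cubic_pair = cubic_pair +
  assumes irreducible: "polyfun g \<Longrightarrow> polyfun h \<Longrightarrow> g 0 = 0 \<Longrightarrow> h 0 = 0 \<Longrightarrow> \<exists>x. T x x x \<noteq> g x * h x"
begin

lemma nonzero: "\<exists>x. T x x x \<noteq> 0"
  using irreducible[of "\<lambda>x. 0" "\<lambda>x. 0"] by auto

text \<open>On a line the Peirce projection would be a linear form tau times v. As the cubic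
  vanishes where tau does, by \<open>cubic_annihilator\<close>, expanding it at
  \<open>y x + \<tau> x *s v\<close> shows that tau divides it.\<close>

lemma peirce0_not_line:
  assumes ef: "idempotent e f"
  shows "\<not> peirce0 e f \<subseteq> vec.span {v}"
proof
  assume v: "peirce0 e f \<subseteq> vec.span {v}"
  define P where "P x = dr f (cr e x)" for x
  have P: "P x \<in> peirce0 e f" for x unfolding P_def using ef by (rule dr_in_peirce0)
  have crP: "cr e (P x) = cr e x" for x
    using rank1_project[of e x f] ef by (simp add: P_def idempotent_def dr_commute)
  have "v \<noteq> 0"
  proof
    assume "v = 0"
    then have "P x = 0" for x using P v by auto
    then have "cr e x = 0" for x using crP[of x] by simp
    then have "e = 0" using cr_nondegenerate nonzero by blast
    then show False using ef by (simp add: idempotent_def)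
  qed
  then obtain z where z: "pairing v z = 1" using pairing_nondegenerate by blast
  define \<tau> where "\<tau> x = pairing (P x) z" for x
  have Pv: "P x = \<tau> x *s v" for x
  proof -
    obtain k where "P x = k *s v" using P[of x] v by (auto simp: vec.span_singleton)
    then show ?thesis by (simp add: \<tau>_def z)
  qed
  define y where "y x = x - P x" for x
  have polyP: "polymap P" unfolding P_def
    by (rule polymap_linear) (simp_all add: cr_linear dr_linear polymap_id)
  have poly: "polyfun \<tau>" "polymap y"
    unfolding \<tau>_def y_def by (intro polyfun_pairing polymap_const polymap_diff polymap_id polyP)+
  define \<kappa> where "\<kappa> x = 3 * T (y x) (y x) v + 3 * \<tau> x * T v v (y x) + \<tau> x * \<tau> x * T v v v" for x
  have "polyfun \<kappa>"
    unfolding \<kappa>_def using poly polymap_const by (intro polyfun_add polyfun_mult polyfun_const polyfun_T) auto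
  moreover have "T x x x = \<tau> x * \<kappa> x" for x
  proof -
    have "cr e (y x) = 0" by (simp add: y_def cr_linear crP)
    then have "T (y x) (y x) (y x) = 0" using cubic_annihilator[OF ef] by blast
    moreover have "x = y x + \<tau> x *s v + 0" by (simp add: y_def Pv[symmetric])
    ultimately show ?thesis
      using T_cube_add[of "y x" "\<tau> x *s v" 0]
      by (simp add: T_linear \<kappa>_def algebra_simps)
  qed
  moreover have "\<tau> 0 = 0" "\<kappa> 0 = 0" by (simp_all add: \<kappa>_def \<tau>_def y_def P_def dr_zero)
  ultimately show False using irreducible[of \<tau> \<kappa>] poly(1) by blast
qed

text \<open>With both spaces zero, every term left in \<open>cubic_expansion\<close> contains the
  third diagonal coordinate \<open>T e1 e2 x\<close>, a linear factor.\<close>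

lemma peirce_not_both_zero:
  assumes fr: "frame e1 e2 e3"
  shows "(\<exists>v\<in>peirce e2 e3. v \<noteq> 0) \<or> (\<exists>v\<in>peirce e3 e1. v \<noteq> 0)"
proof (rule ccontr)
  assume *: "\<not> ?thesis"
  note fr2 = frame_rotate[OF fr] and fr3 = frame_rotate[OF frame_rotate[OF fr]]
  define a3 where "a3 x = peirce_proj e3 e1 e2 x" for x
  define \<kappa> where "\<kappa> x = 6 * (T e2 e3 x * T e3 e1 x) + 3 * T e3 (a3 x) (a3 x)" for x
  have lin: "a3 (x + y) = a3 x + a3 y" "a3 (c *s x) = c *s a3 x" for x y c
    by (simp_all add: a3_def peirce_proj_def cr_linear dr_linear T_linear vec_eq_iff algebra_simps)
  have "polymap a3" using polymap_linear[OF lin polymap_id] .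
  then have "polyfun \<kappa>"
    unfolding \<kappa>_def by (intro polyfun_add polyfun_mult polyfun_const polyfun_T polymap_const polymap_id)
  moreover have "polyfun (T e1 e2)" by (intro polyfun_T polymap_const polymap_id)
  moreover have "T x x x = T e1 e2 x * \<kappa> x" for x
  proof -
    have z: "peirce_proj e1 e2 e3 x = 0" "peirce_proj e2 e3 e1 x = 0"
      using * peirce_proj_mem[OF fr] peirce_proj_mem[OF fr2] by blast+
    have "T x x x = 6 * (T e2 e3 x * T e3 e1 x * T e1 e2 x) + 3 * (T e2 e3 x * T e1 0 0 + T e3 e1 x * T e2 0 0
        + T e1 e2 x * T e3 (a3 x) (a3 x)) + 6 * T 0 0 (a3 x)"
    proof (rule cubic_expansion[OF fr])
      show "a3 x \<in> peirce e1 e2" unfolding a3_def by (rule peirce_proj_mem[OF fr3])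
      show "x = T e2 e3 x *s e1 + T e3 e1 x *s e2 + T e1 e2 x *s e3 + (0 + 0 + a3 x)"
        using peirce_decomposition[OF fr, of x] by (simp add: z a3_def)
    qed (simp_all add: peirce_def)
    then show ?thesis by (simp add: \<kappa>_def algebra_simps)
  qed
  moreover have "T e1 e2 0 = 0" "\<kappa> 0 = 0" using lin(2)[of 0 0] by (simp_all add: \<kappa>_def)
  ultimately show False using irreducible[of "T e1 e2" \<kappa>] by blast
qed

text \<open>By the composition law, the product of two vectors of nonzero norm has nonzero
  norm.\<close>

lemma peirce_third_nonzero:
  assumes fr: "frame e1 e2 e3" and "\<exists>v\<in>peirce e2 e3. v \<noteq> 0" "\<exists>v\<in>peirce e3 e1. v \<noteq> 0"
  shows "\<exists>v\<in>peirce e1 e2. v \<noteq> 0"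
proof -
  interpret P1: bilinear_space "\<lambda>x y. - T e1 x y" "peirce e2 e3" using fr by (rule peirce_space)
  interpret P2: bilinear_space "\<lambda>x y. - T e2 x y" "peirce e3 e1" by (rule peirce_space[OF frame_rotate[OF fr]])
  obtain v where v: "v \<in> peirce e2 e3" "- T e1 v v = 1" using P1.exists_value assms(2) by blast
  obtain w where w: "w \<in> peirce e3 e1" "- T e2 w w = 1" using P2.exists_value assms(3) by blast
  have "T e1 v v = - 1" "T e2 w w = -1" using v w by (metis minus_minus)+
  then have "pmult e1 e2 v w \<noteq> 0" using pmult_norm[OF fr v(1) w(1)] by auto
  then show ?thesis using pmult_mem[OF fr v(1) w(1)] by blast
qed

text \<open>At most one of the three spaces can be zero, and two nonzero ones force the third to be
  nonzero.\<close>

lemma peirce_nonzero: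
  assumes fr: "frame e1 e2 e3"
  shows "\<exists>v\<in>peirce e2 e3. v \<noteq> 0" "\<exists>v\<in>peirce e3 e1. v \<noteq> 0"
  using peirce_not_both_zero[OF fr] peirce_not_both_zero[OF frame_rotate[OF fr]]
    peirce_not_both_zero[OF frame_rotate[OF frame_rotate[OF fr]]]
    peirce_third_nonzero[OF fr] peirce_third_nonzero[OF frame_rotate[OF fr]]
    peirce_third_nonzero[OF frame_rotate[OF frame_rotate[OF fr]]]
  by blast+

lemma extend_frame:
  assumes "cr e e = 0" "e \<noteq> 0"
  shows "\<exists>e2 e3. frame e e2 e3"
  using exists_idempotent[OF assms] nonzero exists_frame peirce0_not_line by metis

section \<open>Zeros of the cubic form, rank one vectors and secant lines\<close>

lemma sharp_sharp: "3 *s dr (cr x x) (cr x x) = (4 * T x x x) *s x"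
  using adjoint[of x x x x] by (simp add: T_def vec_eq_iff)

lemma dual_nonzero: "\<exists>y. D.T y y y \<noteq> 0"
proof -
  obtain x where x: "T x x x \<noteq> 0" using nonzero by blast
  have "3 * D.T (cr x x) (cr x x) (cr x x) = pairing (3 *s dr (cr x x) (cr x x)) (cr x x)" by (simp add: D.T_def)
  also have "\<dots> = 4 * T x x x * T x x x" unfolding sharp_sharp by (simp add: T_def pairing_commute)
  finally show ?thesis using x by (intro exI[of _ "cr x x"]) auto
qed

text \<open>At a zero of the cubic, \<open>sharp_sharp\<close> makes \<open>cr x x\<close> a
  covector of rank one, so the existence of idempotents applies on the dual side.\<close>

lemma dual_idempotent:
  assumes "cr x x \<noteq> 0" "T x x x = 0"
  shows "\<exists>e. idempotent e (cr x x)"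
proof -
  have "dr (cr x x) (cr x x) = 0" using sharp_sharp[of x] assms(2) by simp
  then obtain e where "dual.idempotent (cr x x) e"
    using dual.exists_idempotent dual_nonzero assms(1) by blast
  then show ?thesis by (auto simp: idempotent_def dual.idempotent_def pairing_commute[of e])
qed

text \<open>In a plane the cubic has a nonzero zero x by the fundamental theorem of algebra. Either
  x has rank one, or the partner of \<open>cr x x\<close> in an idempotent does.\<close>

lemma exists_rank1:
  assumes "CARD('a) \<ge> 2"
  shows "\<exists>e. cr e e = 0 \<and> e \<noteq> 0"
proof -
  obtain i j :: 'a where ij: "i \<noteq> j"
    using assms by (metis card_1_singletonE card_le_Suc0_iff_eq finite UNIV_I not_less_eq_eq numeral_2_eq_2)
  define a b :: "complex^'a" where "a = axis i 1" and "b = axis j 1"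
  have "\<exists>x. x \<noteq> 0 \<and> T x x x = 0"
  proof (cases "T b b b = 0")
    case True
    then show ?thesis by (intro exI[of _ b]) (simp add: b_def axis_eq_0_iff)
  next
    case False
    define p where "p = [:T a a a, 3 * T a a b, 3 * T a b b, T b b b:]"
    have "\<not> constant (poly p)" using False by (simp add: p_def constant_degree)
    then obtain t where t: "poly p t = 0" using fundamental_theorem_of_algebra by blast
    have "T (a + t *s b + 0) (a + t *s b + 0) (a + t *s b + 0) = poly p t"
      unfolding T_cube_add by (simp add: T_linear T_sym3(1)[of b b a] p_def algebra_simps)
    moreover have "(a + t *s b) $ i = 1" using ij by (simp add: a_def b_def axis_def)
    then have "a + t *s b \<noteq> 0" by (metis zero_index zero_neq_one)
    ultimately show ?thesis using t by (intro exI[of _ "a + t *s b"]) simp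
  qed
  then obtain x where x: "x \<noteq> 0" "T x x x = 0" by blast
  show ?thesis
  proof (cases "cr x x = 0")
    case True
    then show ?thesis using x by blast
  next
    case False
    then obtain e where "idempotent e (cr x x)" using dual_idempotent x by blast
    then show ?thesis by (intro exI[of _ e]) (auto simp: idempotent_def)
  qed
qed

lemma secant:
  assumes x: "x \<noteq> 0" "T x x x = 0"
  shows "\<exists>a b. cr a a = 0 \<and> cr b b = 0 \<and> a \<noteq> 0 \<and> b \<noteq> 0 \<and> b \<notin> vec.span {a} \<and> x \<in> vec.span {a, b}"
proof (cases "cr x x = 0")
  case True
  \<comment> \<open>A rank one x lies on its secant line through any other frame vector.\<close>
  then obtain e2 e3 where fr: "frame x e2 e3" using extend_frame x by blast
  have "e2 \<notin> vec.span {x}"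
  proof
    assume "e2 \<in> vec.span {x}"
    then obtain k where "e2 = k *s x" by (auto simp: vec.span_singleton)
    then show False using fr True by (simp add: frame_def T_linear) (simp add: T_def)
  qed
  moreover have "e2 \<noteq> 0" using fr by (auto simp: frame_def)
  moreover have "x \<in> vec.span {x, e2}" by (simp add: vec.span_base)
  ultimately show ?thesis using fr x by (intro exI[of _ x] exI[of _ e2]) (simp add: frame_def)
next
  case False
  let ?y = "cr x x"
  obtain e where e: "idempotent e ?y" using dual_idempotent False x by blast
  have xe: "T x x e = 1" using e by (simp add: idempotent_def T_def pairing_commute[of e])
  interpret W: bilinear_space "T e" "peirce0 e ?y" using e by (rule peirce0_space)
  \<comment> \<open>As \<open>T x x x = 0\<close> and \<open>T x x e = 1\<close>,
    \<open>adjoint\<close> at x, x, x, e says that x is fixed by the Peirce projection of the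
    idempotent formed by e and \<open>cr x x\<close>.\<close>
  have "3 *s dr ?y (cr x e) = 3 *s x"
    using adjoint[of x x x e] dr_commute[of "cr x e" ?y] x(2) xe by (simp add: T_def[symmetric] vec_eq_iff)
  then have "dr ?y (cr e x) = x" by (simp add: vec_eq_iff cr_commute[of e x])
  then have xW: "x \<in> peirce0 e ?y" by (simp add: peirce0_def)
  have exx: "T e x x = 1" using xe by (simp add: T_sym3(1)[of x x e])
  obtain w where w: "w \<in> peirce0 e ?y" "T e x w = 0" "T e w w = -1"
    using W.exists_orthogonal[of x "-1"] xW exx peirce0_not_line[OF e] by auto
  have ewx: "T e w x = 0" using w(2) by (simp add: T_sym(2)[of e w x])
  \<comment> \<open>With w orthogonal to x and of the opposite square, x is the sum of the isotropic
    vectors a and b, which have rank one by \<open>cr_peirce0\<close>.\<close>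
  define a b where "a = (1/2) *s (x + w)" and "b = (1/2) *s (x - w)"
  have mem: "a \<in> peirce0 e ?y" "b \<in> peirce0 e ?y" using xW w by (simp_all add: a_def b_def W.W_closed)
  have T: "T e a a = 0" "T e b b = 0" "T e a b = 1/2"
    using w exx ewx by (simp_all add: a_def b_def T_linear)
  have "cr a a = 0" "cr b b = 0" using cr_peirce0[OF e mem(1,1)] cr_peirce0[OF e mem(2,2)] T by simp_all
  moreover have "a \<noteq> 0" "b \<noteq> 0" using T(3) by auto
  moreover have "b \<notin> vec.span {a}"
  proof
    assume "b \<in> vec.span {a}"
    then obtain k where "b = k *s a" by (auto simp: vec.span_singleton)
    then show False using T by (simp add: T_linear)
  qed
  moreover have "x \<in> vec.span {a, b}"
  proof -
    have "x = a + b" by (simp add: a_def b_def vec_eq_iff field_simps)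
    then show ?thesis by (simp add: vec.span_add vec.span_base)
  qed
  ultimately show ?thesis by blast
qed

end

section \<open>Cubic polynomials\<close>

lemma monomial_split:
  fixes k :: "'n::finite \<Rightarrow> nat"
  assumes "(\<Sum>i\<in>UNIV. k i) = Suc d"
  shows "\<exists>i k'. (\<forall>x::complex^'n. (\<Prod>j\<in>UNIV. x $ j ^ k j) = x $ i * (\<Prod>j\<in>UNIV. x $ j ^ k' j)) \<and> (\<Sum>j\<in>UNIV. k' j) = d"
proof -
  obtain i where i: "k i \<noteq> 0" using assms by (metis sum.neutral nat.distinct(1))
  define k' where "k' = k(i := k i - 1)"
  have "(\<Prod>j\<in>UNIV. x $ j ^ k j) = x $ i * (\<Prod>j\<in>UNIV. x $ j ^ k' j)" for x :: "complex^'n"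
  proof -
    have "(\<Prod>j\<in>UNIV. x $ j ^ k j) = x $ i ^ k i * (\<Prod>j\<in>UNIV - {i}. x $ j ^ k j)" by (rule prod.remove) auto
    also have "(\<Prod>j\<in>UNIV - {i}. x $ j ^ k j) = (\<Prod>j\<in>UNIV - {i}. x $ j ^ k' j)" by (rule prod.cong) (auto simp: k'_def)
    also have "x $ i ^ k i = x $ i * x $ i ^ k' i" using i by (simp add: k'_def power_eq_if)
    also have "x $ i * x $ i ^ k' i * (\<Prod>j\<in>UNIV - {i}. x $ j ^ k' j) = x $ i * (\<Prod>j\<in>UNIV. x $ j ^ k' j)"
      by (subst (2) prod.remove[of _ i]) auto
    finally show ?thesis .
  qed
  moreover have "(\<Sum>j\<in>UNIV. k' j) = d"
  proof -
    have "(\<Sum>j\<in>UNIV. k j) = k i + (\<Sum>j\<in>UNIV - {i}. k j)" by (rule sum.remove) auto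
    also have "(\<Sum>j\<in>UNIV - {i}. k j) = (\<Sum>j\<in>UNIV - {i}. k' j)" by (rule sum.cong) (auto simp: k'_def)
    finally have "Suc d = Suc (k' i + (\<Sum>j\<in>UNIV - {i}. k' j))" using i assms by (simp add: k'_def)
    also have "k' i + (\<Sum>j\<in>UNIV - {i}. k' j) = (\<Sum>j\<in>UNIV. k' j)" by (rule sum.remove[symmetric]) auto
    finally show ?thesis by simp
  qed
  ultimately show ?thesis by blast
qed

lemma cubic_monomial:
  fixes m :: "'n::finite \<Rightarrow>\<^sub>0 nat"
  assumes "(\<Sum>i\<in>UNIV. Poly_Mapping.lookup m i) = 3"
  shows "\<exists>a b c. \<forall>x. monom_fun m x = x $ a * x $ b * x $ c"
proof -
  let ?k = "Poly_Mapping.lookup m"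
  obtain a k1 where 1: "\<And>x::complex^'n. (\<Prod>j\<in>UNIV. x $ j ^ ?k j) = x $ a * (\<Prod>j\<in>UNIV. x $ j ^ k1 j)" "(\<Sum>j\<in>UNIV. k1 j) = 2"
    using monomial_split[of ?k 2] assms by auto
  obtain b k2 where 2: "\<And>x::complex^'n. (\<Prod>j\<in>UNIV. x $ j ^ k1 j) = x $ b * (\<Prod>j\<in>UNIV. x $ j ^ k2 j)" "(\<Sum>j\<in>UNIV. k2 j) = 1"
    using monomial_split[of k1 1] 1 by auto
  obtain c k3 where 3: "\<And>x::complex^'n. (\<Prod>j\<in>UNIV. x $ j ^ k2 j) = x $ c * (\<Prod>j\<in>UNIV. x $ j ^ k3 j)" "(\<Sum>j\<in>UNIV. k3 j) = 0"
    using monomial_split[of k2 0] 2 by auto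
  have "monom_fun m x = x $ a * x $ b * x $ c" for x
    using 3(2) by (simp add: monom_fun_def 1(1) 2(1) 3(1))
  then show ?thesis by blast
qed

text \<open>Each cubic monomial is a product of three coordinates, symmetrized over the six
  permutations without division; this is the origin of the factor 6.\<close>

lemma polarization:
  fixes p :: "'n::finite mpoly"
  assumes "homogeneous_poly 3 p"
  shows "\<exists>cr. cubic_map cr \<and> (\<forall>x. cubic_map.T cr x x x = 6 * poly_fun p x)"
proof -
  let ?K = "Poly_Mapping.keys p"
  have "\<forall>m\<in>?K. \<exists>a b c. \<forall>x. monom_fun m x = x $ a * x $ b * x $ c"
    using assms cubic_monomial unfolding homogeneous_poly_def by blast
  then obtain a b c where abc: "\<And>m x. m \<in> ?K \<Longrightarrow> monom_fun m x = x $ a m * x $ b m * x $ c m" by metis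
  define F where "F x y z = (\<Sum>m\<in>?K. Poly_Mapping.lookup p m *
    (x $ a m * y $ b m * z $ c m + x $ a m * z $ b m * y $ c m + y $ a m * x $ b m * z $ c m
    + y $ a m * z $ b m * x $ c m + z $ a m * x $ b m * y $ c m + z $ a m * y $ b m * x $ c m))" for x y z :: "complex^'n"
  define cr where "cr x y = (\<chi> i. F x y (axis i 1))" for x y
  have F_add: "F (x + x') y z = F x y z + F x' y z" for x x' y z
    unfolding F_def sum.distrib[symmetric] by (rule sum.cong) (simp_all add: algebra_simps)
  have F_scale: "F (k *s x) y z = k * F x y z" for k x y z
    unfolding F_def sum_distrib_left by (rule sum.cong) (simp_all add: algebra_simps)
  have F_sym: "F x y z = F y x z" "F x y z = F x z y" for x y z
    unfolding F_def by (rule sum.cong; simp add: algebra_simps)+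
  have F_cr: "pairing (cr x y) z = F x y z" for x y z
  proof -
    have "F z x y = (\<Sum>i\<in>UNIV. z $ i * F (axis i 1) x y)"
    proof -
      \<comment> \<open>The scalar is wrapped into a vector of length 1 so that
        \<open>additive_sum_axis\<close> applies.\<close>
      have *: "(\<chi> i::1. F z x y) = (\<Sum>j\<in>UNIV. z $ j *s (\<chi> i::1. F (axis j 1) x y))"
        by (rule additive_sum_axis) (simp_all add: F_add F_scale vec_eq_iff)
      show ?thesis using arg_cong[OF *, of "\<lambda>v. v $ 1"] by simp
    qed
    moreover have "F a x y = F x y a" for a using F_sym by metis
    ultimately show ?thesis by (simp add: pairing_def cr_def mult.commute)
  qed
  interpret cubic_map cr
  proof
    show "pairing (cr x y) z = pairing (cr x z) y" for x y z unfolding F_cr by (rule F_sym)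
    show "cr x y = cr y x" for x y unfolding cr_def using F_sym(1) by (simp add: vec_eq_iff)
  qed (simp_all add: cr_def F_add F_scale vec_eq_iff)
  have "T x x x = 6 * poly_fun p x" for x
  proof -
    have "T x x x = (\<Sum>m\<in>?K. 6 * (Poly_Mapping.lookup p m * monom_fun m x))"
      unfolding T_def F_cr F_def by (rule sum.cong) (simp_all add: abc algebra_simps)
    then show ?thesis by (simp add: poly_fun_superset[of ?K p] sum_distrib_left)
  qed
  then show ?thesis using cubic_map_axioms by blast
qed

section \<open>The differential and the logarithmic Hessian in terms of \<open>cr\<close>\<close>

context cubic_map
begin

lemma T_line: "T (x + t *s y) (x + t *s y) (x + t *s y) = T x x x + 3 * t * T x x y + 3 * t\<^sup>2 * T x y y + t ^ 3 * T y y y"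
  using T_cube_add[of x "t *s y" 0] T_sym3(1)[of y y x]
  by (simp add: T_linear power2_eq_square power3_eq_cube algebra_simps)

lemma T_line_derivative: "((\<lambda>t. T (x + t *s y) (x + t *s y) (x + t *s y)) has_field_derivative 3 * T x x y) (at 0)"
  unfolding T_line by (auto intro!: derivative_eq_intros)

lemma differential_cubic:
  assumes "\<And>x. T x x x = 6 * poly_fun p x"
  shows "differential (poly_fun p) x = (1/2) *s cr x x"
proof -
  have "partial i (poly_fun p) x = (1/2) * cr x x $ i" for i
  proof -
    have "((\<lambda>t. poly_fun p (x + t *s axis i 1)) has_field_derivative (3 * T x x (axis i 1)) / 6) (at 0)"
      using DERIV_cdivide[OF T_line_derivative, of x "axis i 1" 6] by (simp add: assms)
    then show ?thesis unfolding partial_def by (subst DERIV_imp_deriv) (auto simp: T_def pairing_axis)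
  qed
  then show ?thesis by (simp add: differential_def vec_eq_iff)
qed

lemma hessian_ln_cubic:
  assumes p: "\<And>x. T x x x = 6 * poly_fun p x" and x: "poly_fun p x \<noteq> 0"
  shows "hessian_ln (poly_fun p) x $ i $ j =
    cr x (axis i 1) $ j / poly_fun p x - cr x x $ i * cr x x $ j / (4 * (poly_fun p x)\<^sup>2)"
proof -
  let ?a = "axis i 1"
  have 1: "((\<lambda>t. poly_fun p (x + t *s ?a)) has_field_derivative cr x x $ i / 2) (at 0)"
    using DERIV_cdivide[OF T_line_derivative, of x ?a 6] by (simp add: p T_def pairing_axis)
  have "cr (x + t *s ?a) (x + t *s ?a) $ j = cr x x $ j + 2 * t * cr x ?a $ j + t\<^sup>2 * cr ?a ?a $ j" for t
    by (simp add: cr_linear cr_commute[of ?a x] power2_eq_square algebra_simps)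
  then have 2: "((\<lambda>t. (1/2) * cr (x + t *s ?a) (x + t *s ?a) $ j) has_field_derivative cr x ?a $ j) (at 0)"
    by (auto intro!: derivative_eq_intros)
  have "((\<lambda>t. ((1/2) * cr (x + t *s ?a) (x + t *s ?a) $ j) / poly_fun p (x + t *s ?a)) has_field_derivative
      (cr x ?a $ j * poly_fun p x - (1/2) * cr x x $ j * (cr x x $ i / 2)) / (poly_fun p x * poly_fun p x)) (at 0)"
    using DERIV_divide[OF 2 1] x by simp
  then have "hessian_ln (poly_fun p) x $ i $ j =
      (cr x ?a $ j * poly_fun p x - (1/2) * cr x x $ j * (cr x x $ i / 2)) / (poly_fun p x * poly_fun p x)"
    unfolding hessian_ln_def vec_lambda_beta partial_def log_differential_def differential_cubic[OF p]
    by (subst DERIV_imp_deriv) (auto simp: mult.commute)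
  then show ?thesis using x by (simp add: field_simps power2_eq_square)
qed

text \<open>The Hessian of ln f is \<open>cr x\<close> divided by f, minus a rank one matrix built
  from \<open>cr x x\<close>. If \<open>cr x v = 0\<close>, symmetry also makes
  \<open>cr x x\<close> pair to zero with v, so v lies in the kernel of the Hessian.\<close>

lemma cr_injective_of_hessian:
  assumes p: "\<And>x. T x x x = 6 * poly_fun p x" and x: "poly_fun p x \<noteq> 0" "det (hessian_ln (poly_fun p) x) \<noteq> 0"
    and v: "cr x v = 0"
  shows "v = 0"
proof -
  let ?H = "hessian_ln (poly_fun p) x"
  have cv: "(\<Sum>i\<in>UNIV. v $ i * cr x (axis i 1) $ j) = 0" for j
  proof -
    have "cr x v = (\<Sum>i\<in>UNIV. v $ i *s cr x (axis i 1))" by (rule additive_sum_axis) (simp_all add: cr_linear)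
    then show ?thesis using v by (metis (no_types, lifting) sum_component vector_smult_component zero_index sum.cong)
  qed
  have vx: "(\<Sum>i\<in>UNIV. v $ i * cr x x $ i) = 0"
    using cr_assoc[of x x v] v by (simp add: pairing_def mult.commute)
  have "(\<Sum>i\<in>UNIV. v $ i * ?H $ i $ j) = 0" for j
  proof -
    have "(\<Sum>i\<in>UNIV. v $ i * ?H $ i $ j) = (\<Sum>i\<in>UNIV. v $ i * cr x (axis i 1) $ j) / poly_fun p x
        - (\<Sum>i\<in>UNIV. v $ i * cr x x $ i) * (cr x x $ j / (4 * (poly_fun p x)\<^sup>2))"
      unfolding hessian_ln_cubic[OF p x(1)] sum_divide_distrib sum_distrib_right sum_subtractf[symmetric]
      by (rule sum.cong) (simp_all add: algebra_simps)
    then show ?thesis by (simp add: cv vx)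
  qed
  then have "transpose ?H *v v = 0"
    by (simp add: matrix_vector_mult_def transpose_def vec_eq_iff mult.commute)
  moreover have "invertible (transpose ?H)" using x(2) by (simp add: invertible_det_nz)
  ultimately show ?thesis by (metis invertible_def matrix_left_invertible_ker)
qed

text \<open>A polynomial in x, so that \<open>cr x\<close> is injective on an open set, where it can
  be cancelled from identities.\<close>

definition cr_det :: "complex^'n \<Rightarrow> complex" where
  "cr_det x = det (\<chi> i j. cr x (axis j 1) $ i)"

lemma polyfun_cr_det: "polyfun cr_det"
  unfolding cr_det_def det_def vec_lambda_beta
  using polymap_cr[OF polymap_id polymap_const]
  by (auto simp: polymap_def intro!: polyfun_sum polyfun_mult polyfun_prod polyfun_const)

lemma cr_det_nonzero_iff: "cr_det x \<noteq> 0 \<longleftrightarrow> (\<forall>v. cr x v = 0 \<longrightarrow> v = 0)"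
proof -
  have "(\<chi> i j. cr x (axis j 1) $ i) *v v = cr x v" for v
    using additive_sum_axis[of "cr x" v] by (simp add: cr_linear matrix_vector_mult_def vec_eq_iff mult.commute)
  then show ?thesis
    unfolding cr_det_def invertible_det_nz[symmetric] invertible_left_inverse matrix_left_invertible_ker by simp
qed

end

text \<open>Polarization one argument at a time: expanding along x + t y gives a polynomial in t
  that vanishes for all t, and a few values of t isolate its lowest coefficient.\<close>

lemma symmetric_quadrilinear_zero:
  fixes F :: "complex^'n::finite \<Rightarrow> complex^'n \<Rightarrow> complex^'n \<Rightarrow> complex^'n \<Rightarrow> complex"
  assumes add: "\<And>x x' y z w. F (x + x') y z w = F x y z w + F x' y z w"
    and scale: "\<And>c x y z w. F (c *s x) y z w = c * F x y z w"
    and sym: "\<And>x y z w. F x y z w = F y x z w" "\<And>x y z w. F x y z w = F x z y w" "\<And>x y z w. F x y z w = F x y w z"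
    and diag: "\<And>x. F x x x x = 0"
  shows "F x y z w = 0"
proof -
  have add2: "F x (y + y') z w = F x y z w + F x y' z w" "F x z (y + y') w = F x z y w + F x z y' w"
    "F x z w (y + y') = F x z w y + F x z w y'" for x y y' z w
    using add sym by metis+
  have scale2: "F x (c *s y) z w = c * F x y z w" "F x z (c *s y) w = c * F x z y w" "F x z w (c *s y) = c * F x z w y" for c x y z w
    using scale sym by metis+
  note lin = add add2 scale scale2
  have 1: "F x x x y = 0" for x y
  proof -
    have e: "4 * t * F x x x y + 6 * t\<^sup>2 * F x x y y + 4 * t ^ 3 * F x y y y = 0" for t
    proof -
      have "F (x + t *s y) (x + t *s y) (x + t *s y) (x + t *s y) = F x x x x + 4 * t * F x x x y + 6 * t\<^sup>2 * F x x y y + 4 * t ^ 3 * F x y y y + t ^ 4 * F y y y y"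
        by (simp add: lin sym power2_eq_square power3_eq_cube power4_eq_xxxx algebra_simps)
      then show ?thesis by (simp add: diag)
    qed
    show ?thesis using e[of 1] e[of "-1"] e[of 2] by simp algebra
  qed
  have 2: "F x x y w = 0" for x y w
  proof -
    have e: "3 * t * F x x y w + 3 * t\<^sup>2 * F x y y w = 0" for t
    proof -
      have "F (x + t *s y) (x + t *s y) (x + t *s y) w = F x x x w + 3 * t * F x x y w + 3 * t\<^sup>2 * F x y y w + t ^ 3 * F y y y w"
        by (simp add: lin sym power2_eq_square power3_eq_cube algebra_simps)
      then show ?thesis by (simp add: 1)
    qed
    show ?thesis using e[of 1] e[of "-1"] by simp
  qed
  have "F (x + y) (x + y) z w = F x x z w + 2 * F x y z w + F y y z w" by (simp add: lin sym)
  then show ?thesis by (simp add: 2)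
qed

lemma adjoint_polarization:
  fixes cr dr :: "complex^'n::finite \<Rightarrow> complex^'n \<Rightarrow> complex^'n"
  assumes "cubic_map cr" "cubic_map dr"
    and adj: "\<And>x. 3 *s dr (cr x x) (cr x x) = (4 * pairing (cr x x) x) *s x"
  shows "dr (cr x1 x2) (cr x3 x4) + dr (cr x1 x3) (cr x2 x4) + dr (cr x1 x4) (cr x2 x3)
      = pairing (cr x2 x3) x4 *s x1 + pairing (cr x1 x3) x4 *s x2
      + pairing (cr x1 x2) x4 *s x3 + pairing (cr x1 x2) x3 *s x4"
proof (rule pairing_eqI)
  interpret C: cubic_map cr by fact
  interpret D: cubic_map dr by fact
  fix v
  define F where "F x1 x2 x3 x4 = pairing (dr (cr x1 x2) (cr x3 x4) + dr (cr x1 x3) (cr x2 x4) + dr (cr x1 x4) (cr x2 x3)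
      - (C.T x2 x3 x4 *s x1 + C.T x1 x3 x4 *s x2 + C.T x1 x2 x4 *s x3 + C.T x1 x2 x3 *s x4)) v" for x1 x2 x3 x4
  have "F x1 x2 x3 x4 = 0"
  proof (rule symmetric_quadrilinear_zero)
    show "F (x + x') y z w = F x y z w + F x' y z w" for x x' y z w
      by (simp add: F_def C.cr_linear D.cr_linear C.T_linear algebra_simps)
    show "F (c *s x) y z w = c * F x y z w" for c x y z w
      by (simp add: F_def C.cr_linear D.cr_linear C.T_linear algebra_simps)
    show "F x y z w = F y x z w" for x y z w
      unfolding F_def C.T_sym(1)[of y x] C.cr_commute[of y x] D.cr_commute[of "cr y z"] D.cr_commute[of "cr y w"]
      by (simp add: algebra_simps)
    show "F x y z w = F x z y w" for x y z w
      unfolding F_def C.T_sym(2)[of x z y] C.T_sym(1)[of z y] C.cr_commute[of z y] by (simp add: algebra_simps)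
    show "F x y z w = F x y w z" for x y z w
      unfolding F_def C.T_sym(2)[of _ w z] C.cr_commute[of w z] D.cr_commute[of "cr x z" "cr y w"] D.cr_commute[of "cr x w" "cr y z"]
      by (simp add: algebra_simps)
    show "F x x x x = 0" for x
    proof -
      have "F x x x x = 3 * pairing (dr (cr x x) (cr x x)) v - (4 * C.T x x x) * pairing x v"
        unfolding F_def pairing_simps by simp
      also have "\<dots> = 0"
        using arg_cong[OF adj[of x], of "\<lambda>u. pairing u v"] by (simp only: pairing_simps C.T_def) simp
      finally show ?thesis .
    qed
  qed
  then show "pairing (dr (cr x1 x2) (cr x3 x4) + dr (cr x1 x3) (cr x2 x4) + dr (cr x1 x4) (cr x2 x3)) v
    = pairing (pairing (cr x2 x3) x4 *s x1 + pairing (cr x1 x3) x4 *s x2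
      + pairing (cr x1 x2) x4 *s x3 + pairing (cr x1 x2) x3 *s x4) v"
    by (simp add: F_def C.T_def)
qed

section \<open>From the Legendre transform to the two adjoint identities\<close>

lemma polyfun_eq_on_open:
  assumes "polyfun g" "polyfun h" "open U" "U \<noteq> {}" "\<And>x. x \<in> U \<Longrightarrow> g x = h x"
  shows "g x = h x"
  using polyfun_eq_0_on_open[OF polyfun_diff[OF assms(1,2)] assms(3,4)] assms(5) by simp

lemma polymap_eq_on_open:
  assumes "polymap g" "polymap h" "open U" "U \<noteq> {}" "\<And>x. x \<in> U \<Longrightarrow> g x = h x"
  shows "g x = h x"
proof -
  have "g x $ i = h x $ i" for i
    by (rule polyfun_eq_on_open[of "\<lambda>x. g x $ i" "\<lambda>x. h x $ i" U]) (use assms in \<open>auto simp: polymap_def\<close>)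
  then show ?thesis by (simp add: vec_eq_iff)
qed

lemma continuous_polymap: "polymap h \<Longrightarrow> continuous_on S h"
proof -
  assume h: "polymap h"
  have "continuous_on S (\<lambda>x. \<chi> i. h x $ i)"
    by (rule continuous_on_vec_lambda) (use h in \<open>auto simp: polymap_def intro: continuous_on_subset[OF continuous_polyfun]\<close>)
  then show ?thesis by simp
qed

text \<open>Since \<open>g\<close> is homogeneous of degree \<open>d\<close>, comparing degrees in \<open>f g(f') = f ^ d\<close> gives \<open>3 + 2 d = 3 d\<close>.\<close>

lemma legendre_cubic:
  fixes f g :: "'n::finite mpoly"
  assumes p: "cubic_map cr" "\<And>x. cubic_map.T cr x x x = 6 * poly_fun f x" and f: "homogeneous_poly 3 f"
    and l: "multiplicative_legendre_transform (poly_fun f) (poly_fun g)"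
  shows "homogeneous_poly 3 g \<and> (\<forall>x. poly_fun g ((1/2) *s cr x x) = (poly_fun f x)\<^sup>2)"
proof -
  interpret cubic_map cr by fact
  obtain d where d: "homogeneous_fun d (poly_fun g)" using l by (auto simp: multiplicative_legendre_transform_def)
  obtain U where U: "open U" "U \<noteq> {}" "\<And>x. x \<in> U \<Longrightarrow> poly_fun f x \<noteq> 0"
    "\<And>x. x \<in> U \<Longrightarrow> poly_fun g (log_differential (poly_fun f) x) = 1 / poly_fun f x"
    using l unfolding multiplicative_legendre_transform_def by blast
  define h where "h x = (1/2) *s cr x x" for x
  have gh: "poly_fun g (c *s x) = c ^ d * poly_fun g x" for c x using d by (simp add: homogeneous_fun_def)
  have poly_gh: "polyfun (\<lambda>x. poly_fun g (h x))"
  proof (rule polyfun_compose)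
    have "polymap h" unfolding h_def by (intro polymap_scale polyfun_const polymap_cr polymap_id)
    then show "polyfun (\<lambda>x. h x $ i)" for i by (simp add: polymap_def)
  qed auto
  have 1: "poly_fun f x * poly_fun g (h x) = poly_fun f x ^ d" for x
  proof (rule polyfun_eq_on_open[OF _ _ U(1,2)])
    fix x assume x: "x \<in> U"
    have "log_differential (poly_fun f) x = (1 / poly_fun f x) *s h x"
      by (simp only: log_differential_def differential_cubic[OF p(2)] h_def)
    then have "(1 / poly_fun f x) ^ d * poly_fun g (h x) = 1 / poly_fun f x" using U(4)[OF x] gh by simp
    then show "poly_fun f x * poly_fun g (h x) = poly_fun f x ^ d" using U(3)[OF x] by (simp add: field_simps power_divide)
  qed (use poly_gh in auto)
  obtain x where x: "poly_fun f x \<noteq> 0" using U by blast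
  \<comment> \<open>Doubling x multiplies \<open>h x\<close> by 4 and the cubic by 8; where f is
    nonzero, this compares 8 * 4 ^ d with 8 ^ d.\<close>
  have "h (2 *s x) = 4 *s h x" by (simp add: h_def cr_linear vec_eq_iff)
  moreover have "poly_fun f (2 *s x) = 8 * poly_fun f x" using homogeneous_poly_fun_scale[OF f, of 2] by simp
  ultimately have "8 * poly_fun f x * (4 ^ d * poly_fun g (h x)) = 8 ^ d * poly_fun f x ^ d"
    using 1[of "2 *s x"] gh by (simp add: power_mult_distrib)
  then have "(8 * 4 ^ d) * poly_fun f x ^ d = 8 ^ d * poly_fun f x ^ d" unfolding 1[of x, symmetric] by simp
  then have "(8::complex) * 4 ^ d = 8 ^ d" using x by simp
  moreover have "(8::complex) * 4 ^ d = of_nat (2 ^ (3 + 2 * d))" "(8::complex) ^ d = of_nat (2 ^ (3 * d))"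
    by (simp_all add: power_add power_mult)
  ultimately have "(2::nat) ^ (3 + 2 * d) = 2 ^ (3 * d)" by (metis of_nat_eq_iff)
  then have "3 + 2 * d = 3 * d" by (simp add: power_inject_exp)
  then have d3: "d = 3" by simp
  then have "homogeneous_poly 3 g" using d homogeneous_fun_imp_poly by blast
  moreover have "poly_fun g (h x) - (poly_fun f x)\<^sup>2 = 0" for x
  proof (rule polyfun_mult_eq_0[of "poly_fun f"])
    show "poly_fun f x * (poly_fun g (h x) - (poly_fun f x)\<^sup>2) = 0" for x
      using 1[of x] d3 by (simp add: algebra_simps power2_eq_square power3_eq_cube)
  qed (use poly_gh x in \<open>auto intro!: polyfun_diff polyfun_power\<close>)
  ultimately show ?thesis by (simp add: h_def)
qed

text \<open>Differentiating the norm identity in direction z shows that \<open>cr x\<close>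
  annihilates the difference of the two sides. Where \<open>cr_det\<close> is nonzero this
  difference is 0, and the nonempty open set of such x determines a polynomial map.\<close>

lemma adjoint_of_norm:
  assumes "cubic_map cr" "cubic_map dr"
    and norm: "\<And>x. 3 * pairing (dr (cr x x) (cr x x)) (cr x x) = 4 * (pairing (cr x x) x)\<^sup>2"
    and det: "cubic_map.cr_det cr x0 \<noteq> 0"
  shows "3 *s dr (cr x x) (cr x x) = (4 * pairing (cr x x) x) *s x"
proof -
  interpret C: cubic_map cr by fact
  interpret D: cubic_map dr by fact
  have 1: "cr x (3 *s dr (cr x x) (cr x x) - (4 * C.T x x x) *s x) = 0" for x
  proof (rule pairing_eqI)
    fix z
    let ?s = "cr x x" and ?w = "2 *s cr x z" and ?y = "cr z z"
    have n: "3 * D.T (cr x x) (cr x x) (cr x x) = 4 * (C.T x x x)\<^sup>2" for x using norm by (simp add: C.T_def D.T_def)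
    have "cr (x + t *s z) (x + t *s z) = ?s + t *s ?w + t\<^sup>2 *s ?y" for t
      by (simp add: C.cr_linear C.cr_commute[of z x] vec_eq_iff power2_eq_square algebra_simps)
    then have "3 * D.T (?s + t *s ?w + t\<^sup>2 *s ?y) (?s + t *s ?w + t\<^sup>2 *s ?y) (?s + t *s ?w + t\<^sup>2 *s ?y)
        = 4 * (C.T (x + t *s z) (x + t *s z) (x + t *s z))\<^sup>2" for t
      using n[of "x + t *s z"] by simp
    moreover have "((\<lambda>t. 3 * D.T (?s + t *s ?w + t\<^sup>2 *s ?y) (?s + t *s ?w + t\<^sup>2 *s ?y) (?s + t *s ?w + t\<^sup>2 *s ?y))
        has_field_derivative 9 * D.T ?s ?s ?w) (at 0)"
      unfolding D.T_cube_add D.T_linear(7-9) by (auto intro!: derivative_eq_intros)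
    moreover have "((\<lambda>t. 4 * (C.T (x + t *s z) (x + t *s z) (x + t *s z))\<^sup>2) has_field_derivative 24 * C.T x x x * C.T x x z) (at 0)"
      using DERIV_cmult[OF DERIV_power[OF C.T_line_derivative[of x z], of 2], of 4] by (simp add: mult_ac)
    ultimately have "9 * D.T ?s ?s ?w = 24 * C.T x x x * C.T x x z" by (metis (no_types, lifting) DERIV_unique ext)
    then have "18 * D.T ?s ?s (cr x z) = 24 * (C.T x x x * C.T x x z)" by (simp add: D.T_linear)
    then have "3 * D.T ?s ?s (cr x z) = 4 * C.T x x x * C.T x x z" by algebra
    moreover have "D.T ?s ?s (cr x z) = pairing (cr x (dr ?s ?s)) z"
      unfolding D.T_def pairing_commute[of "dr ?s ?s"] by (rule C.cr_assoc)
    ultimately show "pairing (cr x (3 *s dr ?s ?s - (4 * C.T x x x) *s x)) z = pairing 0 z"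
      by (simp add: C.cr_linear C.T_def[of x x z])
  qed
  show ?thesis
  proof (rule polymap_eq_on_open[of "\<lambda>x. 3 *s dr (cr x x) (cr x x)" "\<lambda>x. (4 * pairing (cr x x) x) *s x" "{x. C.cr_det x \<noteq> 0}"])
    show "open {x. C.cr_det x \<noteq> 0}" using C.polyfun_cr_det by (rule open_polyfun_nonzero)
    show "polymap (\<lambda>x. 3 *s dr (cr x x) (cr x x))" "polymap (\<lambda>x. (4 * pairing (cr x x) x) *s x)"
      by (intro polymap_scale polyfun_mult polyfun_const polyfun_pairing D.polymap_cr C.polymap_cr polymap_id)+
    show "{x. C.cr_det x \<noteq> 0} \<noteq> {}" using det by blast
    show "3 *s dr (cr x x) (cr x x) = (4 * pairing (cr x x) x) *s x" if "x \<in> {x. C.cr_det x \<noteq> 0}" for x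
    proof -
      have "3 *s dr (cr x x) (cr x x) - (4 * C.T x x x) *s x = 0"
        using 1[of x] that C.cr_det_nonzero_iff[of x] by blast
      then show ?thesis by (simp only: C.T_def eq_iff_diff_eq_0[symmetric])
    qed
  qed
qed

text \<open>Up to sign, \<open>x\<close> is determined by \<open>cr x x\<close> where the cubic form does not vanish; by invariance of
  domain the image of \<open>x \<mapsto> cr x x\<close> has interior points.\<close>

lemma dual_adjoint_of_adjoint:
  fixes cr dr :: "complex^'n::finite \<Rightarrow> complex^'n \<Rightarrow> complex^'n"
  assumes "cubic_map cr" "cubic_map dr"
    and adj: "\<And>x. 3 *s dr (cr x x) (cr x x) = (4 * pairing (cr x x) x) *s x"
    and x0: "pairing (cr x0 x0) x0 \<noteq> 0"
  shows "3 *s cr (dr y y) (dr y y) = (4 * pairing (dr y y) y) *s y"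
proof -
  interpret C: cubic_map cr by fact
  interpret D: cubic_map dr by fact
  have norm: "3 * D.T (cr x x) (cr x x) (cr x x) = 4 * (C.T x x x)\<^sup>2" for x
    using arg_cong[OF adj[of x], of "\<lambda>u. pairing u (cr x x)"]
    by (simp only: pairing_simps D.T_def C.T_def pairing_commute[of x] power2_eq_square mult.assoc)
  \<comment> \<open>The ball around x0 of radius \<open>norm x0\<close> contains no two opposite
    vectors, which removes the ambiguity of sign.\<close>
  define S where "S = ball x0 (norm x0) \<inter> {x. C.T x x x \<noteq> 0}"
  have "polyfun (\<lambda>x. C.T x x x)" by (intro C.polyfun_T polymap_id)
  then have S: "open S" unfolding S_def by (intro open_Int open_ball open_polyfun_nonzero)
  have "x0 \<noteq> 0" using x0 by auto
  then have "x0 \<in> S" using x0 by (simp add: S_def C.T_def)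
  let ?s = "\<lambda>x. cr x x"
  have "inj_on ?s S"
  proof
    fix x y assume xy: "x \<in> S" "y \<in> S" "?s x = ?s y"
    have "(C.T x x x)\<^sup>2 = (C.T y y y)\<^sup>2" using norm[of x] norm[of y] xy(3) by simp
    then have "C.T x x x = C.T y y y \<or> C.T x x x = - C.T y y y" by (simp add: power2_eq_iff)
    moreover have "(4 * C.T x x x) *s x = (4 * C.T y y y) *s y"
    proof -
      have "(4 * C.T x x x) *s x = 3 *s dr (cr x x) (cr x x)" using adj[of x] by (simp only: C.T_def)
      also have "\<dots> = (4 * C.T y y y) *s y" unfolding xy(3) using adj[of y] by (simp only: C.T_def)
      finally show ?thesis .
    qed
    ultimately have "(4 * C.T y y y) *s (x - y) = 0 \<or> (4 * C.T y y y) *s (x + y) = 0"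
      by (auto simp: vec.scale_right_diff_distrib vec.scale_right_distrib neg_eq_iff_add_eq_0)
    then have "x = y \<or> x = - y"
      using xy(2) unfolding vec.scale_eq_0_iff by (auto simp: S_def eq_neg_iff_add_eq_0)
    moreover have "x \<noteq> - y"
    proof
      assume "x = - y"
      then have "norm (x0 + y) < norm x0" "norm (x0 - y) < norm x0" using xy by (simp_all add: S_def dist_norm)
      then have "norm ((x0 + y) + (x0 - y)) < 2 * norm x0" using norm_triangle_ineq[of "x0 + y" "x0 - y"] by linarith
      moreover have "(x0 + y) + (x0 - y) = 2 *\<^sub>R x0" by (simp add: scaleR_2)
      ultimately show False by simp
    qed
    ultimately show "x = y" by blast
  qed
  moreover have "polymap ?s" by (intro C.polymap_cr polymap_id)
  ultimately have "open (?s ` S)" using S continuous_polymap invariance_of_domain by blast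
  show ?thesis
  proof (rule polymap_eq_on_open[of "\<lambda>y. 3 *s cr (dr y y) (dr y y)" "\<lambda>y. (4 * pairing (dr y y) y) *s y" "?s ` S"])
    show "open (?s ` S)" by fact
    show "polymap (\<lambda>y. 3 *s cr (dr y y) (dr y y))" "polymap (\<lambda>y. (4 * pairing (dr y y) y) *s y)"
      by (intro polymap_scale polyfun_mult polyfun_const polyfun_pairing D.polymap_cr C.polymap_cr polymap_id)+
    show "?s ` S \<noteq> {}" using \<open>x0 \<in> S\<close> by blast
    fix y assume "y \<in> ?s ` S"
    then obtain x where y: "y = cr x x" by blast
    \<comment> \<open>On the image of x under squaring, \<open>dr y y\<close> is an explicit
      multiple of x, so applying \<open>cr\<close> gives back a multiple of y.\<close>
    have d: "dr y y = (4 / 3 * C.T x x x) *s x"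
      using arg_cong[OF adj[of x], of "\<lambda>u. (1/3) *s u"] by (simp add: y C.T_def)
    have pd: "pairing (dr y y) y = 4 / 3 * (C.T x x x)\<^sup>2" unfolding d by (simp add: y pairing_commute[of x "cr x x"] C.T_def[symmetric] power2_eq_square)
    show "3 *s cr (dr y y) (dr y y) = (4 * pairing (dr y y) y) *s y"
      unfolding pd unfolding d by (simp add: C.cr_linear y power2_eq_square)
  qed
qed

theorem EKP_cubic_pair:
  fixes f :: "'n::finite mpoly"
  assumes "irreducible f" "homogeneous_poly 3 f" "EKP_homaloidal f"
  obtains cr dr where "irreducible_cubic_pair cr dr" "\<And>x. cubic_map.T cr x x x = 6 * poly_fun f x"
proof -
  obtain cr where cr: "cubic_map cr" "\<And>x. cubic_map.T cr x x x = 6 * poly_fun f x"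
    using polarization[OF assms(2)] by blast
  interpret C: cubic_map cr by fact
  obtain x0 where x0: "poly_fun f x0 \<noteq> 0" "det (hessian_ln (poly_fun f) x0) \<noteq> 0"
    using assms(3) by (auto simp: EKP_homaloidal_def generically_invertible_hessian_ln_def)
  obtain g where g: "multiplicative_legendre_transform (poly_fun f) (poly_fun g)"
    using assms(3) by (auto simp: EKP_homaloidal_def)
  note lg = legendre_cubic[OF cr assms(2) g]
  obtain dr where dr: "cubic_map dr" "\<And>x. cubic_map.T dr x x x = 6 * poly_fun g x"
    using polarization lg by blast
  interpret D: cubic_map dr by fact
  have norm: "3 * pairing (dr (cr x x) (cr x x)) (cr x x) = 4 * (pairing (cr x x) x)\<^sup>2" for x
  proof -
    have "poly_fun g ((1/2) *s cr x x) = (1/2) ^ 3 * poly_fun g (cr x x)"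
      using lg homogeneous_poly_fun_scale by blast
    then have "(1/2) ^ 3 * poly_fun g (cr x x) = (poly_fun f x)\<^sup>2" using lg by simp
    then have "8 * ((1/2) ^ 3 * poly_fun g (cr x x)) = 8 * (poly_fun f x)\<^sup>2" by (simp only:)
    then have "poly_fun g (cr x x) = 8 * (poly_fun f x)\<^sup>2" by (simp add: power3_eq_cube)
    then have "D.T (cr x x) (cr x x) (cr x x) = 48 * (poly_fun f x)\<^sup>2" using dr by simp
    then show ?thesis using cr(2)[of x] by (simp add: D.T_def C.T_def power2_eq_square)
  qed
  have "C.cr_det x0 \<noteq> 0" using C.cr_det_nonzero_iff C.cr_injective_of_hessian[OF cr(2) x0] by blast
  then have adj: "3 *s dr (cr x x) (cr x x) = (4 * pairing (cr x x) x) *s x" for x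
    using adjoint_of_norm[OF cr(1) dr(1) norm] by blast
  have "pairing (cr x0 x0) x0 \<noteq> 0" using x0 cr(2)[of x0] by (simp add: C.T_def)
  then have dadj: "3 *s cr (dr y y) (dr y y) = (4 * pairing (dr y y) y) *s y" for y
    using dual_adjoint_of_adjoint[OF cr(1) dr(1) adj] by blast
  have "irreducible_cubic_pair cr dr"
  proof
    fix g h :: "complex^'n \<Rightarrow> complex"
    assume gh: "polyfun g" "polyfun h" "g 0 = 0" "h 0 = 0"
    show "\<exists>x. C.T x x x \<noteq> g x * h x"
    proof (rule ccontr)
      assume "\<not> ?thesis"
      then have "poly_fun f x = (1/6 * g x) * h x" for x using cr(2)[of x] by simp
      then show False
        using not_irreducible_poly_fun[of "\<lambda>x. 1/6 * g x" h f] polyfun_mult[OF polyfun_const[of "1/6"] gh(1)] gh assms(1) by simp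
    qed
  qed (rule adjoint_polarization[OF cr(1) dr(1) adj] adjoint_polarization[OF dr(1) cr(1) dadj])+
  then show ?thesis using that cr(2) by blast
qed

section \<open>Singular loci\<close>

text \<open>Twice the derivative of the cubic form \<open>N\<close> at \<open>x\<close> in direction \<open>y\<close>.\<close>

definition grad :: "(complex^'n::finite \<Rightarrow> complex) \<Rightarrow> complex^'n \<Rightarrow> complex^'n \<Rightarrow> complex" where
  "grad N x y = N (x + y) - N (x - y) - 2 * N y"

definition slocus :: "(complex^'n::finite \<Rightarrow> complex) \<Rightarrow> 'n point set" where
  "slocus N = {vec.span {x} | x. x \<noteq> 0 \<and> (\<forall>y. grad N x y = 0)}"

lemma span_scale: "c \<noteq> 0 \<Longrightarrow> vec.span {c *s x} = vec.span {x :: complex^'n::finite}"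
proof -
  assume c: "c \<noteq> 0"
  have "x = (1 / c) *s (c *s x)" using c by simp
  then have "x \<in> vec.span {c *s x}" using vec.span_scale vec.span_base by (metis insertI1)
  then show ?thesis
    by (intro equalityI vec.span_minimal) (auto simp: vec.span_scale vec.span_base)
qed

lemma slocus_eqI:
  assumes "\<And>x. x \<noteq> 0 \<Longrightarrow> (\<And>y. grad N x y = 0) \<Longrightarrow> \<exists>p. P p \<and> (\<exists>c. F p = c *s x) \<and> F p \<noteq> 0"
    and "\<And>p y. P p \<Longrightarrow> grad N (F p) y = 0" "\<And>p. P p \<Longrightarrow> F p \<noteq> 0"
  shows "slocus N = {vec.span {F p} | p. P p}"
proof (intro equalityI subsetI)
  fix L assume "L \<in> slocus N"
  then obtain x where x: "x \<noteq> 0" "\<And>y. grad N x y = 0" "L = vec.span {x}" by (auto simp: slocus_def)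
  obtain p c where p: "P p" "F p = c *s x" "F p \<noteq> 0" using assms(1) x by metis
  then have "L = vec.span {F p}" using x(3) span_scale[of c x] by auto
  then show "L \<in> {vec.span {F p} | p. P p}" using p by blast
next
  fix L assume "L \<in> {vec.span {F p} | p. P p}"
  then show "L \<in> slocus N" using assms(2,3) unfolding slocus_def by blast
qed

lemma grad_sym_cubic:
  "grad sym_cubic x y = 2 * (y $ 1 * (x $ 2 * x $ 3 - x $ 6 * x $ 6) + y $ 2 * (x $ 1 * x $ 3 - x $ 5 * x $ 5)
    + y $ 3 * (x $ 1 * x $ 2 - x $ 4 * x $ 4) + 2 * y $ 4 * (x $ 5 * x $ 6 - x $ 3 * x $ 4)
    + 2 * y $ 5 * (x $ 4 * x $ 6 - x $ 2 * x $ 5) + 2 * y $ 6 * (x $ 4 * x $ 5 - x $ 1 * x $ 6))"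
  unfolding grad_def sym_cubic_def vector_add_component vector_minus_component by algebra

text \<open>The partial derivatives are, up to factors, the 2 x 2 minors, so singular points are
  symmetric matrices of rank one.\<close>

lemma slocus_sym_cubic: "slocus sym_cubic = veronese_surface"
  unfolding veronese_surface_def
proof (rule slocus_eqI)
  fix x :: "complex^6" assume x: "x \<noteq> 0" and g: "\<And>y. grad sym_cubic x y = 0"
  have q: "x $ 2 * x $ 3 = x $ 6 * x $ 6" "x $ 1 * x $ 3 = x $ 5 * x $ 5" "x $ 1 * x $ 2 = x $ 4 * x $ 4"
    "x $ 5 * x $ 6 = x $ 3 * x $ 4" "x $ 4 * x $ 6 = x $ 2 * x $ 5" "x $ 4 * x $ 5 = x $ 1 * x $ 6"
    using g[of "vector [1, 0, 0, 0, 0, 0]"] g[of "vector [0, 1, 0, 0, 0, 0]"] g[of "vector [0, 0, 1, 0, 0, 0]"]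
      g[of "vector [0, 0, 0, 1, 0, 0]"] g[of "vector [0, 0, 0, 0, 1, 0]"] g[of "vector [0, 0, 0, 0, 0, 1]"]
    by (simp_all add: grad_sym_cubic)
  let ?F = "\<lambda>z :: complex^3. vector [z $ 1 * z $ 1, z $ 2 * z $ 2, z $ 3 * z $ 3, z $ 1 * z $ 2, z $ 1 * z $ 3, z $ 2 * z $ 3] :: complex^6"
  have "x $ 1 \<noteq> 0 \<or> x $ 2 \<noteq> 0 \<or> x $ 3 \<noteq> 0"
  proof (rule ccontr)
    assume "\<not> ?thesis"
    then have "x = 0" using q by (simp add: vec_eq_iff forall_6)
    then show False using x by simp
  qed
  \<comment> \<open>The test vectors are the rows of the symmetric matrix: in rank one, the product
    of row i with its transpose is the i-th diagonal entry times the matrix.\<close>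
  moreover have "?F (vector [x $ 1, x $ 4, x $ 5]) = x $ 1 *s x" "?F (vector [x $ 4, x $ 2, x $ 6]) = x $ 2 *s x"
    "?F (vector [x $ 5, x $ 6, x $ 3]) = x $ 3 *s x"
    using q by (simp_all add: vec_eq_iff forall_6 mult.commute)
  ultimately obtain z c where z: "?F z = c *s x" "c \<noteq> 0" by metis
  then have "?F z \<noteq> 0" using x by (simp add: vec.scale_eq_0_iff)
  moreover have "z \<noteq> 0"
  proof
    assume "z = 0"
    then have "?F z = 0" by (simp add: vec_eq_iff forall_6)
    then show False using \<open>?F z \<noteq> 0\<close> by blast
  qed
  ultimately show "\<exists>z. z \<noteq> 0 \<and> (\<exists>c. ?F z = c *s x) \<and> ?F z \<noteq> 0" using z by blast
next
  fix z :: "complex^3" and y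
  show "grad sym_cubic (vector [z $ 1 * z $ 1, z $ 2 * z $ 2, z $ 3 * z $ 3, z $ 1 * z $ 2, z $ 1 * z $ 3, z $ 2 * z $ 3]) y = 0"
    unfolding grad_sym_cubic vector_6 by algebra
next
  fix z :: "complex^3" assume "z \<noteq> 0"
  then show "(vector [z $ 1 * z $ 1, z $ 2 * z $ 2, z $ 3 * z $ 3, z $ 1 * z $ 2, z $ 1 * z $ 3, z $ 2 * z $ 3] :: complex^6) \<noteq> 0"
    by (auto simp: vec_eq_iff forall_6 forall_3)
qed

lemma grad_det_cubic:
  "grad det_cubic x y = 2 * (
    y $ (1,1) * (x $ (2,2) * x $ (3,3) - x $ (2,3) * x $ (3,2)) - y $ (1,2) * (x $ (2,1) * x $ (3,3) - x $ (2,3) * x $ (3,1))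
    + y $ (1,3) * (x $ (2,1) * x $ (3,2) - x $ (2,2) * x $ (3,1)) - y $ (2,1) * (x $ (1,2) * x $ (3,3) - x $ (1,3) * x $ (3,2))
    + y $ (2,2) * (x $ (1,1) * x $ (3,3) - x $ (1,3) * x $ (3,1)) - y $ (2,3) * (x $ (1,1) * x $ (3,2) - x $ (1,2) * x $ (3,1))
    + y $ (3,1) * (x $ (1,2) * x $ (2,3) - x $ (1,3) * x $ (2,2)) - y $ (3,2) * (x $ (1,1) * x $ (2,3) - x $ (1,3) * x $ (2,1))
    + y $ (3,3) * (x $ (1,1) * x $ (2,2) - x $ (1,2) * x $ (2,1)))"
  unfolding grad_def det_cubic_def det_3 vec_lambda_beta vector_add_component vector_minus_component by algebra

lemma slocus_det_cubic: "slocus det_cubic = segre_P2_P2"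
proof -
  let ?F = "\<lambda>p :: (complex^3) \<times> (complex^3). (\<chi> ij. fst p $ fst ij * snd p $ snd ij) :: complex^(3 \<times> 3)"
  have "slocus det_cubic = {vec.span {?F p} | p. fst p \<noteq> 0 \<and> snd p \<noteq> 0}"
  proof (rule slocus_eqI)
    fix x :: "complex^(3 \<times> 3)" assume x: "x \<noteq> 0" and g: "\<And>y. grad det_cubic x y = 0"
    have q: "x $ (2,2) * x $ (3,3) = x $ (2,3) * x $ (3,2)" "x $ (2,1) * x $ (3,3) = x $ (2,3) * x $ (3,1)"
      "x $ (2,1) * x $ (3,2) = x $ (2,2) * x $ (3,1)" "x $ (1,2) * x $ (3,3) = x $ (1,3) * x $ (3,2)"
      "x $ (1,1) * x $ (3,3) = x $ (1,3) * x $ (3,1)" "x $ (1,1) * x $ (3,2) = x $ (1,2) * x $ (3,1)"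
      "x $ (1,2) * x $ (2,3) = x $ (1,3) * x $ (2,2)" "x $ (1,1) * x $ (2,3) = x $ (1,3) * x $ (2,1)"
      "x $ (1,1) * x $ (2,2) = x $ (1,2) * x $ (2,1)"
      using g[of "axis (1,1) 1"] g[of "axis (1,2) 1"] g[of "axis (1,3) 1"] g[of "axis (2,1) 1"] g[of "axis (2,2) 1"]
        g[of "axis (2,3) 1"] g[of "axis (3,1) 1"] g[of "axis (3,2) 1"] g[of "axis (3,3) 1"]
      by (simp_all add: grad_det_cubic axis_def)
    have minors: "\<forall>i k j l. x $ (i, j) * x $ (k, l) = x $ (i, l) * x $ (k, j)"
      unfolding forall_3 using q by (simp add: mult.commute)
    obtain i j where ij: "x $ (i, j) \<noteq> 0" using x by (auto simp: vec_eq_iff)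
    \<comment> \<open>The column and the row through a nonzero entry factor a matrix of rank one, up
      to that entry.\<close>
    let ?p = "(\<chi> k. x $ (k, j), \<chi> l. x $ (i, l))"
    have F: "?F ?p = x $ (i, j) *s x"
      using minors by (auto simp: vec_eq_iff mult.commute)
    moreover have "?F ?p \<noteq> 0" unfolding F using ij x by (simp add: vec.scale_eq_0_iff)
    moreover have "fst ?p \<noteq> 0" "snd ?p \<noteq> 0" using ij by (auto simp: vec_eq_iff)
    ultimately show "\<exists>p. (fst p \<noteq> 0 \<and> snd p \<noteq> 0) \<and> (\<exists>c. ?F p = c *s x) \<and> ?F p \<noteq> 0" by blast
  next
    show "grad det_cubic (?F p) y = 0" for p y
      unfolding grad_det_cubic vec_lambda_beta fst_conv snd_conv by algebra
    show "?F p \<noteq> 0" if "fst p \<noteq> 0 \<and> snd p \<noteq> 0" for p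
      using that by (auto simp: vec_eq_iff)
  qed
  then show ?thesis by (auto simp: segre_P2_P2_def)
qed

lemma grad_pf_cubic:
  "grad pf_cubic x z = 2 * (- z $ 1 * (x $ 10 * x $ 15 - x $ 11 * x $ 14 + x $ 12 * x $ 13)
    + z $ 2 * (x $ 7 * x $ 15 - x $ 8 * x $ 14 + x $ 9 * x $ 13)
    - z $ 3 * (x $ 6 * x $ 15 - x $ 8 * x $ 12 + x $ 9 * x $ 11)
    + z $ 4 * (x $ 6 * x $ 14 - x $ 7 * x $ 12 + x $ 9 * x $ 10)
    - z $ 5 * (x $ 6 * x $ 13 - x $ 7 * x $ 11 + x $ 8 * x $ 10)
    - z $ 6 * (x $ 3 * x $ 15 - x $ 4 * x $ 14 + x $ 5 * x $ 13)
    + z $ 7 * (x $ 2 * x $ 15 - x $ 4 * x $ 12 + x $ 5 * x $ 11)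
    - z $ 8 * (x $ 2 * x $ 14 - x $ 3 * x $ 12 + x $ 5 * x $ 10)
    + z $ 9 * (x $ 2 * x $ 13 - x $ 3 * x $ 11 + x $ 4 * x $ 10)
    - z $ 10 * (x $ 1 * x $ 15 - x $ 4 * x $ 9 + x $ 5 * x $ 8)
    + z $ 11 * (x $ 1 * x $ 14 - x $ 3 * x $ 9 + x $ 5 * x $ 7)
    - z $ 12 * (x $ 1 * x $ 13 - x $ 3 * x $ 8 + x $ 4 * x $ 7)
    - z $ 13 * (x $ 1 * x $ 12 - x $ 2 * x $ 9 + x $ 5 * x $ 6)
    + z $ 14 * (x $ 1 * x $ 11 - x $ 2 * x $ 8 + x $ 4 * x $ 6)
    - z $ 15 * (x $ 1 * x $ 10 - x $ 2 * x $ 7 + x $ 3 * x $ 6))"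
  unfolding grad_def pf_cubic_def Let_def det_3 vector_3 vector_add_component vector_minus_component by algebra

definition skew :: "complex^15 \<Rightarrow> complex^6^6" where
  "skew x = vector [vector [0, x $ 1, x $ 2, x $ 3, x $ 4, x $ 5],
      vector [- x $ 1, 0, x $ 6, x $ 7, x $ 8, x $ 9],
      vector [- x $ 2, - x $ 6, 0, x $ 10, x $ 11, x $ 12],
      vector [- x $ 3, - x $ 7, - x $ 10, 0, x $ 13, x $ 14],
      vector [- x $ 4, - x $ 8, - x $ 11, - x $ 13, 0, x $ 15],
      vector [- x $ 5, - x $ 9, - x $ 12, - x $ 14, - x $ 15, 0]]"

lemma vector_6_vector [simp]:
  "(vector [a, b, c, d, e, f] :: complex^6^6) $ 1 = a" "(vector [a, b, c, d, e, f] :: complex^6^6) $ 2 = b"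
  "(vector [a, b, c, d, e, f] :: complex^6^6) $ 3 = c" "(vector [a, b, c, d, e, f] :: complex^6^6) $ 4 = d"
  "(vector [a, b, c, d, e, f] :: complex^6^6) $ 5 = e" "(vector [a, b, c, d, e, f] :: complex^6^6) $ 6 = f"
  by (simp_all add: vector_def)

lemma plucker_nth:
  "plucker a b $ 1 = a $ 1 * b $ 2 - a $ 2 * b $ 1" "plucker a b $ 2 = a $ 1 * b $ 3 - a $ 3 * b $ 1"
  "plucker a b $ 3 = a $ 1 * b $ 4 - a $ 4 * b $ 1" "plucker a b $ 4 = a $ 1 * b $ 5 - a $ 5 * b $ 1"
  "plucker a b $ 5 = a $ 1 * b $ 6 - a $ 6 * b $ 1" "plucker a b $ 6 = a $ 2 * b $ 3 - a $ 3 * b $ 2"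
  "plucker a b $ 7 = a $ 2 * b $ 4 - a $ 4 * b $ 2" "plucker a b $ 8 = a $ 2 * b $ 5 - a $ 5 * b $ 2"
  "plucker a b $ 9 = a $ 2 * b $ 6 - a $ 6 * b $ 2" "plucker a b $ 10 = a $ 3 * b $ 4 - a $ 4 * b $ 3"
  "plucker a b $ 11 = a $ 3 * b $ 5 - a $ 5 * b $ 3" "plucker a b $ 12 = a $ 3 * b $ 6 - a $ 6 * b $ 3"
  "plucker a b $ 13 = a $ 4 * b $ 5 - a $ 5 * b $ 4" "plucker a b $ 14 = a $ 4 * b $ 6 - a $ 6 * b $ 4"
  "plucker a b $ 15 = a $ 5 * b $ 6 - a $ 6 * b $ 5"
  unfolding plucker_def list.map prod.case vector_15 by (rule refl)+

text \<open>The partial derivatives are the 4 x 4 sub-Pfaffians up to sign and a factor 2, so their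
  vanishing gives the Pluecker relations. Read as a statement on the 2 x 2 minors of rows i and j,
  these say that the two rows span the required plane if their common entry is nonzero.\<close>

lemma plucker_skew:
  assumes "\<And>z. grad pf_cubic x z = 0"
  shows "plucker (skew x $ i) (skew x $ j) = skew x $ i $ j *s x"
proof -
  have q: "x $ 10 * x $ 15 - x $ 11 * x $ 14 + x $ 12 * x $ 13 = 0"
    "x $ 7 * x $ 15 - x $ 8 * x $ 14 + x $ 9 * x $ 13 = 0"
    "x $ 6 * x $ 15 - x $ 8 * x $ 12 + x $ 9 * x $ 11 = 0"
    "x $ 6 * x $ 14 - x $ 7 * x $ 12 + x $ 9 * x $ 10 = 0"
    "x $ 6 * x $ 13 - x $ 7 * x $ 11 + x $ 8 * x $ 10 = 0"
    "x $ 3 * x $ 15 - x $ 4 * x $ 14 + x $ 5 * x $ 13 = 0"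
    "x $ 2 * x $ 15 - x $ 4 * x $ 12 + x $ 5 * x $ 11 = 0"
    "x $ 2 * x $ 14 - x $ 3 * x $ 12 + x $ 5 * x $ 10 = 0"
    "x $ 2 * x $ 13 - x $ 3 * x $ 11 + x $ 4 * x $ 10 = 0"
    "x $ 1 * x $ 15 - x $ 4 * x $ 9 + x $ 5 * x $ 8 = 0"
    "x $ 1 * x $ 14 - x $ 3 * x $ 9 + x $ 5 * x $ 7 = 0"
    "x $ 1 * x $ 13 - x $ 3 * x $ 8 + x $ 4 * x $ 7 = 0"
    "x $ 1 * x $ 12 - x $ 2 * x $ 9 + x $ 5 * x $ 6 = 0"
    "x $ 1 * x $ 11 - x $ 2 * x $ 8 + x $ 4 * x $ 6 = 0"
    "x $ 1 * x $ 10 - x $ 2 * x $ 7 + x $ 3 * x $ 6 = 0"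
    \<comment> \<open>Unit vectors with the signs that occur in \<open>grad_pf_cubic\<close>, so
      that each instance yields one relation with sign +.\<close>
    using assms[of "vector [- 1, 0, 0, 0, 0, 0, 0, 0, 0, 0, 0, 0, 0, 0, 0]"] assms[of "vector [0, 1, 0, 0, 0, 0, 0, 0, 0, 0, 0, 0, 0, 0, 0]"]
       assms[of "vector [0, 0, - 1, 0, 0, 0, 0, 0, 0, 0, 0, 0, 0, 0, 0]"] assms[of "vector [0, 0, 0, 1, 0, 0, 0, 0, 0, 0, 0, 0, 0, 0, 0]"]
       assms[of "vector [0, 0, 0, 0, - 1, 0, 0, 0, 0, 0, 0, 0, 0, 0, 0]"] assms[of "vector [0, 0, 0, 0, 0, - 1, 0, 0, 0, 0, 0, 0, 0, 0, 0]"]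
       assms[of "vector [0, 0, 0, 0, 0, 0, 1, 0, 0, 0, 0, 0, 0, 0, 0]"] assms[of "vector [0, 0, 0, 0, 0, 0, 0, - 1, 0, 0, 0, 0, 0, 0, 0]"]
       assms[of "vector [0, 0, 0, 0, 0, 0, 0, 0, 1, 0, 0, 0, 0, 0, 0]"] assms[of "vector [0, 0, 0, 0, 0, 0, 0, 0, 0, - 1, 0, 0, 0, 0, 0]"]
       assms[of "vector [0, 0, 0, 0, 0, 0, 0, 0, 0, 0, 1, 0, 0, 0, 0]"] assms[of "vector [0, 0, 0, 0, 0, 0, 0, 0, 0, 0, 0, - 1, 0, 0, 0]"]
       assms[of "vector [0, 0, 0, 0, 0, 0, 0, 0, 0, 0, 0, 0, - 1, 0, 0]"] assms[of "vector [0, 0, 0, 0, 0, 0, 0, 0, 0, 0, 0, 0, 0, 1, 0]"]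
       assms[of "vector [0, 0, 0, 0, 0, 0, 0, 0, 0, 0, 0, 0, 0, 0, - 1]"]
    by (simp_all add: grad_pf_cubic del: distrib_left_numeral right_diff_distrib_numeral)
  have P: "\<forall>i j k l. skew x $ i $ k * skew x $ j $ l - skew x $ i $ l * skew x $ j $ k = skew x $ i $ j * skew x $ k $ l"
    unfolding forall_6 skew_def vector_6 vector_6_vector
    using q by (simp add: algebra_simps)
  have sk: "skew x $ 1 $ 2 = x $ 1" "skew x $ 1 $ 3 = x $ 2" "skew x $ 1 $ 4 = x $ 3" "skew x $ 1 $ 5 = x $ 4"
     "skew x $ 1 $ 6 = x $ 5" "skew x $ 2 $ 3 = x $ 6" "skew x $ 2 $ 4 = x $ 7" "skew x $ 2 $ 5 = x $ 8"
     "skew x $ 2 $ 6 = x $ 9" "skew x $ 3 $ 4 = x $ 10" "skew x $ 3 $ 5 = x $ 11" "skew x $ 3 $ 6 = x $ 12"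
     "skew x $ 4 $ 5 = x $ 13" "skew x $ 4 $ 6 = x $ 14" "skew x $ 5 $ 6 = x $ 15"
    by (simp_all add: skew_def)
  show ?thesis
    unfolding vec_eq_iff forall_15 plucker_nth vector_smult_component P[rule_format] sk by simp
qed

lemma plucker_eq_0_iff: "plucker a b = 0 \<longleftrightarrow> \<not> (a \<noteq> b \<and> vec.independent {a, b})"
proof
  assume 0: "plucker a b = 0"
  then have m: "\<forall>i j. a $ i * b $ j = a $ j * b $ i"
    unfolding vec_eq_iff forall_15 plucker_nth forall_6 by simp
  show "\<not> (a \<noteq> b \<and> vec.independent {a, b})"
  proof
    assume ab: "a \<noteq> b \<and> vec.independent {a, b}"
    then have "a \<noteq> 0" using vec.dependent_zero by blast
    then obtain i where i: "a $ i \<noteq> 0" by (auto simp: vec_eq_iff)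
    have "b = (b $ i / a $ i) *s a" using m i by (simp add: vec_eq_iff field_simps)
    then have "b \<in> vec.span {a}" by (metis vec.span_scale vec.span_base singletonI)
    then show False using ab by (auto simp: vec.independent_insert insert_commute[of a b] split: if_splits)
  qed
next
  assume dep: "\<not> (a \<noteq> b \<and> vec.independent {a, b})"
  have "a = b \<or> a = 0 \<or> (\<exists>c. b = c *s a)"
    using dep by (auto simp: insert_commute[of a b] vec.independent_insert vec.span_singleton split: if_splits)
  then show "plucker a b = 0"
    by (elim disjE exE) (simp_all add: vec_eq_iff forall_15 plucker_nth)
qed

lemma slocus_pf_cubic: "slocus pf_cubic = grassmannian_2_6"
proof -
  have "slocus pf_cubic = {vec.span {plucker (fst p) (snd p)} | p. fst p \<noteq> snd p \<and> vec.independent {fst p, snd p}}"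
  proof (rule slocus_eqI)
    fix x :: "complex^15" assume x: "x \<noteq> 0" and g: "\<And>y. grad pf_cubic x y = 0"
    have "\<exists>i j. skew x $ i $ j \<noteq> 0"
    proof (rule ccontr)
      assume *: "\<not> ?thesis"
      then have "\<forall>i j. skew x $ i $ j = 0" by blast
      then have "x = 0" unfolding forall_6 by (simp add: skew_def vec_eq_iff forall_15)
      then show False using x by simp
    qed
    then obtain i j where ij: "skew x $ i $ j \<noteq> 0" by blast
    have F: "plucker (skew x $ i) (skew x $ j) = skew x $ i $ j *s x" using g by (rule plucker_skew)
    have nz: "plucker (skew x $ i) (skew x $ j) \<noteq> 0" unfolding F using ij x by (simp add: vec.scale_eq_0_iff)
    show "\<exists>p. (fst p \<noteq> snd p \<and> vec.independent {fst p, snd p}) \<and> (\<exists>c. plucker (fst p) (snd p) = c *s x) \<and> plucker (fst p) (snd p) \<noteq> 0"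
      using F nz plucker_eq_0_iff[of "skew x $ i" "skew x $ j"]
      by (metis fst_conv snd_conv)
  next
    show "grad pf_cubic (plucker (fst p) (snd p)) y = 0" for p y
    proof -
      obtain a b where p: "p = (a, b)" by fastforce
      have q: "plucker a b $ 10 * plucker a b $ 15 - plucker a b $ 11 * plucker a b $ 14 + plucker a b $ 12 * plucker a b $ 13 = 0"
        "plucker a b $ 7 * plucker a b $ 15 - plucker a b $ 8 * plucker a b $ 14 + plucker a b $ 9 * plucker a b $ 13 = 0"
        "plucker a b $ 6 * plucker a b $ 15 - plucker a b $ 8 * plucker a b $ 12 + plucker a b $ 9 * plucker a b $ 11 = 0"
        "plucker a b $ 6 * plucker a b $ 14 - plucker a b $ 7 * plucker a b $ 12 + plucker a b $ 9 * plucker a b $ 10 = 0"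
        "plucker a b $ 6 * plucker a b $ 13 - plucker a b $ 7 * plucker a b $ 11 + plucker a b $ 8 * plucker a b $ 10 = 0"
        "plucker a b $ 3 * plucker a b $ 15 - plucker a b $ 4 * plucker a b $ 14 + plucker a b $ 5 * plucker a b $ 13 = 0"
        "plucker a b $ 2 * plucker a b $ 15 - plucker a b $ 4 * plucker a b $ 12 + plucker a b $ 5 * plucker a b $ 11 = 0"
        "plucker a b $ 2 * plucker a b $ 14 - plucker a b $ 3 * plucker a b $ 12 + plucker a b $ 5 * plucker a b $ 10 = 0"
        "plucker a b $ 2 * plucker a b $ 13 - plucker a b $ 3 * plucker a b $ 11 + plucker a b $ 4 * plucker a b $ 10 = 0"
        "plucker a b $ 1 * plucker a b $ 15 - plucker a b $ 4 * plucker a b $ 9 + plucker a b $ 5 * plucker a b $ 8 = 0"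
        "plucker a b $ 1 * plucker a b $ 14 - plucker a b $ 3 * plucker a b $ 9 + plucker a b $ 5 * plucker a b $ 7 = 0"
        "plucker a b $ 1 * plucker a b $ 13 - plucker a b $ 3 * plucker a b $ 8 + plucker a b $ 4 * plucker a b $ 7 = 0"
        "plucker a b $ 1 * plucker a b $ 12 - plucker a b $ 2 * plucker a b $ 9 + plucker a b $ 5 * plucker a b $ 6 = 0"
        "plucker a b $ 1 * plucker a b $ 11 - plucker a b $ 2 * plucker a b $ 8 + plucker a b $ 4 * plucker a b $ 6 = 0"
        "plucker a b $ 1 * plucker a b $ 10 - plucker a b $ 2 * plucker a b $ 7 + plucker a b $ 3 * plucker a b $ 6 = 0"
        unfolding plucker_nth by algebra+
      show ?thesis unfolding p fst_conv snd_conv grad_pf_cubic q by simp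
    qed
    show "plucker (fst p) (snd p) \<noteq> 0" if "fst p \<noteq> snd p \<and> vec.independent {fst p, snd p}" for p
      using that plucker_eq_0_iff by blast
  qed
  then show ?thesis by (auto simp: grassmannian_2_6_def)
qed

section \<open>Classification\<close>

lemma linear_iso_card:
  assumes "linear_iso (\<Phi> :: complex^'m::finite \<Rightarrow> complex^'n::finite)"
  shows "CARD('m) = CARD('n)"
proof -
  have "vec.dim (\<Phi> ` UNIV) = vec.dim (UNIV :: (complex^'m) set)"
    using assms by (intro vec.dim_image_eq) (auto simp: linear_iso_def bij_def)
  moreover have "\<Phi> ` UNIV = UNIV" using assms by (simp add: linear_iso_def bij_def)
  ultimately show ?thesis by (simp only: vec_dim_card)
qed

context
  fixes \<Phi> :: "complex^'m::finite \<Rightarrow> complex^'n::finite"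
  assumes \<Phi>: "linear_iso \<Phi>"
begin

lemma linear_iso_linear: "\<Phi> (x + y) = \<Phi> x + \<Phi> y" "\<Phi> (c *s x) = c *s \<Phi> x" "\<Phi> (x - y) = \<Phi> x - \<Phi> y"
proof -
  interpret Vector_Spaces.linear "(*s)" "(*s)" \<Phi> using \<Phi> by (simp add: linear_iso_def)
  show "\<Phi> (x + y) = \<Phi> x + \<Phi> y" "\<Phi> (c *s x) = c *s \<Phi> x" "\<Phi> (x - y) = \<Phi> x - \<Phi> y"
    by (simp_all add: add scale diff)
qed

lemma linear_iso_eq_0_iff: "\<Phi> x = 0 \<longleftrightarrow> x = 0"
proof -
  have "\<Phi> 0 = 0" using linear_iso_linear(2)[of 0 0] by simp
  moreover have "inj \<Phi>" using \<Phi> by (simp add: linear_iso_def bij_def)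
  ultimately show ?thesis by (metis injD)
qed

lemma linear_iso_span: "\<Phi> ` vec.span {x} = vec.span {\<Phi> x}"
  by (auto simp: vec.span_singleton linear_iso_linear image_image)

lemma linear_iso_inv: "\<Phi> (inv \<Phi> y) = y" "inv \<Phi> (\<Phi> x) = x" "linear_iso (inv \<Phi>)"
proof -
  have "bij \<Phi>" using \<Phi> by (simp add: linear_iso_def)
  then show 1: "\<Phi> (inv \<Phi> y) = y" "inv \<Phi> (\<Phi> x) = x" for x y
    by (simp_all add: bij_is_surj surj_f_inv_f bij_is_inj inv_f_f)
  show "linear_iso (inv \<Phi>)"
  proof (rule linear_isoI)
    show "inv \<Phi> (x + y) = inv \<Phi> x + inv \<Phi> y" for x y by (metis 1 linear_iso_linear(1))
    show "inv \<Phi> (c *s x) = c *s inv \<Phi> x" for c x by (metis 1 linear_iso_linear(2))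
    show "x = 0" if "inv \<Phi> x = 0" for x using that 1(1)[of x] linear_iso_eq_0_iff[of 0] by simp
    show "\<exists>x. inv \<Phi> x = y" for y using 1(2) by blast
  qed
qed

lemma projectively_equivalent_image: "projectively_equivalent W ((\<lambda>L. \<Phi> ` L) ` W)"
  using \<Phi> unfolding projectively_equivalent_def linear_iso_def by blast

end

lemma linear_iso_compose:
  assumes "linear_iso \<Phi>" "linear_iso \<Psi>"
  shows "linear_iso (\<lambda>x. \<Phi> (\<Psi> x))"
proof (rule linear_isoI)
  show "\<exists>x. \<Phi> (\<Psi> x) = y" for y by (metis assms linear_iso_inv(1))
qed (simp_all add: linear_iso_linear assms linear_iso_eq_0_iff)

section \<open>Singular points as points of rank one\<close>

definition rank1_points :: "(complex^'n::finite \<Rightarrow> complex^'n \<Rightarrow> complex^'n) \<Rightarrow> 'n point set" where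
  "rank1_points cr = {vec.span {e} | e. e \<noteq> 0 \<and> cr e e = 0}"

context cubic_map
begin

lemma T_eq_grad:
  assumes "linear_iso \<Phi>" "\<And>x. T (\<Phi> x) (\<Phi> x) (\<Phi> x) = 6 * N x"
  shows "T (\<Phi> x) (\<Phi> x) (\<Phi> y) = grad N x y"
proof -
  have "6 * grad N x y = T (\<Phi> x + \<Phi> y) (\<Phi> x + \<Phi> y) (\<Phi> x + \<Phi> y) - T (\<Phi> x - \<Phi> y) (\<Phi> x - \<Phi> y) (\<Phi> x - \<Phi> y)
      - 2 * T (\<Phi> y) (\<Phi> y) (\<Phi> y)"
    using assms(2)[of "x + y"] assms(2)[of "x - y"] assms(2)[of y] by (simp add: linear_iso_linear[OF assms(1)] grad_def)
  also have "\<dots> = 6 * T (\<Phi> x) (\<Phi> x) (\<Phi> y)"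
    using T_line[of "\<Phi> x" 1 "\<Phi> y"] T_line[of "\<Phi> x" "-1" "\<Phi> y"] by simp
  finally show ?thesis by simp
qed

lemma rank1_iff_grad:
  assumes "linear_iso \<Phi>" "\<And>x. T (\<Phi> x) (\<Phi> x) (\<Phi> x) = 6 * N x"
  shows "cr (\<Phi> x) (\<Phi> x) = 0 \<longleftrightarrow> (\<forall>y. grad N x y = 0)"
proof
  assume "cr (\<Phi> x) (\<Phi> x) = 0"
  then show "\<forall>y. grad N x y = 0" unfolding T_eq_grad[OF assms, symmetric] by (simp add: T_def)
next
  assume g: "\<forall>y. grad N x y = 0"
  show "cr (\<Phi> x) (\<Phi> x) = 0"
  proof (rule pairing_eqI)
    fix z
    have "T (\<Phi> x) (\<Phi> x) (\<Phi> (inv \<Phi> z)) = 0" using T_eq_grad[OF assms] g by simp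
    then show "pairing (cr (\<Phi> x) (\<Phi> x)) z = pairing 0 z" by (simp add: linear_iso_inv[OF assms(1)] T_def)
  qed
qed

lemma rank1_points_image:
  assumes "linear_iso \<Phi>" "\<And>x. T (\<Phi> x) (\<Phi> x) (\<Phi> x) = 6 * N x"
  shows "rank1_points cr = (\<lambda>L. \<Phi> ` L) ` slocus N"
proof -
  have "rank1_points cr = {vec.span {\<Phi> x} | x. x \<noteq> 0 \<and> (\<forall>y. grad N x y = 0)}"
  proof (intro equalityI subsetI)
    fix L assume "L \<in> rank1_points cr"
    then obtain e where e: "L = vec.span {e}" "e \<noteq> 0" "cr e e = 0" by (auto simp: rank1_points_def)
    obtain x where x: "e = \<Phi> x" using linear_iso_inv(1)[OF assms(1)] by metis
    show "L \<in> {vec.span {\<Phi> x} | x. x \<noteq> 0 \<and> (\<forall>y. grad N x y = 0)}"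
      using e rank1_iff_grad[OF assms, of x] linear_iso_eq_0_iff[OF assms(1), of x] unfolding x by blast
  next
    fix L assume "L \<in> {vec.span {\<Phi> x} | x. x \<noteq> 0 \<and> (\<forall>y. grad N x y = 0)}"
    then show "L \<in> rank1_points cr"
      unfolding rank1_points_def using rank1_iff_grad[OF assms] linear_iso_eq_0_iff[OF assms(1)] by blast
  qed
  also have "\<dots> = (\<lambda>L. \<Phi> ` L) ` slocus N"
    unfolding slocus_def linear_iso_span[OF assms(1), symmetric] by blast
  finally show ?thesis .
qed

lemma singular_locus_eq:
  assumes "\<And>x. T x x x = 6 * poly_fun f x"
  shows "singular_locus f = rank1_points cr"
proof (intro equalityI subsetI)
  fix L assume "L \<in> singular_locus f"
  then obtain v where v: "L = vec.span {v}" "v \<noteq> 0" "differential (poly_fun f) v = 0"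
    by (auto simp: singular_locus_def hypersurface_def zero_locus_def proj_space_def vec.span_base)
  then show "L \<in> rank1_points cr"
    using differential_cubic[OF assms, of v] by (auto simp: rank1_points_def vec.scale_eq_0_iff)
next
  fix L assume "L \<in> rank1_points cr"
  then obtain e where e: "L = vec.span {e}" "e \<noteq> 0" "cr e e = 0" by (auto simp: rank1_points_def)
  have "cr v v = 0" if "v \<in> L" for v using that e by (auto simp: vec.span_singleton cr_linear)
  then have "differential (poly_fun f) v = 0" "poly_fun f v = 0" if "v \<in> L" for v
    using that differential_cubic[OF assms, of v] assms[of v] by (simp_all add: T_def)
  then show "L \<in> singular_locus f"
    using e by (auto simp: singular_locus_def hypersurface_def zero_locus_def proj_space_def)
qed

end

lemma polymap_linear_iso: "linear_iso \<Phi> \<Longrightarrow> polymap \<Phi>"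
  using polymap_linear[OF _ _ polymap_id, of \<Phi>] linear_iso_linear by blast

lemma zariski_closed_zero_locus:
  assumes "\<And>h. h \<in> H \<Longrightarrow> \<exists>d. form d h"
  shows "zariski_closed {L \<in> proj_space. \<forall>h\<in>H. \<forall>v\<in>L. h v = 0}"
proof -
  let ?S = "{p. (\<exists>d. homogeneous_poly d p) \<and> poly_fun p \<in> H}"
  have "(\<forall>p\<in>?S. \<forall>v\<in>L. poly_fun p v = 0) \<longleftrightarrow> (\<forall>h\<in>H. \<forall>v\<in>L. h v = 0)" for L
  proof
    assume p: "\<forall>p\<in>?S. \<forall>v\<in>L. poly_fun p v = 0"
    show "\<forall>h\<in>H. \<forall>v\<in>L. h v = 0"
    proof
      fix h assume h: "h \<in> H"
      then obtain d q where "homogeneous_poly d q" "poly_fun q = h" using assms unfolding form_def by blast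
      then have "q \<in> ?S" "poly_fun q = h" using h by auto
      then show "\<forall>v\<in>L. h v = 0" using p by blast
    qed
  qed auto
  then have "{L \<in> proj_space. \<forall>h\<in>H. \<forall>v\<in>L. h v = 0} = zero_locus ?S" by (simp add: zero_locus_def)
  then show ?thesis unfolding zariski_closed_def by (intro exI[of _ ?S]) auto
qed

context irreducible_cubic_pair
begin

lemma rank1_coordinates:
  assumes "cr e e = 0" "e \<noteq> 0"
  shows "(\<exists>\<Phi>::complex^6 \<Rightarrow> complex^'a. linear_iso \<Phi> \<and> (\<forall>x. T (\<Phi> x) (\<Phi> x) (\<Phi> x) = 6 * sym_cubic x)) \<or>
    (\<exists>\<Phi>::complex^(3 \<times> 3) \<Rightarrow> complex^'a. linear_iso \<Phi> \<and> (\<forall>x. T (\<Phi> x) (\<Phi> x) (\<Phi> x) = 6 * det_cubic x)) \<or>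
    (\<exists>\<Phi>::complex^15 \<Rightarrow> complex^'a. linear_iso \<Phi> \<and> (\<forall>x. T (\<Phi> x) (\<Phi> x) (\<Phi> x) = 6 * pf_cubic x)) \<or>
    (\<exists>\<Phi>::complex^(3 \<times> 3 \<times> 3) \<Rightarrow> complex^'a. linear_iso \<Phi> \<and>
      (\<forall>x. T (\<Phi> x) (\<Phi> x) (\<Phi> x) = 6 * cartan_cubic x) \<and> \<Phi> (axis (1, 1, 1) 1) = e)"
proof -
  obtain e2 e3 where fr: "frame e e2 e3" using extend_frame assms by blast
  show ?thesis by (rule coordinates[OF fr peirce_nonzero[OF fr]])
qed

text \<open>The automorphism group of the Cartan cubic acts transitively on its singular points, because every
  singular point can be the first vector of a frame.\<close>

lemma is_cayley_plane_slocus: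
  fixes \<Phi> :: "complex^(3 \<times> 3 \<times> 3) \<Rightarrow> complex^'a"
  assumes \<Phi>: "linear_iso \<Phi>" "\<And>x. T (\<Phi> x) (\<Phi> x) (\<Phi> x) = 6 * cartan_cubic x" and "cr (\<Phi> (axis (1, 1, 1) 1)) (\<Phi> (axis (1, 1, 1) 1)) = 0"
  shows "is_cayley_plane (slocus cartan_cubic)"
  unfolding is_cayley_plane_def
proof (intro conjI bexI)
  let ?E = "axis (1, 1, 1) 1 :: complex^(3 \<times> 3 \<times> 3)"
  have E: "?E \<noteq> 0" by (simp add: axis_eq_0_iff)
  then show "vec.span {?E} \<in> proj_space" by (auto simp: proj_space_def)
  \<comment> \<open>Dimension 27 leaves only the Cartan alternative of
    \<open>rank1_coordinates\<close>, for every rank one vector.\<close>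
  have card: "CARD('a) = 27" using linear_iso_card[OF \<Phi>(1)] by simp
  have other: "\<not> linear_iso (\<Psi> :: complex^6 \<Rightarrow> complex^'a)" "\<not> linear_iso (\<Psi>' :: complex^(3 \<times> 3) \<Rightarrow> complex^'a)"
    "\<not> linear_iso (\<Psi>'' :: complex^15 \<Rightarrow> complex^'a)" for \<Psi> \<Psi>' \<Psi>''
    using card linear_iso_card[of \<Psi>] linear_iso_card[of \<Psi>'] linear_iso_card[of \<Psi>''] by auto
  have gE: "grad cartan_cubic ?E y = 0" for y using rank1_iff_grad[OF \<Phi>] assms(3) by blast
  show "slocus cartan_cubic = {T ` vec.span {?E} | T. T \<in> E6_group}"
  proof (intro equalityI subsetI)
    fix L assume "L \<in> slocus cartan_cubic"
    then obtain x where x: "x \<noteq> 0" "\<forall>y. grad cartan_cubic x y = 0" "L = vec.span {x}" by (auto simp: slocus_def)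
    have "cr (\<Phi> x) (\<Phi> x) = 0" "\<Phi> x \<noteq> 0"
      using rank1_iff_grad[OF \<Phi>] x linear_iso_eq_0_iff[OF \<Phi>(1)] by auto
    then obtain \<Psi> :: "complex^(3 \<times> 3 \<times> 3) \<Rightarrow> complex^'a" where
      \<Psi>: "linear_iso \<Psi>" "\<And>x. T (\<Psi> x) (\<Psi> x) (\<Psi> x) = 6 * cartan_cubic x" "\<Psi> ?E = \<Phi> x"
      using rank1_coordinates[of "\<Phi> x"] other by blast
    \<comment> \<open>Two coordinate systems of the same cubic differ by an automorphism; this one
      takes \<open>?E\<close> to x.\<close>
    define g where "g y = inv \<Phi> (\<Psi> y)" for y
    have g: "linear_iso g" unfolding g_def using \<Psi>(1) linear_iso_inv(3)[OF \<Phi>(1)] linear_iso_compose by blast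
    have "cartan_cubic (g y) = cartan_cubic y" for y
      using \<Phi>(2)[of "g y"] \<Psi>(2)[of y] by (simp add: g_def linear_iso_inv[OF \<Phi>(1)])
    then have "g \<in> E6_group" using g by (simp add: E6_group_def linear_iso_def)
    moreover have "g ?E = x" by (simp add: g_def \<Psi>(3) linear_iso_inv[OF \<Phi>(1)])
    then have "L = g ` vec.span {?E}" by (simp add: linear_iso_span[OF g] x(3))
    ultimately show "L \<in> {T ` vec.span {?E} | T. T \<in> E6_group}" by blast
  next
    fix L assume "L \<in> {T ` vec.span {?E} | T. T \<in> E6_group}"
    then obtain g where g: "g \<in> E6_group" "L = g ` vec.span {?E}" by blast
    then have iso: "linear_iso g" and inv: "\<And>x. cartan_cubic (g x) = cartan_cubic x" by (auto simp: E6_group_def linear_iso_def)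
    have "grad cartan_cubic (g ?E) y = 0" for y
    proof -
      have "grad cartan_cubic (g ?E) (g (inv g y)) = grad cartan_cubic ?E (inv g y)"
        unfolding grad_def linear_iso_linear[OF iso, symmetric] inv ..
      then show ?thesis by (simp add: linear_iso_inv[OF iso] gE)
    qed
    moreover have "g ?E \<noteq> 0" using E linear_iso_eq_0_iff[OF iso] by simp
    ultimately show "L \<in> slocus cartan_cubic" by (auto simp: g(2) linear_iso_span[OF iso] slocus_def)
  qed
  \<comment> \<open>The orbit is closed because it is the singular locus, cut out by quadratic
    forms.\<close>
  let ?H = "range (\<lambda>y x. grad cartan_cubic x y)"
  have "\<exists>d. form d (\<lambda>x. grad cartan_cubic x y)" for y
  proof (rule exI[of _ 2], unfold form_iff, intro conjI)
    show "polyfun (\<lambda>x. grad cartan_cubic x y)"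
      unfolding T_eq_grad[OF \<Phi>, symmetric] by (intro polyfun_T polymap_linear_iso polymap_const \<Phi>(1))
    show "homogeneous_fun 2 (\<lambda>x. grad cartan_cubic x y)"
      unfolding T_eq_grad[OF \<Phi>, symmetric] homogeneous_fun_def
      by (simp add: linear_iso_linear[OF \<Phi>(1)] T_linear power2_eq_square)
  qed
  then have "zariski_closed {L \<in> proj_space. \<forall>h\<in>?H. \<forall>v\<in>L. h v = 0}" by (intro zariski_closed_zero_locus) auto
  moreover have "{L \<in> proj_space. \<forall>h\<in>?H. \<forall>v\<in>L. h v = 0} = slocus cartan_cubic"
  proof -
    have "(\<forall>v\<in>vec.span {x}. grad cartan_cubic v y = 0) \<longleftrightarrow> grad cartan_cubic x y = 0" for x y
      unfolding T_eq_grad[OF \<Phi>, symmetric]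
      by (auto simp: vec.span_singleton linear_iso_linear[OF \<Phi>(1)] T_linear intro: vec.span_base dest: spec[of _ 1])
    then show ?thesis by (auto simp: proj_space_def slocus_def)
  qed
  ultimately show "zariski_closed (slocus cartan_cubic)" by simp
qed

theorem classical_severi:
  assumes "CARD('a) \<ge> 2"
  shows "classical_severi_variety (rank1_points cr)"
proof -
  obtain e where e: "cr e e = 0" "e \<noteq> 0" using exists_rank1[OF assms] by blast
  have image: "projectively_equivalent (slocus N) (rank1_points cr)"
    if "linear_iso \<Phi>" "\<forall>x. T (\<Phi> x) (\<Phi> x) (\<Phi> x) = 6 * N x" for \<Phi> :: "complex^'c::finite \<Rightarrow> complex^'a" and N
    using projectively_equivalent_image[OF that(1), of "slocus N"] rank1_points_image[OF that(1)] that(2) by simp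
  show ?thesis
    using rank1_coordinates[OF e]
  proof (elim disjE exE conjE)
    fix \<Phi> :: "complex^(3 \<times> 3 \<times> 3) \<Rightarrow> complex^'a"
    assume \<Phi>: "linear_iso \<Phi>" "\<forall>x. T (\<Phi> x) (\<Phi> x) (\<Phi> x) = 6 * cartan_cubic x" "\<Phi> (axis (1, 1, 1) 1) = e"
    then have "is_cayley_plane (slocus cartan_cubic)" using e(1) by (intro is_cayley_plane_slocus[of \<Phi>]) simp_all
    then show ?thesis using image[OF \<Phi>(1,2)] unfolding classical_severi_variety_def by blast
  qed (use image[of _ sym_cubic] image[of _ det_cubic] image[of _ pf_cubic] in
      \<open>auto simp: classical_severi_variety_def slocus_sym_cubic slocus_det_cubic slocus_pf_cubic\<close>)
qed

lemma span_Un_span: "vec.span (vec.span {a} \<union> vec.span {b}) = vec.span {a, b :: complex^'a}"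
  unfolding insert_is_Un[of a "{b}"] vec.span_Un vec.span_span ..

text \<open>For v = s a + t b with a and b of rank one, \<open>cr v v\<close> is a multiple of
  \<open>cr a b\<close>, which pairs to zero with a and with b. The converse inclusion is
  \<open>secant\<close>.\<close>

lemma secants_eq_hypersurface:
  assumes f: "\<And>x. T x x x = 6 * poly_fun f x"
  shows "\<Union>{secant_line L M | L M. L \<in> rank1_points cr \<and> M \<in> rank1_points cr \<and> L \<noteq> M} = hypersurface f"
proof (intro equalityI subsetI)
  fix K assume "K \<in> \<Union>{secant_line L M | L M. L \<in> rank1_points cr \<and> M \<in> rank1_points cr \<and> L \<noteq> M}"
  then obtain a b where ab: "cr a a = 0" "cr b b = 0" and K: "K \<in> secant_line (vec.span {a}) (vec.span {b})"
    by (auto simp: rank1_points_def)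
  have "poly_fun f v = 0" if "v \<in> K" for v
  proof -
    have "v \<in> vec.span {a, b}" using that K by (auto simp: secant_line_def span_Un_span)
    then obtain s where "v - s *s a \<in> vec.span {b}" by (auto simp: vec.span_breakdown_eq)
    then obtain t where "v - s *s a = t *s b" by (auto simp: vec.span_singleton)
    then have v: "v = s *s a + t *s b" by (simp add: diff_eq_eq add.commute)
    have "cr v v = (2 * s * t) *s cr a b" using ab by (simp add: v cr_linear cr_commute[of b a] vec_eq_iff)
    then have "T v v v = 0"
      using ab pairing_self_rank1[of a b] pairing_self_rank1[of b a]
      by (simp add: T_def v cr_commute[of b a])
    then show ?thesis using f[of v] by simp
  qed
  then show "K \<in> hypersurface f" using K by (simp add: hypersurface_def zero_locus_def secant_line_def)
next
  fix K assume "K \<in> hypersurface f"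
  then obtain x where x: "K = vec.span {x}" "x \<noteq> 0" "poly_fun f x = 0"
    by (auto simp: hypersurface_def zero_locus_def proj_space_def vec.span_base)
  then have "T x x x = 0" using f by simp
  then obtain a b where ab: "cr a a = 0" "cr b b = 0" "a \<noteq> 0" "b \<noteq> 0" "b \<notin> vec.span {a}" "x \<in> vec.span {a, b}"
    using secant x(2) by blast
  have "K \<in> secant_line (vec.span {a}) (vec.span {b})"
    using x ab vec.span_minimal[of "{x}" "vec.span {a, b}"]
    by (auto simp: secant_line_def span_Un_span proj_space_def)
  moreover have "vec.span {a} \<noteq> vec.span {b}" using ab(5) vec.span_base[of b "{b}"] by auto
  ultimately show "K \<in> \<Union>{secant_line L M | L M. L \<in> rank1_points cr \<and> M \<in> rank1_points cr \<and> L \<noteq> M}"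
    using ab unfolding rank1_points_def by blast
qed

end

theorem corollary4:
  fixes f :: "'n::finite mpoly"
  assumes "CARD('n) \<ge> 2"
    and "irreducible f"
    and "homogeneous_poly 3 f"
    and "EKP_homaloidal f"
  shows "classical_severi_variety (singular_locus f) \<and>
         secant_variety (singular_locus f) = hypersurface f"
proof -
  obtain cr dr where "irreducible_cubic_pair cr dr" and f: "\<And>x. cubic_map.T cr x x x = 6 * poly_fun f x"
    using EKP_cubic_pair[OF assms(2-4)] by blast
  interpret irreducible_cubic_pair cr dr by fact
  \<comment> \<open>The union of the secant lines is already the whole hypersurface, so taking the
    closure adds nothing.\<close>
  have "zariski_closed (hypersurface f)"
    unfolding zariski_closed_def hypersurface_def using assms(3) by blast
  then have "secant_variety (rank1_points cr) = hypersurface f"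
    unfolding secant_variety_def secants_eq_hypersurface[OF f] by (rule hull_same)
  then show ?thesis using classical_severi[OF assms(1)] by (simp add: singular_locus_eq[OF f])
qed

end
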